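(* Let $r > 1/\sqrt{2}$, let $S^3_r$ be a three-dimensional sphere of radius $r$ in $\mathbb{R}^4$, and let $X \subset S^3_r$ be a finite set of Euclidean diameter $1$ with $|X| = n$. Let $G = G(X)$ be the diameter graph of $X$. Then: 1. $G$ has at most $2n-2$ edges. 2. $\chi(G) \le 4$, where $\chi(G)$ is the chromatic number of $G$. 3. Any two odd cycles in $G$ have a common vertex.
   Context: $S^3_r$ denotes the sphere $\{p\in\mathbb{R}^4 : \|p-c\| = r\}$ of radius $r$ (with some centre $c$). Distances and diameter are Euclidean (not geodesic). For a finite set $X$ of diameter $1$, the diameter graph $G(X)$ has vertex set $X$, and two points of $X$ are joined by an edge if and only if their Euclidean distance equals $1$. *)

theory Defs
  imports "HOL-Analysis.Analysis"
begin

text \<open>A simple graph is given by a vertex set \<open>V\<close> and a set \<open>E\<close> of two-element subsets of \<open>V\<close>.\<close>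

text \<open>Edge set of the diameter graph on the vertex set \<open>X\<close>; it is used for \<open>X\<close> of diameter 1,
  so the diameter is normalised to 1 here.\<close>

definition diameter_graph_edges :: "'a::metric_space set \<Rightarrow> 'a set set" where
  "diameter_graph_edges X = {{x, y} | x y. x \<in> X \<and> y \<in> X \<and> dist x y = 1}"

definition proper_colouring :: "'a set \<Rightarrow> 'a set set \<Rightarrow> nat \<Rightarrow> ('a \<Rightarrow> nat) \<Rightarrow> bool" where
  "proper_colouring V E k f \<longleftrightarrow>
     f ` V \<subseteq> {..<k} \<and> (\<forall>x y. {x, y} \<in> E \<longrightarrow> f x \<noteq> f y)"

text \<open>Meaningful for finite simple graphs only: \<open>LEAST\<close> is unspecified if no number of
  colours suffices, but an injective colouring of a finite simple graph is always proper.\<close>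

definition chromatic_number :: "'a set \<Rightarrow> 'a set set \<Rightarrow> nat" where
  "chromatic_number V E = (LEAST k. \<exists>f. proper_colouring V E k f)"

lemma ex_proper_colouring:
  assumes "finite V" and "\<And>x y. {x, y} \<in> E \<Longrightarrow> x \<in> V \<and> y \<in> V \<and> x \<noteq> y"
  shows "\<exists>f. proper_colouring V E (card V) f"
proof -
  obtain f where f: "bij_betw f V {0..<card V}"
    using ex_bij_betw_finite_nat[OF assms(1)] by blast
  have "f x \<noteq> f y" if "{x, y} \<in> E" for x y
    using assms(2)[OF that] f by (auto simp: bij_betw_def inj_on_def)
  moreover have "f ` V \<subseteq> {..<card V}"
    using f by (auto simp: bij_betw_def)
  ultimately show ?thesis
    unfolding proper_colouring_def by blast
qed

text \<open>A cycle is represented by the list of its vertices in cyclic order, without repeating the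
  starting vertex, so the length of the list is the length of the cycle.\<close>

definition graph_cycle :: "'a set \<Rightarrow> 'a set set \<Rightarrow> 'a list \<Rightarrow> bool" where
  "graph_cycle V E p \<longleftrightarrow>
     3 \<le> length p \<and> distinct p \<and> set p \<subseteq> V \<and>
     (\<forall>i<length p. {p ! i, p ! ((i + 1) mod length p)} \<in> E)"

definition odd_graph_cycle :: "'a set \<Rightarrow> 'a set set \<Rightarrow> 'a list \<Rightarrow> bool" where
  "odd_graph_cycle V E p \<longleftrightarrow> graph_cycle V E p \<and> odd (length p)"

end

theory Submission
  imports Defs "HOL-Analysis.Cross3"
begin

text \<open>After a translation and a scaling the points are unit vectors \<open>e x\<close> of \<open>\<real>\<^sup>4\<close>, any two of which have inner
product at least \<open>g = 1 - 1 / (2 * r\<^sup>2)\<close>, and \<open>x\<close>, \<open>y\<close> are adjacent iff their inner product equals \<open>g\<close>.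
The hypothesis on \<open>r\<close> says exactly that \<open>g\<close> is positive.

The proof carries Swanepoel's proof of Vazsonyi's conjecture from \<open>\<real>\<^sup>3\<close> to the three-sphere. In \<open>\<real>\<^sup>3\<close>
one translates all edge vectors to one common unit sphere. On the three-sphere, left multiplication by
unit quaternions takes the place of the translations: let \<open>d x y \<in> \<real>\<^sup>3\<close> be the imaginary part of
\<open>e x\<^sup>* e y\<close>, so that \<open>d y x = - d x y\<close>, and let \<open>R x\<close> be the convex cone generated by the vectors
\<open>d x y\<close> with \<open>y\<close> adjacent to \<open>x\<close>. For distinct \<open>x\<close>, \<open>y\<close> the cones \<open>R x\<close> and \<open>R y\<close> meet only in \<open>0\<close>,
and \<open>R x\<close> and \<open>- R y\<close> meet at most in the ray of \<open>d x y\<close>, and only if \<open>x\<close> and \<open>y\<close> are adjacent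
(\<open>spherical_cone_contacts\<close>). On the two-sphere the cones \<open>R x\<close> and \<open>- R x\<close> therefore cut out
convex polygons that touch in single points, one for each ordered pair of adjacent points; if \<open>y\<close> has
degree at least \<open>2\<close>, then \<open>d x y\<close> is a corner of the polygon of \<open>x\<close>. This is an antipodally symmetric
drawing of the bipartite double cover of the diameter graph.

\<^bold>\<open>Odd cycles.\<close> An odd cycle lifts to a closed polygon on the two-sphere that is mapped to itself by the
antipodal map and runs through the cones of its vertices. Any two antipodally symmetric closed polygons
meet (\<open>antipodal_polygons_meet\<close>), and a common point of the polygons of two odd cycles forces a common
vertex (\<open>odd_closed_walks_meet\<close>).

\<^bold>\<open>Edges.\<close> Vertices of degree at most \<open>2\<close> can be removed by induction. If all degrees are at least \<open>3\<close>,
let \<open>n\<close> be the number of vertices and \<open>m\<close> the number of edges. The polygons and their contacts form a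
bipartite plane graph with \<open>2 * n\<close> vertices, \<open>2 * m\<close> edges and faces of length at least \<open>4\<close>, so Euler's
formula would give \<open>2 * m \<le> 2 * (2 * n) - 4\<close>. The inequality in Euler's formula that is needed here is
obtained by counting modulo two. An element \<open>Z\<close> of the cycle space has a winding number modulo two, which is
constant along each face and jumps exactly across the edges in \<open>Z\<close>, so that \<open>Z\<close> can be recovered from it.
There are at least \<open>2\<close> to the power \<open>2 * m - 2 * n + 1\<close> such \<open>Z\<close>, and twice as many functions because
\<open>1\<close> can be added to each. On the other hand the functions modulo two that are constant along the faces
number at most \<open>2\<close> to the power \<open>4 * m / 4\<close>, since the \<open>4 * m\<close> sides are distributed among faces of
length at least \<open>4\<close>. Hence \<open>2 * m - 2 * n + 2 \<le> m\<close> (\<open>card_flags_le\<close>).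

\<^bold>\<open>Colouring.\<close> The edge bound holds for every nonempty subset of \<open>X\<close>, so every such subset contains a point
of degree at most \<open>3\<close> in it, and four colours suffice by induction.\<close>

section \<open>Determinants and cones in space\<close>

definition triple :: "real^3 \<Rightarrow> real^3 \<Rightarrow> real^3 \<Rightarrow> real" where
  "triple a b c = a \<bullet> cross3 b c"

definition cone2 :: "real^3 \<Rightarrow> real^3 \<Rightarrow> (real^3) set" where
  "cone2 a b = {\<alpha> *\<^sub>R a + \<beta> *\<^sub>R b | \<alpha> \<beta>. 0 \<le> \<alpha> \<and> 0 \<le> \<beta>}"

text \<open>Spherical triangles are handled as the open cones over them; likewise \<open>cone2 a b\<close> stands for the closed
great-circle arc from \<open>a\<close> to \<open>b\<close>.\<close>

definition in_tri :: "real^3 \<Rightarrow> real^3 \<Rightarrow> real^3 \<Rightarrow> real^3 \<Rightarrow> bool" where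
  "in_tri N a b p \<longleftrightarrow>
     (\<exists>\<alpha> \<beta> \<delta>. 0 < \<alpha> \<and> 0 < \<beta> \<and> 0 < \<delta> \<and> p = \<alpha> *\<^sub>R N + \<beta> *\<^sub>R a + \<delta> *\<^sub>R b)"

lemma triple_expand:
  "triple a b c = a$1 * (b$2 * c$3 - b$3 * c$2) + a$2 * (b$3 * c$1 - b$1 * c$3)
     + a$3 * (b$1 * c$2 - b$2 * c$1)"
  by (simp add: triple_def cross3_def inner_vec_def sum_3)

lemma triple_simps [simp]:
  "triple a a b = 0" "triple a b a = 0" "triple b a a = 0"
  "triple (a + a') b c = triple a b c + triple a' b c"
  "triple a (b + b') c = triple a b c + triple a b' c"
  "triple a b (c + c') = triple a b c + triple a b c'"
  "triple (k *\<^sub>R a) b c = k * triple a b c"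
  "triple a (k *\<^sub>R b) c = k * triple a b c"
  "triple a b (k *\<^sub>R c) = k * triple a b c"
  "triple (- a) b c = - triple a b c"
  "triple a (- b) c = - triple a b c"
  "triple a b (- c) = - triple a b c"
  "triple 0 b c = 0" "triple a 0 c = 0" "triple a b 0 = 0"
  by (simp_all add: triple_expand algebra_simps)

lemma triple_swap: "triple b a c = - triple a b c" "triple a c b = - triple a b c"
  by (simp_all add: triple_expand algebra_simps)

lemma triple_rotate: "triple b c a = triple a b c"
  by (simp add: triple_expand algebra_simps)

lemma triple_sum: "triple a b (sum f S) = (\<Sum>i\<in>S. triple a b (f i))"
  by (induction S rule: infinite_finite_induct) auto

lemma cramer3:
  "triple a b c *\<^sub>R p = triple p b c *\<^sub>R a + triple a p c *\<^sub>R b + triple a b p *\<^sub>R c"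
  by (simp add: vec_eq_iff forall_3 triple_expand algebra_simps)

lemma triple_coords:
  assumes "triple a b c \<noteq> 0"
  shows "p = (triple p b c / triple a b c) *\<^sub>R a + (triple a p c / triple a b c) *\<^sub>R b
     + (triple a b p / triple a b c) *\<^sub>R c"
proof -
  have "p = (1 / triple a b c) *\<^sub>R (triple a b c *\<^sub>R p)" using assms by simp
  also have "\<dots> = (1 / triple a b c) *\<^sub>R
      (triple p b c *\<^sub>R a + triple a p c *\<^sub>R b + triple a b p *\<^sub>R c)"
    by (subst cramer3) (rule refl)
  also have "\<dots> = (triple p b c / triple a b c) *\<^sub>R a + (triple a p c / triple a b c) *\<^sub>R b
     + (triple a b p / triple a b c) *\<^sub>R c"
    by (simp only: scaleR_right_distrib scaleR_scaleR times_divide_eq_left mult_1)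
  finally show ?thesis .
qed

lemma cone2_I: "\<lbrakk>x = \<alpha> *\<^sub>R a + \<beta> *\<^sub>R b; 0 \<le> \<alpha>; 0 \<le> \<beta>\<rbrakk> \<Longrightarrow> x \<in> cone2 a b"
  unfolding cone2_def by blast

lemma cone2_left: "0 \<le> k \<Longrightarrow> k *\<^sub>R a \<in> cone2 a b" "a \<in> cone2 a b"
  by (rule cone2_I[of _ k _ 0], simp_all) (rule cone2_I[of _ 1 _ 0], simp_all)

lemma in_tri_coords:
  assumes D: "triple N a b \<noteq> 0"
    and p: "p = x *\<^sub>R N + y *\<^sub>R a + z *\<^sub>R b"
  shows "in_tri N a b p \<longleftrightarrow> 0 < x \<and> 0 < y \<and> 0 < z"
proof
  assume "in_tri N a b p"
  then obtain x' y' z' where pos: "0 < x'" "0 < y'" "0 < z'"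
    and p': "p = x' *\<^sub>R N + y' *\<^sub>R a + z' *\<^sub>R b"
    unfolding in_tri_def by blast
  have "triple p a b = x * triple N a b" "triple N p b = y * triple N a b"
    "triple N a p = z * triple N a b" unfolding p by simp_all
  moreover have "triple p a b = x' * triple N a b" "triple N p b = y' * triple N a b"
    "triple N a p = z' * triple N a b" unfolding p' by simp_all
  ultimately have "x = x'" "y = y'" "z = z'" using D by simp_all
  then show "0 < x \<and> 0 < y \<and> 0 < z" using pos by simp
next
  assume "0 < x \<and> 0 < y \<and> 0 < z"
  then show "in_tri N a b p" unfolding in_tri_def using p by blast
qed


section \<open>Winding numbers modulo two of spherical polygons\<close>

text \<open>At the crossing with the first axis the first coordinate is the determinant of the two end points
divided by \<open>qb - pb\<close>; the right-hand side expresses that it is positive.\<close>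

lemma axis_crossing:
  fixes pa pb qa qb :: real
  assumes nz: "pb \<noteq> 0" "qb \<noteq> 0" and D: "pa * qb - qa * pb \<noteq> 0"
  shows "(\<exists>t. 0 \<le> t \<and> t \<le> 1 \<and> (1 - t) * pb + t * qb = 0 \<and> 0 \<le> (1 - t) * pa + t * qa)
     \<longleftrightarrow> pb * qb < 0 \<and> 0 < (pa * qb - qa * pb) * (qb - pb)"
proof
  assume "\<exists>t. 0 \<le> t \<and> t \<le> 1 \<and> (1 - t) * pb + t * qb = 0 \<and> 0 \<le> (1 - t) * pa + t * qa"
  then obtain t where t: "0 \<le> t" "t \<le> 1" "(1 - t) * pb + t * qb = 0"
    "0 \<le> (1 - t) * pa + t * qa" by blast
  have t0: "t \<noteq> 0" "t \<noteq> 1" using t nz by auto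
  have "((1 - t) * pb + t * qb) * qb = 0" using t(3) by simp
  then have "(1 - t) * (pb * qb) = - (t * (qb * qb))" by (simp add: algebra_simps)
  moreover have "0 < t * (qb * qb)"
  proof (rule mult_pos_pos)
    show "0 < t" using t0(1) t(1) by linarith
    show "0 < qb * qb" using nz(2) not_real_square_gt_zero[of qb] by blast
  qed
  ultimately have "(1 - t) * (pb * qb) < 0" by linarith
  then have opp: "pb * qb < 0" using t(2) by (simp add: mult_less_0_iff)
  have ne: "qb - pb \<noteq> 0" using opp by (auto simp: mult_less_0_iff)
  have "pb = t * (pb - qb)" using t(3) by (simp add: algebra_simps)
  have "((1 - t) * pa + t * qa) * (qb - pb) = pa * qb - qa * pb"
  proof -
    have tb: "t * (qb - pb) = - pb" using t(3) by (simp add: algebra_simps)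
    have "((1 - t) * pa + t * qa) * (qb - pb) = pa * (qb - pb) + (qa - pa) * (t * (qb - pb))"
      by (simp add: algebra_simps)
    also have "\<dots> = pa * qb - qa * pb" unfolding tb by (simp add: algebra_simps)
    finally show ?thesis .
  qed
  then have eq: "(pa * qb - qa * pb) * (qb - pb) = ((1 - t) * pa + t * qa) * (qb - pb)\<^sup>2"
    by (metis mult.assoc power2_eq_square)
  then have "0 \<le> (pa * qb - qa * pb) * (qb - pb)" using t(4) by simp
  moreover have "(pa * qb - qa * pb) * (qb - pb) \<noteq> 0" using D ne by simp
  ultimately show "pb * qb < 0 \<and> 0 < (pa * qb - qa * pb) * (qb - pb)" using opp by linarith
next
  assume h: "pb * qb < 0 \<and> 0 < (pa * qb - qa * pb) * (qb - pb)"
  then have ne: "qb - pb \<noteq> 0" by (auto simp: mult_less_0_iff)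
  define t where "t = - pb / (qb - pb)"
  have tb: "t * (qb - pb) = - pb" using ne by (simp add: t_def)
  have "0 \<le> t" "t \<le> 1" using h unfolding t_def
    by (auto simp: mult_less_0_iff divide_simps)
  moreover have "(1 - t) * pb + t * qb = 0" using tb by (simp add: algebra_simps)
  moreover have "0 \<le> (1 - t) * pa + t * qa"
  proof -
    have "((1 - t) * pa + t * qa) * (qb - pb) = pa * (qb - pb) + (qa - pa) * (t * (qb - pb))"
      by (simp add: algebra_simps)
    also have "\<dots> = pa * qb - qa * pb" unfolding tb by (simp add: algebra_simps)
    finally have "(pa * qb - qa * pb) * (qb - pb) = ((1 - t) * pa + t * qa) * (qb - pb)\<^sup>2"
      by (metis mult.assoc power2_eq_square)
    then have "0 < ((1 - t) * pa + t * qa) * (qb - pb)\<^sup>2" using h by simp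
    then show ?thesis using ne by (simp add: zero_less_mult_iff)
  qed
  ultimately show "\<exists>t. 0 \<le> t \<and> t \<le> 1 \<and> (1 - t) * pb + t * qb = 0 \<and> 0 \<le> (1 - t) * pa + t * qa"
    by blast
qed

text \<open>A segment in general position enters or leaves the open positive quadrant once for each of the
two boundary half-axes that it crosses.\<close>

lemma quadrant_crossing:
  fixes pa pb qa qb :: real
  assumes nz: "pa \<noteq> 0" "pb \<noteq> 0" "qa \<noteq> 0" "qb \<noteq> 0"
    and D: "pa * qb - qa * pb \<noteq> 0"
  shows "((0 < pa \<and> 0 < pb) \<noteq> (0 < qa \<and> 0 < qb)) \<longleftrightarrow>
     ((\<exists>t. 0 \<le> t \<and> t \<le> 1 \<and> (1 - t) * pb + t * qb = 0 \<and> 0 \<le> (1 - t) * pa + t * qa) \<noteq>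
      (\<exists>t. 0 \<le> t \<and> t \<le> 1 \<and> (1 - t) * pa + t * qa = 0 \<and> 0 \<le> (1 - t) * pb + t * qb))"
proof -
  have D': "pb * qa - qb * pa \<noteq> 0" using D by (simp add: mult.commute)
  have D'': "pb * qa - qb * pa = - (pa * qb - qa * pb)" by (simp add: mult.commute)
  have opp: "x * y < 0 \<longleftrightarrow> (0 < x) \<noteq> (0 < y)" if "x \<noteq> 0" "y \<noteq> 0" for x y :: real
    using that by (auto simp: mult_less_0_iff)
  have same: "0 < x * y \<longleftrightarrow> (0 < x) = (0 < y)" if "x \<noteq> 0" "y \<noteq> 0" for x y :: real
    using that by (auto simp: zero_less_mult_iff)
  have D1: "0 < pa * qb - qa * pb" if "(0 < pa) = (0 < qb)" "(0 < qa) \<noteq> (0 < pb)"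
    using that same[OF nz(1,4)] opp[OF nz(3,2)] by linarith
  have D2: "\<not> 0 < pa * qb - qa * pb" if "(0 < pa) \<noteq> (0 < qb)" "(0 < qa) = (0 < pb)"
    using that opp[OF nz(1,4)] same[OF nz(3,2)] by linarith
  have E1: "0 < (pa * qb - qa * pb) * (qb - pb) \<longleftrightarrow> (0 < pa * qb - qa * pb) = (0 < qb)"
    if "(0 < pb) \<noteq> (0 < qb)"
  proof -
    have "qb - pb \<noteq> 0" "0 < qb - pb \<longleftrightarrow> 0 < qb" using that nz by auto
    then show ?thesis using same[OF D] by blast
  qed
  have E2: "0 < - (pa * qb - qa * pb) * (qa - pa) \<longleftrightarrow> (0 < pa * qb - qa * pb) \<noteq> (0 < qa)"
    if "(0 < pa) \<noteq> (0 < qa)"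
  proof -
    have "qa - pa \<noteq> 0" "0 < qa - pa \<longleftrightarrow> 0 < qa" using that nz by auto
    then have "(pa * qb - qa * pb) * (qa - pa) < 0 \<longleftrightarrow> (0 < pa * qb - qa * pb) \<noteq> (0 < qa)"
      using opp[OF D] by blast
    then show ?thesis by (simp only: mult_minus_left neg_0_less_iff_less)
  qed
  show ?thesis
    unfolding axis_crossing[OF nz(2,4) D] axis_crossing[OF nz(1,3) D'] D''
      opp[OF nz(2,4)] opp[OF nz(1,3)]
    using D1 D2 E1 E2 by blast
qed

text \<open>The three-dimensional version, in barycentric coordinates of a triangle with apex \<open>N\<close>. On the part of
the segment where the coordinates of \<open>a\<close> and \<open>b\<close> are nonnegative, the coordinate of \<open>N\<close> does not
vanish, because the segment avoids the side opposite to \<open>N\<close>; hence it has a constant sign there. If it is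
positive, the claim reduces to the quadrant, and if it is negative, nothing is crossed.\<close>

lemma triangle_crossing_coords:
  fixes pN pa pb qN qa qb :: real
  assumes nz: "pa \<noteq> 0" "pb \<noteq> 0" "qa \<noteq> 0" "qb \<noteq> 0"
    and D: "pa * qb - qa * pb \<noteq> 0"
    and avoid: "\<And>t. \<lbrakk>0 \<le> t; t \<le> 1; (1 - t) * pN + t * qN = 0; 0 \<le> (1 - t) * pa + t * qa;
        0 \<le> (1 - t) * pb + t * qb\<rbrakk> \<Longrightarrow> False"
  shows "((0 < pN \<and> 0 < pa \<and> 0 < pb) \<noteq> (0 < qN \<and> 0 < qa \<and> 0 < qb)) \<longleftrightarrow>
     ((\<exists>t. 0 \<le> t \<and> t \<le> 1 \<and> (1 - t) * pb + t * qb = 0 \<and> 0 \<le> (1 - t) * pN + t * qN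
          \<and> 0 \<le> (1 - t) * pa + t * qa) \<noteq>
      (\<exists>t. 0 \<le> t \<and> t \<le> 1 \<and> (1 - t) * pa + t * qa = 0 \<and> 0 \<le> (1 - t) * pN + t * qN
          \<and> 0 \<le> (1 - t) * pb + t * qb))" (is "?L \<longleftrightarrow> ?R")
proof -
  define Q where "Q t \<longleftrightarrow> 0 \<le> t \<and> t \<le> 1 \<and> 0 \<le> (1 - t) * pa + t * qa \<and> 0 \<le> (1 - t) * pb + t * qb"
    for t
  \<comment> \<open>The coordinate of \<open>N\<close> has no zero on \<open>Q\<close>; \<open>Q\<close> is an interval, so the sign of \<open>h\<close> is constant there.\<close>
  define h where "h t = (1 - t) * pN + t * qN" for t
  have hne: "h t \<noteq> 0" if "Q t" for t using avoid[of t] that unfolding Q_def h_def by blast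
  have conv: "Q ((1 - k) * s + k * t)" if "Q s" "Q t" "0 \<le> k" "k \<le> 1" for s t k
  proof -
    have aff: "(1 - ((1 - k) * s + k * t)) * u + ((1 - k) * s + k * t) * v
        = (1 - k) * ((1 - s) * u + s * v) + k * ((1 - t) * u + t * v)" for u v :: real
      by (simp add: algebra_simps)
    have "(1 - k) * s + k * t \<le> (1 - k) * 1 + k * 1"
      using that unfolding Q_def by (intro add_mono mult_left_mono) auto
    then show ?thesis using that unfolding Q_def aff by auto
  qed
  have same: "0 < h t" if "Q s" "0 < h s" "Q t" for s t
  proof (rule ccontr)
    assume "\<not> 0 < h t"
    then have ht: "h t < 0" using hne[OF that(3)] by linarith
    define k where "k = h s / (h s - h t)"
    have k: "0 \<le> k" "k \<le> 1" unfolding k_def using that ht by (auto simp: divide_simps)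
    have "h ((1 - k) * s + k * t) = (1 - k) * h s + k * h t"
      unfolding h_def by (simp add: algebra_simps)
    also have "\<dots> = h s - k * (h s - h t)" by (simp add: algebra_simps)
    also have "\<dots> = 0" unfolding k_def using that ht by simp
    finally show False using hne[OF conv[OF that(1,3) k]] by simp
  qed
  have Q0: "Q 0 \<longleftrightarrow> 0 < pa \<and> 0 < pb" and Q1: "Q 1 \<longleftrightarrow> 0 < qa \<and> 0 < qb"
    using nz unfolding Q_def by auto
  have h01: "h 0 = pN" "h 1 = qN" unfolding h_def by auto
  show ?thesis
  proof (cases "\<exists>s. Q s \<and> 0 < h s")
    case True
    then have P: "0 < h t" if "Q t" for t using same that by blast
    have L: "?L \<longleftrightarrow> ((0 < pa \<and> 0 < pb) \<noteq> (0 < qa \<and> 0 < qb))"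
      using P[of 0] P[of 1] Q0 Q1 h01 by auto
    have N: "0 \<le> (1 - t) * pN + t * qN"
      if "0 \<le> t" "t \<le> 1" "0 \<le> (1 - t) * pa + t * qa" "0 \<le> (1 - t) * pb + t * qb" for t
      using P[of t] that unfolding Q_def h_def by linarith
    have b: "(\<exists>t. 0 \<le> t \<and> t \<le> 1 \<and> (1 - t) * pb + t * qb = 0 \<and> 0 \<le> (1 - t) * pN + t * qN
          \<and> 0 \<le> (1 - t) * pa + t * qa) \<longleftrightarrow>
        (\<exists>t. 0 \<le> t \<and> t \<le> 1 \<and> (1 - t) * pb + t * qb = 0 \<and> 0 \<le> (1 - t) * pa + t * qa)"
      by (intro arg_cong[where f=Ex] ext) (use N in auto)
    have a: "(\<exists>t. 0 \<le> t \<and> t \<le> 1 \<and> (1 - t) * pa + t * qa = 0 \<and> 0 \<le> (1 - t) * pN + t * qN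
          \<and> 0 \<le> (1 - t) * pb + t * qb) \<longleftrightarrow>
        (\<exists>t. 0 \<le> t \<and> t \<le> 1 \<and> (1 - t) * pa + t * qa = 0 \<and> 0 \<le> (1 - t) * pb + t * qb)"
      by (intro arg_cong[where f=Ex] ext) (use N in auto)
    show ?thesis using quadrant_crossing[OF nz D] unfolding L a b by blast
  next
    case False
    then have P: "h t < 0" if "Q t" for t using that hne[of t] by (meson linorder_neqE_linordered_idom)
    have "\<not> ?L" using P[of 0] P[of 1] Q0 Q1 h01 by auto
    moreover have "\<not> ?R" using P unfolding Q_def h_def
      by (metis linorder_not_less order_refl)
    ultimately show ?thesis by blast
  qed
qed

lemma triangle_crossing:
  assumes D: "triple N a b \<noteq> 0" and pq: "triple N p q \<noteq> 0"
    and g: "triple N p a \<noteq> 0" "triple N p b \<noteq> 0" "triple N q a \<noteq> 0" "triple N q b \<noteq> 0"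
    and avoid: "closed_segment p q \<inter> cone2 a b = {}"
  shows "(in_tri N a b p \<noteq> in_tri N a b q) \<longleftrightarrow>
    ((closed_segment p q \<inter> cone2 N a \<noteq> {}) \<noteq> (closed_segment p q \<inter> cone2 N b \<noteq> {}))"
proof -
  define pN pa pb where pc: "pN = triple p a b / triple N a b" "pa = triple N p b / triple N a b"
    "pb = triple N a p / triple N a b"
  define qN qa qb where qc: "qN = triple q a b / triple N a b" "qa = triple N q b / triple N a b"
    "qb = triple N a q / triple N a b"
  have p: "p = pN *\<^sub>R N + pa *\<^sub>R a + pb *\<^sub>R b" unfolding pc by (rule triple_coords[OF D])
  have q: "q = qN *\<^sub>R N + qa *\<^sub>R a + qb *\<^sub>R b" unfolding qc by (rule triple_coords[OF D])
  have nz: "pa \<noteq> 0" "pb \<noteq> 0" "qa \<noteq> 0" "qb \<noteq> 0"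
    using D g unfolding pc qc by (simp_all add: triple_swap(2)[of N _ a])
  have "triple N p q = (pa * qb - qa * pb) * triple N a b"
    unfolding p q by (simp add: algebra_simps triple_swap(2)[of N b a])
  then have D2: "pa * qb - qa * pb \<noteq> 0" using pq by auto
  have pt: "(1 - t) *\<^sub>R p + t *\<^sub>R q = ((1 - t) * pN + t * qN) *\<^sub>R N
      + ((1 - t) * pa + t * qa) *\<^sub>R a + ((1 - t) * pb + t * qb) *\<^sub>R b" for t
    unfolding p q by (simp add: algebra_simps)
  have uniq: "x *\<^sub>R N + y *\<^sub>R a + z *\<^sub>R b = x' *\<^sub>R N + y' *\<^sub>R a + z' *\<^sub>R b \<longleftrightarrow> x = x' \<and> y = y' \<and> z = z'"
    for x y z x' y' z'
  proof
    assume eq: "x *\<^sub>R N + y *\<^sub>R a + z *\<^sub>R b = x' *\<^sub>R N + y' *\<^sub>R a + z' *\<^sub>R b"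
    show "x = x' \<and> y = y' \<and> z = z'"
      using arg_cong[OF eq, of "\<lambda>u. triple u a b"] arg_cong[OF eq, of "\<lambda>u. triple N u b"]
        arg_cong[OF eq, of "\<lambda>u. triple N a u"] D by simp
  qed simp
  have meets_a: "closed_segment p q \<inter> cone2 N a \<noteq> {} \<longleftrightarrow>
     (\<exists>t. 0 \<le> t \<and> t \<le> 1 \<and> (1 - t) * pb + t * qb = 0 \<and> 0 \<le> (1 - t) * pN + t * qN
          \<and> 0 \<le> (1 - t) * pa + t * qa)" (is "?L = ?R")
  proof
    assume ?L
    then obtain t \<alpha> \<beta> where t: "0 \<le> t" "t \<le> 1" "0 \<le> \<alpha>" "0 \<le> \<beta>"
      and eq: "(1 - t) *\<^sub>R p + t *\<^sub>R q = \<alpha> *\<^sub>R N + \<beta> *\<^sub>R a"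
      unfolding cone2_def closed_segment_def by auto
    show ?R using t eq[unfolded pt] uniq[of _ _ _ \<alpha> \<beta> 0] by (intro exI[of _ t]) auto
  next
    assume ?R
    then obtain t where t: "0 \<le> t" "t \<le> 1" "(1 - t) * pb + t * qb = 0"
      "0 \<le> (1 - t) * pN + t * qN" "0 \<le> (1 - t) * pa + t * qa" by blast
    have "(1 - t) *\<^sub>R p + t *\<^sub>R q \<in> closed_segment p q"
      using t unfolding closed_segment_def by blast
    moreover have "(1 - t) *\<^sub>R p + t *\<^sub>R q \<in> cone2 N a"
      using t unfolding cone2_def pt[of t] by auto
    ultimately show ?L by blast
  qed
  have meets_b: "closed_segment p q \<inter> cone2 N b \<noteq> {} \<longleftrightarrow>
     (\<exists>t. 0 \<le> t \<and> t \<le> 1 \<and> (1 - t) * pa + t * qa = 0 \<and> 0 \<le> (1 - t) * pN + t * qN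
          \<and> 0 \<le> (1 - t) * pb + t * qb)" (is "?L = ?R")
  proof
    assume ?L
    then obtain t \<alpha> \<beta> where t: "0 \<le> t" "t \<le> 1" "0 \<le> \<alpha>" "0 \<le> \<beta>"
      and eq: "(1 - t) *\<^sub>R p + t *\<^sub>R q = \<alpha> *\<^sub>R N + \<beta> *\<^sub>R b"
      unfolding cone2_def closed_segment_def by auto
    show ?R using t eq[unfolded pt] uniq[of _ _ _ \<alpha> 0 \<beta>] by (intro exI[of _ t]) auto
  next
    assume ?R
    then obtain t where t: "0 \<le> t" "t \<le> 1" "(1 - t) * pa + t * qa = 0"
      "0 \<le> (1 - t) * pN + t * qN" "0 \<le> (1 - t) * pb + t * qb" by blast
    have "(1 - t) *\<^sub>R p + t *\<^sub>R q \<in> closed_segment p q"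
      using t unfolding closed_segment_def by blast
    moreover have "(1 - t) *\<^sub>R p + t *\<^sub>R q \<in> cone2 N b"
      using t unfolding cone2_def pt[of t] by auto
    ultimately show ?L by blast
  qed
  have av: False if "0 \<le> t" "t \<le> 1" "(1 - t) * pN + t * qN = 0" "0 \<le> (1 - t) * pa + t * qa"
        "0 \<le> (1 - t) * pb + t * qb" for t
  proof -
    have "(1 - t) *\<^sub>R p + t *\<^sub>R q \<in> closed_segment p q"
      using that unfolding closed_segment_def by blast
    moreover have "(1 - t) *\<^sub>R p + t *\<^sub>R q \<in> cone2 a b"
      using that unfolding cone2_def pt[of t] by auto
    ultimately show False using avoid by blast
  qed
  show ?thesis
    unfolding in_tri_coords[OF D p] in_tri_coords[OF D q] meets_a meets_b
    by (rule triangle_crossing_coords[OF nz D2 av])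
qed

text \<open>The union of the triangles \<open>(N, a i, b i)\<close> is a cone over the closed polygon with sides \<open>(a i, b i)\<close>,
so for \<open>p\<close> in general position the parity of the number of triangles that contain \<open>p\<close> is the winding
number modulo two of the polygon around \<open>p\<close>, normalised to vanish near \<open>- N\<close>.\<close>

definition winding :: "real^3 \<Rightarrow> ('i \<Rightarrow> real^3) \<Rightarrow> ('i \<Rightarrow> real^3) \<Rightarrow> 'i set \<Rightarrow> real^3 \<Rightarrow> nat" where
  "winding N a b I p = (\<Sum>i\<in>I. of_bool (in_tri N (a i) (b i) p))"

text \<open>The parity is unchanged along segments that avoid the polygon: crossing the meridian from \<open>N\<close> to a
vertex of the polygon enters or leaves one triangle for each side at this vertex, and the number of these
sides is even. Evenness is stated as evenness of all sums over the end points, which spares any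
counting of incidences.\<close>

lemma winding_segment:
  assumes I: "finite I"
    and closed: "\<And>g :: real^3 \<Rightarrow> nat. even (\<Sum>i\<in>I. g (a i) + g (b i))"
    and D: "\<And>i. i \<in> I \<Longrightarrow> triple N (a i) (b i) \<noteq> 0" and pq: "triple N p q \<noteq> 0"
    and g: "\<And>i. i \<in> I \<Longrightarrow> triple N p (a i) \<noteq> 0" "\<And>i. i \<in> I \<Longrightarrow> triple N p (b i) \<noteq> 0"
      "\<And>i. i \<in> I \<Longrightarrow> triple N q (a i) \<noteq> 0" "\<And>i. i \<in> I \<Longrightarrow> triple N q (b i) \<noteq> 0"
    and avoid: "\<And>i. i \<in> I \<Longrightarrow> closed_segment p q \<inter> cone2 (a i) (b i) = {}"
  shows "even (winding N a b I p) \<longleftrightarrow> even (winding N a b I q)"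
proof -
  define X :: "real^3 \<Rightarrow> nat" where "X v = of_bool (closed_segment p q \<inter> cone2 N v \<noteq> {})" for v
  have one: "even (of_bool (in_tri N (a i) (b i) p) + of_bool (in_tri N (a i) (b i) q)
      + (X (a i) + X (b i)))" if "i \<in> I" for i
    using triangle_crossing[OF D[OF that] pq g[OF that] avoid[OF that]]
    unfolding X_def by (auto simp: of_bool_def)
  have "even (\<Sum>i\<in>I. of_bool (in_tri N (a i) (b i) p) + of_bool (in_tri N (a i) (b i) q)
      + (X (a i) + X (b i)))"
    by (rule dvd_sum) (rule one)
  then have "even (winding N a b I p + winding N a b I q + (\<Sum>i\<in>I. X (a i) + X (b i)))"
    unfolding winding_def by (simp add: sum.distrib)
  then show ?thesis using closed[of X] by simp
qed

text \<open>Finitely many planes do not cover the space.\<close>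

lemma generic_pole:
  assumes W: "finite (W :: (real^3) set)"
  obtains N where "\<And>u v. \<lbrakk>u \<in> W; v \<in> W; cross3 u v \<noteq> 0\<rbrakk> \<Longrightarrow> triple N u v \<noteq> 0"
proof -
  define C where "C = (\<lambda>(u, v). cross3 u v) ` (W \<times> W) - {0}"
  have fin: "finite C" unfolding C_def using W by auto
  have "negligible (\<Union>c\<in>C. {x. c \<bullet> x = 0})"
    using fin by (intro negligible_Union) (auto simp: C_def intro!: negligible_hyperplane)
  then have "(\<Union>c\<in>C. {x. c \<bullet> x = 0}) \<noteq> UNIV" using non_negligible_UNIV by metis
  then obtain N where "\<forall>c\<in>C. c \<bullet> N \<noteq> 0" by blast
  then have "triple N u v \<noteq> 0" if "u \<in> W" "v \<in> W" "cross3 u v \<noteq> 0" for u v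
    using that unfolding C_def triple_def by (force simp: inner_commute)
  then show thesis using that by blast
qed

lemma cross3_eq_0_parallel:
  assumes "cross3 u v = 0" "u \<noteq> 0"
  obtains k where "v = k *\<^sub>R u"
proof -
  have "collinear {0, u, v}" using assms by (simp add: cross_eq_0)
  then show thesis using that assms(2) by (metis collinear_lemma scaleR_zero_left)
qed

section \<open>Two antipodal polygons meet\<close>

text \<open>The triangles over an arc with apexes \<open>N\<close> and \<open>- N\<close> together form the lune of \<open>a\<close> and \<open>b\<close>. The line
through \<open>p\<close> meets this lune iff the meridian plane of \<open>p\<close> separates \<open>a\<close> from \<open>b\<close>.\<close>

lemma in_tri_antipodal:
  assumes D: "triple N a b \<noteq> 0" and g: "triple N p a \<noteq> 0" "triple N p b \<noteq> 0"
    and avoid: "p \<notin> cone2 a b" "- p \<notin> cone2 a b"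
  shows "even (of_bool (in_tri N a b p) + of_bool (in_tri N a b (- p)) +
      (of_bool (in_tri N (- a) (- b) p) + of_bool (in_tri N (- a) (- b) (- p))) :: nat)
     \<longleftrightarrow> (0 < triple N p a) = (0 < triple N p b)"
proof -
  define x y z where c: "x = triple p a b / triple N a b" "y = triple N p b / triple N a b"
    "z = triple N a p / triple N a b"
  have p1: "p = x *\<^sub>R N + y *\<^sub>R a + z *\<^sub>R b" unfolding c by (rule triple_coords[OF D])
  have p2: "- p = (- x) *\<^sub>R N + (- y) *\<^sub>R a + (- z) *\<^sub>R b"
    by (subst p1) (simp add: algebra_simps)
  have p3: "p = x *\<^sub>R N + (- y) *\<^sub>R (- a) + (- z) *\<^sub>R (- b)" by (subst p1) simp
  have p4: "- p = (- x) *\<^sub>R N + y *\<^sub>R (- a) + z *\<^sub>R (- b)"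
    by (subst p1) (simp add: algebra_simps)
  have D': "triple N (- a) (- b) \<noteq> 0" using D by simp
  have yz: "y \<noteq> 0" "z \<noteq> 0" using D g unfolding c by (auto simp: triple_swap(2)[of N _ a])
  have "\<not> (x = 0 \<and> 0 < y \<and> 0 < z)"
  proof
    assume "x = 0 \<and> 0 < y \<and> 0 < z"
    then have "\<exists>\<alpha> \<beta>. p = \<alpha> *\<^sub>R a + \<beta> *\<^sub>R b \<and> 0 \<le> \<alpha> \<and> 0 \<le> \<beta>"
      using p1 by (intro exI[of _ y] exI[of _ z]) auto
    then show False using avoid(1) unfolding cone2_def by blast
  qed
  moreover have "\<not> (x = 0 \<and> y < 0 \<and> z < 0)"
  proof
    assume "x = 0 \<and> y < 0 \<and> z < 0"
    then have "\<exists>\<alpha> \<beta>. - p = \<alpha> *\<^sub>R a + \<beta> *\<^sub>R b \<and> 0 \<le> \<alpha> \<and> 0 \<le> \<beta>"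
      using p2 by (intro exI[of _ "- y"] exI[of _ "- z"]) auto
    then show False using avoid(2) unfolding cone2_def by blast
  qed
  moreover have "(0 < triple N p a) = (0 < triple N p b) \<longleftrightarrow> (0 < y) \<noteq> (0 < z)"
  proof -
    have "triple N p b = y * triple N a b" "triple N p a = - (z * triple N a b)"
      using D unfolding c by (simp_all add: triple_swap(2)[of N p a])
    then show ?thesis using D yz
      by (cases "0 < triple N a b"; cases "0 < y"; cases "0 < z")
         (auto simp: zero_less_mult_iff mult_less_0_iff)
  qed
  ultimately show ?thesis
    unfolding in_tri_coords[OF D p1] in_tri_coords[OF D p2] in_tri_coords[OF D' p3]
      in_tri_coords[OF D' p4]
    using yz by (cases "0 < y"; cases "0 < z"; cases "0 < x"; cases "x = 0") auto
qed

lemma even_sign_changes: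
  fixes s :: "nat \<Rightarrow> bool"
  shows "even (\<Sum>i<(n::nat). of_bool (s i \<noteq> s (Suc i)) :: nat) \<longleftrightarrow> s 0 = s n"
  by (induction n) (auto simp: of_bool_def)

lemma even_sum_cong:
  fixes f g :: "'i \<Rightarrow> nat"
  assumes "\<And>i. i \<in> I \<Longrightarrow> even (f i) \<longleftrightarrow> even (g i)"
  shows "even (sum f I) \<longleftrightarrow> even (sum g I)"
  using assms by (induction I rule: infinite_finite_induct) auto

text \<open>If the polygons were disjoint, the winding number of the first would be constant along the second, in
particular equal at \<open>u 0\<close> and \<open>- u 0\<close>. But the two values differ: modulo two, their sum counts how often the first
polygon changes sides of the meridian plane of \<open>u 0\<close> while it runs from \<open>w 0\<close> to \<open>- w 0\<close>.\<close>

theorem antipodal_polygons_meet: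
  fixes w u :: "nat \<Rightarrow> real^3"
  assumes wL: "\<And>i. w (i + L) = - w i" and uM: "\<And>j. u (j + M) = - u j"
    and w: "\<And>i. cross3 (w i) (w (Suc i)) \<noteq> 0" and u: "\<And>j. cross3 (u j) (u (Suc j)) \<noteq> 0"
  obtains i j x where "x \<noteq> 0" "x \<in> cone2 (w i) (w (Suc i))" "x \<in> cone2 (u j) (u (Suc j))"
proof (rule ccontr)
  assume not: "\<not> thesis"
  note meets = that
  have dis: "x = 0" if "x \<in> cone2 (w i) (w (Suc i))" "x \<in> cone2 (u j) (u (Suc j))" for x i j
    using meets not that by blast
  have w0: "w i \<noteq> 0" for i using w[of i] by auto
  have u0: "u i \<noteq> 0" for i using u[of i] by auto
  have wper: "w (i + k * (2 * L)) = w i" for i k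
  proof (induction k)
    case (Suc k)
    have "w (i + Suc k * (2 * L)) = w ((i + k * (2 * L) + L) + L)" by (simp add: algebra_simps)
    also have "\<dots> = w i" unfolding wL using Suc by simp
    finally show ?case .
  qed simp
  have uper: "u (i + k * (2 * M)) = u i" for i k
  proof (induction k)
    case (Suc k)
    have "u (i + Suc k * (2 * M)) = u ((i + k * (2 * M) + M) + M)" by (simp add: algebra_simps)
    also have "\<dots> = u i" unfolding uM using Suc by simp
    finally show ?case .
  qed simp
  have "L \<noteq> 0" using wL[of 0] w0[of 0] by (intro notI) (simp add: eq_neg_iff_add_eq_0 flip: scaleR_2)
  have "M \<noteq> 0" using uM[of 0] u0[of 0] by (intro notI) (simp add: eq_neg_iff_add_eq_0 flip: scaleR_2)
  define W where "W = w ` {..<2*L} \<union> u ` {..<2*M}"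
  have wW: "w i \<in> W" for i
  proof -
    have "w i = w (i mod (2*L))" using wper[of "i mod (2*L)" "i div (2*L)"] by (simp only: mod_div_mult_eq)
    then show ?thesis unfolding W_def using \<open>L \<noteq> 0\<close> by auto
  qed
  have uW: "u i \<in> W" for i
  proof -
    have "u i = u (i mod (2*M))" using uper[of "i mod (2*M)" "i div (2*M)"] by (simp only: mod_div_mult_eq)
    then show ?thesis unfolding W_def using \<open>M \<noteq> 0\<close> by auto
  qed
  have "finite W" unfolding W_def by simp
  then obtain N where N: "\<And>a b. \<lbrakk>a \<in> W; b \<in> W; cross3 a b \<noteq> 0\<rbrakk> \<Longrightarrow> triple N a b \<noteq> 0"
    using generic_pole[of W] by metis
  \<comment> \<open>A vertex of one polygon on the line of a vertex of the other would be a common point, possibly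
    after replacing the latter by its antipode.\<close>
  have uw_cross: "cross3 (u j) (w i) \<noteq> 0" for i j
  proof
    assume "cross3 (u j) (w i) = 0"
    then obtain k where k: "w i = k *\<^sub>R u j" using cross3_eq_0_parallel u0 by metis
    show False
    proof (cases "0 \<le> k")
      case True
      then have "w i \<in> cone2 (u j) (u (Suc j))" using cone2_left(1) k by metis
      then show False using dis cone2_left(2)[of "w i"] w0 by blast
    next
      case False
      then have "w i = (- k) *\<^sub>R u (j + M)" using k uM by simp
      then have "w i \<in> cone2 (u (j + M)) (u (Suc (j + M)))" using cone2_left(1) False
        by (metis neg_0_le_iff_le linear)
      then show False using dis cone2_left(2)[of "w i"] w0 by blast
    qed
  qed
  note uw = N[OF uW wW uw_cross] and ww = N[OF wW wW w] and uu = N[OF uW uW u]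
  define f where "f = winding N w (\<lambda>i. w (Suc i)) {..<2*L}"
  have closed: "even (\<Sum>i<2*L. g (w i) + g (w (Suc i)))" for g :: "real^3 \<Rightarrow> nat"
  proof -
    have "w (2 * L) = w 0" using wper[of 0 1] by simp
    then have "(\<Sum>i<2*L. g (w (Suc i))) = (\<Sum>i<2*L. g (w i))"
      using sum.lessThan_Suc[of "\<lambda>i. g (w i)" "2*L"]
        sum.lessThan_Suc_shift[of "\<lambda>i. g (w i)" "2*L"] by simp
    then show ?thesis by (simp add: sum.distrib)
  qed
  have step: "even (f (u j)) \<longleftrightarrow> even (f (u (Suc j)))" for j
    unfolding f_def
  proof (rule winding_segment)
    fix i
    show "closed_segment (u j) (u (Suc j)) \<inter> cone2 (w i) (w (Suc i)) = {}"
    proof (intro equals0I, elim IntE)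
      fix x assume x: "x \<in> closed_segment (u j) (u (Suc j))" "x \<in> cone2 (w i) (w (Suc i))"
      then obtain t where t: "0 \<le> t" "t \<le> 1" "x = (1 - t) *\<^sub>R u j + t *\<^sub>R u (Suc j)"
        unfolding closed_segment_def by blast
      then have "x \<in> cone2 (u j) (u (Suc j))" by (intro cone2_I[of _ "1 - t" _ t]) auto
      then have x0: "x = 0" using dis x(2) by blast
      have "triple N (u j) x = t * triple N (u j) (u (Suc j))" unfolding t by simp
      then have "t = 0" using x0 uu by simp
      then show False using t x0 u0 by simp
    qed
  qed (auto simp: closed uw ww uu)
  have const: "even (f (u j)) \<longleftrightarrow> even (f (u 0))" for j
    by (induction j) (use step in auto)
  define p where "p = u 0"
  have "even (f p + f (- p))" using const[of M] uM[of 0] unfolding p_def by simp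
  moreover have "odd (f p + f (- p))"
  proof -
    define h :: "nat \<Rightarrow> nat" where "h i = of_bool (in_tri N (w i) (w (Suc i)) p)
       + of_bool (in_tri N (w i) (w (Suc i)) (- p))" for i
    have "f p + f (- p) = (\<Sum>i<2*L. h i)"
      unfolding f_def winding_def h_def by (simp add: sum.distrib)
    also have "\<dots> = (\<Sum>i<L. h i) + (\<Sum>i<L. h (i + L))"
      using sum.nat_group[of h L 2]
      by (simp add: mult.commute numeral_2_eq_2 atLeast0LessThan
          sum.shift_bounds_nat_ivl[of h 0 L L, simplified atLeast0LessThan add_0])
    also have "\<dots> = (\<Sum>i<L. h i + h (i + L))" by (simp add: sum.distrib)
    finally have fp: "f p + f (- p) = (\<Sum>i<L. h i + h (i + L))" .
    define s where "s i \<longleftrightarrow> 0 < triple N p (w i)" for i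
    have h: "even (h i + h (i + L)) \<longleftrightarrow> s i = s (Suc i)" for i
    proof -
      \<comment> \<open>The arcs \<open>i\<close> and \<open>i + L\<close> are antipodal, so their triangles, taken at \<open>p\<close> and \<open>- p\<close>,
        form the lune of the arc \<open>i\<close>.\<close>
      have sL: "Suc (i + L) = Suc i + L" by simp
      have "p \<notin> cone2 (w i) (w (Suc i))"
        using dis[of p i 0] cone2_left(2)[of p] u0 unfolding p_def by blast
      moreover have "- p \<notin> cone2 (w i) (w (Suc i))"
        using dis[of "- p" i M] cone2_left(2)[of "- p"] u0[of 0] uM[of 0] unfolding p_def by auto
      ultimately show ?thesis
        unfolding h_def s_def sL wL
        by (intro in_tri_antipodal) (use ww uw in \<open>auto simp: p_def\<close>)
    qed
    have "even (\<Sum>i<L. h i + h (i + L)) \<longleftrightarrow> even (\<Sum>i<L. of_bool (s i \<noteq> s (Suc i)) :: nat)"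
      by (rule even_sum_cong) (use h in auto)
    also have "\<dots> \<longleftrightarrow> s 0 = s L" by (rule even_sign_changes)
    also have "\<not> (s 0 = s L)"
      using wL[of 0] uw[of 0 0] unfolding s_def p_def by auto
    finally show ?thesis unfolding fp by blast
  qed
  ultimately show False by blast
qed

section \<open>Crossing the two sectors at a contact point\<close>

lemma planar_pluecker:
  "triple z a b * triple z c e = triple z a c * triple z b e - triple z a e * triple z b c"
  using arg_cong[OF cramer3[of z a b c], of "\<lambda>u. triple z u e"] triple_swap(2)[of z b c]
  by (simp add: algebra_simps)

text \<open>The direction \<open>e\<close> lies in the open sector spanned by \<open>N\<close> and \<open>r\<close>, in the plane of directions at \<open>z\<close>.\<close>

definition in_sector :: "real^3 \<Rightarrow> real^3 \<Rightarrow> real^3 \<Rightarrow> real^3 \<Rightarrow> bool" where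
  "in_sector z N r e \<longleftrightarrow> 0 < triple z e r * triple z N r \<and> 0 < triple z N e * triple z N r"

text \<open>The signs of products, in a form suited to linear arithmetic.\<close>

lemma sign_table:
  fixes x y :: real
  shows "(0 < x \<and> 0 < y \<longrightarrow> 0 < x * y) \<and> (0 < x \<and> y < 0 \<longrightarrow> x * y < 0) \<and>
    (x < 0 \<and> 0 < y \<longrightarrow> x * y < 0) \<and> (x < 0 \<and> y < 0 \<longrightarrow> 0 < x * y) \<and>
    (x = 0 \<or> y = 0 \<longrightarrow> x * y = 0)"
  by (simp add: mult_pos_pos mult_pos_neg mult_neg_pos mult_neg_neg)

text \<open>In this lemma and the next, \<open>A\<close>, \<open>B\<close>, \<open>C\<close>, \<open>p\<close>, \<open>q\<close>, \<open>s\<close> are the determinants of the pairs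
\<open>(N, r)\<close>, \<open>(N, r')\<close>, \<open>(r, r')\<close>, \<open>(N, e)\<close>, \<open>(r, e)\<close>, \<open>(r', e)\<close> in the plane of directions, and the left-hand
side says that \<open>e\<close> lies in exactly one of the sectors \<open>(N, r)\<close> and \<open>(N, r')\<close>. Three rays cut the
plane into sectors, so for given rays this depends only on whether \<open>e\<close> lies in the sector \<open>(r, r')\<close>. The case \<open>C = 0\<close>,
where \<open>r\<close> and \<open>r'\<close> are opposite, has to be included.\<close>

lemma ray_inside:
  fixes A B C p q s :: real
  assumes "A \<noteq> 0" "B \<noteq> 0" "p \<noteq> 0" and C: "0 < C \<or> C = 0 \<and> A * B < 0"
    and k: "p * C = B * q - A * s" and "0 < q" "s < 0"
  shows "((0 < - q * A \<and> 0 < p * A) \<noteq> (0 < - s * B \<and> 0 < p * B)) \<longleftrightarrow> \<not> (0 < A \<and> B < 0)"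
proof -
  note t = assms(1-3,5-7) sign_table[of p C] sign_table[of B q] sign_table[of A s]
    sign_table[of "- q" A] sign_table[of p A] sign_table[of "- s" B] sign_table[of p B]
    sign_table[of A B]
  show ?thesis
  proof (cases "0 < C")
    case True
    then show ?thesis using t by (smt (verit))
  next
    case False
    then show ?thesis using t assms(4) by (smt (verit))
  qed
qed

lemma ray_outside:
  fixes A B C p q s :: real
  assumes "A \<noteq> 0" "B \<noteq> 0" "p \<noteq> 0" and C: "0 < C \<or> C = 0 \<and> A * B < 0"
    and k: "p * C = B * q - A * s" and "q < 0 \<or> 0 < s"
  shows "((0 < - q * A \<and> 0 < p * A) \<noteq> (0 < - s * B \<and> 0 < p * B)) \<longleftrightarrow> 0 < A \<and> B < 0"
proof -
  note t = assms(1-3,5) sign_table[of p C] sign_table[of B q] sign_table[of A s] sign_table[of "- q" A]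
    sign_table[of p A] sign_table[of "- s" B] sign_table[of p B] sign_table[of A B]
  show ?thesis
  proof (cases "0 < C")
    case True
    then show ?thesis using t assms(6) by (smt (verit))
  next
    case False
    then show ?thesis using t assms(4,6) by (smt (verit))
  qed
qed

text \<open>Two polygons touch at \<open>z\<close>. In counterclockwise order the directions at \<open>z\<close> are \<open>e2\<close>, \<open>r\<close>, \<open>e1\<close> in the
first polygon and \<open>e3\<close>, \<open>r'\<close>, \<open>e4\<close> in the second one, where the \<open>ei\<close> are the sides and \<open>r\<close>, \<open>r'\<close> point to the
interior. So \<open>e1\<close> and \<open>e3\<close> bound one gap, \<open>e4\<close> and \<open>e2\<close> the other, and the path \<open>r\<close>, \<open>z\<close>, \<open>r'\<close> separates the
gaps: a winding number jumps between the gaps if this path belongs to the curve. The assumptions \<open>D1\<close> and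
\<open>D2\<close> say that the two polygons do not overlap.\<close>

lemma gap_crossing:
  assumes N: "triple z N e1 \<noteq> 0" "triple z N e2 \<noteq> 0" "triple z N e3 \<noteq> 0" "triple z N e4 \<noteq> 0"
      "triple z N r \<noteq> 0" "triple z N r' \<noteq> 0"
    and w: "0 < triple z e2 r" "0 < triple z r e1" "0 < triple z e2 e1"
    and w': "0 < triple z e3 r'" "0 < triple z r' e4" "0 < triple z e3 e4"
    and D1: "\<not> (0 \<le> triple z e2 r' \<and> 0 \<le> triple z r' e1)"
    and D2: "\<not> (0 \<le> triple z e3 r \<and> 0 \<le> triple z r e4)"
  defines "P \<equiv> \<lambda>e. in_sector z N r e \<noteq> in_sector z N r' e"
  shows "P e1 = P e3 \<and> P e4 = P e2 \<and> P e1 \<noteq> P e2"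
proof -
  let ?b = "triple z"
  have sw: "?b u v = - ?b v u" for u v by (rule triple_swap(2))
  define A B C where "A = ?b N r" and "B = ?b N r'" and "C = ?b r r'"
  have k: "?b N e * C = B * ?b r e - A * ?b r' e" for e
    using planar_pluecker[of z N e r r'] sw[of e] unfolding A_def B_def C_def by simp
  have k': "?b N e * (- C) = A * ?b r' e - B * ?b r e" for e using k[of e] by simp
  have P: "P e \<longleftrightarrow> ((0 < - ?b r e * A \<and> 0 < ?b N e * A) \<noteq> (0 < - ?b r' e * B \<and> 0 < ?b N e * B))" for e
    unfolding P_def in_sector_def A_def B_def sw[of e] by blast
  have P': "P e \<longleftrightarrow> ((0 < - ?b r' e * B \<and> 0 < ?b N e * B) \<noteq> (0 < - ?b r e * A \<and> 0 < ?b N e * A))" for e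
    unfolding P by blast
  have AB: "A \<noteq> 0" "B \<noteq> 0" using N unfolding A_def B_def by auto
  \<comment> \<open>According to the sign of \<open>C\<close> the sector \<open>(r, r')\<close> contains \<open>e1\<close>, \<open>e3\<close> or \<open>e2\<close>, \<open>e4\<close>.\<close>
  consider "0 < C" | "C = 0" | "0 < - C" by linarith
  then show ?thesis
  proof cases
    case 1
    have s1: "?b r' e1 < 0"
    proof (rule ccontr)
      assume "\<not> ?b r' e1 < 0"
      moreover have "?b e2 r' * ?b r e1 = ?b e2 r * ?b r' e1 + ?b e2 e1 * ?b r r'"
        using planar_pluecker[of z e2 r' r e1] sw[of r' r] by simp
      ultimately have "0 < ?b e2 r' * ?b r e1" using w 1 unfolding C_def
        by (simp add: add_nonneg_pos)
      then show False using D1 \<open>\<not> ?b r' e1 < 0\<close> w(2) by (simp add: zero_less_mult_iff)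
    qed
    have q3: "0 < ?b r e3"
    proof (rule ccontr)
      assume "\<not> 0 < ?b r e3"
      then have n: "0 \<le> ?b e3 r" using sw[of r e3] by simp
      moreover have "?b r e4 * ?b e3 r' = ?b r r' * ?b e3 e4 + ?b e3 r * ?b r' e4"
        using planar_pluecker[of z r e4 e3 r'] sw[of e4 e3] sw[of e4 r'] sw[of r e3] by simp
      ultimately have "0 < ?b r e4 * ?b e3 r'" using w' 1 unfolding C_def
        by (simp add: add_pos_nonneg)
      then show False using D2 n w'(1) by (simp add: zero_less_mult_iff)
    qed
    have s3: "?b r' e3 < 0" using w'(1) sw[of r' e3] by simp
    have q2: "?b r e2 < 0" using w(1) sw[of r e2] by simp
    have C: "0 < C \<or> C = 0 \<and> A * B < 0" using 1 by blast
    have "P e1 \<longleftrightarrow> \<not> (0 < A \<and> B < 0)" unfolding P by (rule ray_inside[OF AB N(1) C k w(2) s1])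
    moreover have "P e3 \<longleftrightarrow> \<not> (0 < A \<and> B < 0)" unfolding P by (rule ray_inside[OF AB N(3) C k q3 s3])
    moreover have "P e2 \<longleftrightarrow> 0 < A \<and> B < 0" unfolding P using q2 by (intro ray_outside[OF AB N(2) C k]) simp
    moreover have "P e4 \<longleftrightarrow> 0 < A \<and> B < 0" unfolding P using w'(2) by (intro ray_outside[OF AB N(4) C k]) simp
    ultimately show ?thesis by blast
  next
    case 2
    have eq: "B * ?b r e = A * ?b r' e" for e using k[of e] 2 by simp
    have q2: "?b r e2 < 0" using w(1) sw[of r e2] by simp
    have s3: "?b r' e3 < 0" using w'(1) sw[of r' e3] by simp
    have ABneg: "A * B < 0"
    proof (rule ccontr)
      assume "\<not> A * B < 0"
      then have "0 < A * B" using AB by (metis linorder_neqE_linordered_idom mult_eq_0_iff)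
      then have "0 < ?b r' e1" "?b r' e2 < 0"
        using eq[of e1] eq[of e2] w(2) q2 AB
          sign_table[of B "?b r e1"] sign_table[of A "?b r' e1"] sign_table[of B "?b r e2"]
          sign_table[of A "?b r' e2"] sign_table[of A B]
        by (smt (verit))+
      then show False using D1 sw[of e2 r'] by simp
    qed
    have C: "0 < C \<or> C = 0 \<and> A * B < 0" using 2 ABneg by blast
    have s1: "?b r' e1 < 0" 
      using eq[of e1] w(2) ABneg sign_table[of B "?b r e1"] sign_table[of A "?b r' e1"]
        sign_table[of A B] by (smt (verit))
    have q3: "0 < ?b r e3"
      using eq[of e3] s3 ABneg sign_table[of B "?b r e3"] sign_table[of A "?b r' e3"]
        sign_table[of A B] by (smt (verit))
    have "P e1 \<longleftrightarrow> \<not> (0 < A \<and> B < 0)" unfolding P by (rule ray_inside[OF AB N(1) C k w(2) s1])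
    moreover have "P e3 \<longleftrightarrow> \<not> (0 < A \<and> B < 0)" unfolding P by (rule ray_inside[OF AB N(3) C k q3 s3])
    moreover have "P e2 \<longleftrightarrow> 0 < A \<and> B < 0" unfolding P using q2 by (intro ray_outside[OF AB N(2) C k]) simp
    moreover have "P e4 \<longleftrightarrow> 0 < A \<and> B < 0" unfolding P using w'(2) by (intro ray_outside[OF AB N(4) C k]) simp
    ultimately show ?thesis by blast
  next
    case 3
    have C': "- C = ?b r' r" unfolding C_def using sw[of r' r] by simp
    have s2: "0 < ?b r' e2"
    proof (rule ccontr)
      assume "\<not> 0 < ?b r' e2"
      then have n: "0 \<le> ?b e2 r'" using sw[of r' e2] by simp
      moreover have "?b r' e1 * ?b e2 r = ?b r' r * ?b e2 e1 + ?b e2 r' * ?b r e1"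
        using planar_pluecker[of z r' e1 e2 r] sw[of e1 e2] sw[of e1 r] sw[of r' e2] by simp
      ultimately have "0 < ?b r' e1 * ?b e2 r" using w 3 unfolding C'
        by (simp add: add_pos_nonneg)
      then show False using D1 n w(1) by (simp add: zero_less_mult_iff)
    qed
    have q4: "?b r e4 < 0"
    proof (rule ccontr)
      assume "\<not> ?b r e4 < 0"
      moreover have "?b e3 r * ?b r' e4 = ?b e3 r' * ?b r e4 + ?b e3 e4 * ?b r' r"
        using planar_pluecker[of z e3 r r' e4] sw[of r r'] by simp
      ultimately have "0 < ?b e3 r * ?b r' e4" using w' 3 unfolding C'
        by (simp add: add_nonneg_pos)
      then show False using D2 \<open>\<not> ?b r e4 < 0\<close> w'(2) by (simp add: zero_less_mult_iff)
    qed
    have q2: "?b r e2 < 0" using w(1) sw[of r e2] by simp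
    have s3: "?b r' e3 < 0" using w'(1) sw[of r' e3] by simp
    have C: "0 < - C \<or> - C = 0 \<and> B * A < 0" using 3 by blast
    note BA = AB(2,1)
    have "P e2 \<longleftrightarrow> \<not> (0 < B \<and> A < 0)" unfolding P' by (rule ray_inside[OF BA N(2) C k' s2 q2])
    moreover have "P e4 \<longleftrightarrow> \<not> (0 < B \<and> A < 0)" unfolding P' by (rule ray_inside[OF BA N(4) C k' w'(2) q4])
    moreover have "P e1 \<longleftrightarrow> 0 < B \<and> A < 0" unfolding P' using w(2) by (intro ray_outside[OF BA N(1) C k']) simp
    moreover have "P e3 \<longleftrightarrow> 0 < B \<and> A < 0" unfolding P' using s3 by (intro ray_outside[OF BA N(3) C k']) simp
    ultimately show ?thesis by blast
  qed
qed

lemma eventually_affine_pos: "0 < a \<Longrightarrow> \<forall>\<^sub>F \<epsilon> in at_right 0. 0 < a + \<epsilon> * b" for a b :: real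
proof -
  assume a: "0 < a"
  have "((\<lambda>\<epsilon>. a + \<epsilon> * b) \<longlongrightarrow> a + 0 * b) (at_right 0)" by (intro tendsto_intros)
  then show ?thesis using a by (simp add: order_tendstoD)
qed

lemma eventually_affine_neg: "a < 0 \<Longrightarrow> \<forall>\<^sub>F \<epsilon> in at_right 0. a + \<epsilon> * b < 0" for a b :: real
  using eventually_affine_pos[of "- a" "- b"] by (auto elim!: eventually_mono)

lemma eventually_affine_nonzero:
  "a \<noteq> 0 \<Longrightarrow> \<forall>\<^sub>F \<epsilon> in at_right 0. a + \<epsilon> * b \<noteq> 0" for a b :: real
  using eventually_affine_pos[of a b] eventually_affine_neg[of a b]
  by (cases "0 < a") (auto elim!: eventually_mono)

text \<open>Points off the boundary of a triangle have a neighbourhood on one side of it.\<close>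

lemma in_tri_near:
  assumes D: "triple N a b \<noteq> 0" and off: "z \<notin> cone2 a b" "z \<notin> cone2 N a" "z \<notin> cone2 N b"
  shows "\<forall>\<^sub>F \<epsilon> in at_right 0. in_tri N a b (z + \<epsilon> *\<^sub>R e) \<longleftrightarrow> in_tri N a b z"
proof -
  define x y w where c: "x = triple z a b / triple N a b" "y = triple N z b / triple N a b"
    "w = triple N a z / triple N a b"
  define x' y' w' where c': "x' = triple e a b / triple N a b" "y' = triple N e b / triple N a b"
    "w' = triple N a e / triple N a b"
  have z: "z = x *\<^sub>R N + y *\<^sub>R a + w *\<^sub>R b" unfolding c by (rule triple_coords[OF D])
  have e: "e = x' *\<^sub>R N + y' *\<^sub>R a + w' *\<^sub>R b" unfolding c' by (rule triple_coords[OF D])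
  have ze: "z + \<epsilon> *\<^sub>R e = (x + \<epsilon> * x') *\<^sub>R N + (y + \<epsilon> * y') *\<^sub>R a + (w + \<epsilon> * w') *\<^sub>R b" for \<epsilon>
    by (subst z, subst e) (simp add: algebra_simps)
  have nz: "x \<noteq> 0 \<or> y < 0 \<or> w < 0" "w \<noteq> 0 \<or> x < 0 \<or> y < 0" "y \<noteq> 0 \<or> x < 0 \<or> w < 0"
    using off z cone2_I[of z y a w b] cone2_I[of z x N y a] cone2_I[of z x N w b]
    by (metis add.left_neutral add.right_neutral linorder_not_le scaleR_zero_left)+
  show ?thesis
    unfolding in_tri_coords[OF D z] in_tri_coords[OF D ze]
  proof (cases "0 < x \<and> 0 < y \<and> 0 < w")
    case True
    then have "\<forall>\<^sub>F \<epsilon> in at_right 0. 0 < x + \<epsilon> * x'" "\<forall>\<^sub>F \<epsilon> in at_right 0. 0 < y + \<epsilon> * y'"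
      "\<forall>\<^sub>F \<epsilon> in at_right 0. 0 < w + \<epsilon> * w'" by (simp_all add: eventually_affine_pos)
    then show "\<forall>\<^sub>F \<epsilon> in at_right 0. (0 < x + \<epsilon> * x' \<and> 0 < y + \<epsilon> * y' \<and> 0 < w + \<epsilon> * w')
        = (0 < x \<and> 0 < y \<and> 0 < w)"
      by eventually_elim (use True in simp)
  next
    case False
    then consider "x < 0" | "y < 0" | "w < 0" using nz by linarith
    then have "\<forall>\<^sub>F \<epsilon> in at_right 0. x + \<epsilon> * x' < 0 \<or> y + \<epsilon> * y' < 0 \<or> w + \<epsilon> * w' < 0"
    proof cases
      case 1
      show ?thesis by (rule eventually_mono[OF eventually_affine_neg[OF 1]]) blast
    next
      case 2
      show ?thesis by (rule eventually_mono[OF eventually_affine_neg[OF 2]]) blast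
    next
      case 3
      show ?thesis by (rule eventually_mono[OF eventually_affine_neg[OF 3]]) blast
    qed
    then show "\<forall>\<^sub>F \<epsilon> in at_right 0. (0 < x + \<epsilon> * x' \<and> 0 < y + \<epsilon> * y' \<and> 0 < w + \<epsilon> * w')
        = (0 < x \<and> 0 < y \<and> 0 < w)"
      by eventually_elim (use False in auto)
  qed
qed

lemma in_tri_near_vertex:
  assumes D: "triple N r z \<noteq> 0"
  shows "\<forall>\<^sub>F \<epsilon> in at_right 0. in_tri N r z (z + \<epsilon> *\<^sub>R e) \<longleftrightarrow> in_sector z N r e"
proof -
  define x y w where c: "x = triple e r z / triple N r z" "y = triple N e z / triple N r z"
    "w = triple N r e / triple N r z"
  have e: "e = x *\<^sub>R N + y *\<^sub>R r + w *\<^sub>R z" unfolding c by (rule triple_coords[OF D])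
  have ze: "z + \<epsilon> *\<^sub>R e = (\<epsilon> * x) *\<^sub>R N + (\<epsilon> * y) *\<^sub>R r + (1 + \<epsilon> * w) *\<^sub>R z" for \<epsilon>
    by (subst e) (simp add: algebra_simps)
  have rot: "triple z N r = triple N r z" "triple z e r = triple e r z" "triple z N e = triple N e z"
    by (simp_all add: triple_rotate)
  have "in_sector z N r e \<longleftrightarrow> 0 < x \<and> 0 < y"
    unfolding in_sector_def c rot by (auto simp: zero_less_mult_iff zero_less_divide_iff)
  moreover have "\<forall>\<^sub>F \<epsilon> in at_right 0. 0 < 1 + \<epsilon> * w \<and> 0 < \<epsilon>"
    by (intro eventually_conj eventually_affine_pos eventually_at_right_less) simp
  ultimately show ?thesis
    unfolding in_tri_coords[OF D ze]
    by (auto simp: zero_less_mult_iff elim!: eventually_mono)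
qed

section \<open>Systems of touching cones\<close>

definition gen_cone :: "('i \<Rightarrow> 'v::real_vector) \<Rightarrow> 'i set \<Rightarrow> 'v set" where
  "gen_cone f S = {\<Sum>i\<in>S. c i *\<^sub>R f i | c. \<forall>i\<in>S. 0 \<le> c i}"

lemma gen_coneE:
  assumes "v \<in> gen_cone f S"
  obtains c where "\<And>i. i \<in> S \<Longrightarrow> 0 \<le> c i" "v = (\<Sum>i\<in>S. c i *\<^sub>R f i)"
  using assms unfolding gen_cone_def by blast

lemma gen_coneI: "(\<And>i. i \<in> S \<Longrightarrow> 0 \<le> c i) \<Longrightarrow> (\<Sum>i\<in>S. c i *\<^sub>R f i) \<in> gen_cone f S"
  unfolding gen_cone_def by blast

lemma gen_cone_0 [simp]: "0 \<in> gen_cone f S"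
  using gen_coneI[of S "\<lambda>_. 0" f] by simp

lemma gen_cone_scale:
  assumes "v \<in> gen_cone f S" "0 \<le> k"
  shows "k *\<^sub>R v \<in> gen_cone f S"
proof -
  obtain c where c: "\<And>i. i \<in> S \<Longrightarrow> 0 \<le> c i" "v = (\<Sum>i\<in>S. c i *\<^sub>R f i)"
    using assms(1) by (rule gen_coneE) blast
  have "k *\<^sub>R v = (\<Sum>i\<in>S. (k * c i) *\<^sub>R f i)" unfolding c(2) by (simp add: scaleR_sum_right)
  then show ?thesis using gen_coneI[of S "\<lambda>i. k * c i" f] c(1) assms(2) by simp
qed

lemma gen_cone_add:
  assumes "u \<in> gen_cone f S" "v \<in> gen_cone f S"
  shows "u + v \<in> gen_cone f S"
proof -
  obtain b where b: "\<And>i. i \<in> S \<Longrightarrow> 0 \<le> b i" "u = (\<Sum>i\<in>S. b i *\<^sub>R f i)"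
    using assms(1) by (rule gen_coneE) blast
  obtain c where c: "\<And>i. i \<in> S \<Longrightarrow> 0 \<le> c i" "v = (\<Sum>i\<in>S. c i *\<^sub>R f i)"
    using assms(2) by (rule gen_coneE) blast
  have "u + v = (\<Sum>i\<in>S. (b i + c i) *\<^sub>R f i)"
    unfolding b(2) c(2) by (simp add: sum.distrib scaleR_left_distrib)
  then show ?thesis using gen_coneI[of S "\<lambda>i. b i + c i" f] b(1) c(1) by simp
qed

lemma gen_cone_gen:
  assumes "finite S" "i \<in> S"
  shows "f i \<in> gen_cone f S"
proof -
  have "(\<Sum>j\<in>S. (if j = i then 1 else 0) *\<^sub>R f j) = (\<Sum>j\<in>S. if j = i then f j else 0)"
    by (intro sum.cong) auto
  also have "\<dots> = f i" using assms by simp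
  finally have "f i = (\<Sum>j\<in>S. (if j = i then 1 else 0) *\<^sub>R f j)" by simp
  then show ?thesis using gen_coneI[of S "\<lambda>j. if j = i then 1 else 0" f] by simp
qed

lemma gen_cone_sum:
  assumes "finite S" "T \<subseteq> S"
  shows "(\<Sum>i\<in>T. f i) \<in> gen_cone f S"
proof -
  have "finite T" using assms finite_subset by blast
  then show ?thesis using assms(2)
    by (induction T) (auto intro!: gen_cone_add gen_cone_gen assms(1))
qed

text \<open>An abstract form of the cones of a diameter graph: \<open>nb x\<close> is the set of neighbours of \<open>x\<close>, and
\<open>gen_cone (d x) (nb x)\<close> is the cone \<open>R x\<close> of the introduction. The last assumption says that every \<open>d x y\<close>
spans an extreme ray of \<open>R x\<close>, unless \<open>x\<close> is the only neighbour of \<open>y\<close>.\<close>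

locale cone_contacts =
  fixes V :: "'a set" and nb :: "'a \<Rightarrow> 'a set" and d :: "'a \<Rightarrow> 'a \<Rightarrow> real^3"
  assumes finite_V: "finite V"
    and nb_V: "\<And>x. x \<in> V \<Longrightarrow> nb x \<subseteq> V"
    and nb_sym: "\<And>x y. \<lbrakk>x \<in> V; y \<in> nb x\<rbrakk> \<Longrightarrow> x \<in> nb y"
    and d_swap: "\<And>x y. d y x = - d x y"
    and d_nonzero: "\<And>x y. \<lbrakk>x \<in> V; y \<in> nb x\<rbrakk> \<Longrightarrow> d x y \<noteq> 0"
    and disjoint: "\<And>x y v. \<lbrakk>x \<in> V; y \<in> V; v \<in> gen_cone (d x) (nb x); v \<in> gen_cone (d y) (nb y);
        v \<noteq> 0\<rbrakk> \<Longrightarrow> x = y"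
    and contact: "\<And>x y v. \<lbrakk>x \<in> V; y \<in> V; v \<in> gen_cone (d x) (nb x); - v \<in> gen_cone (d y) (nb y);
        v \<noteq> 0\<rbrakk> \<Longrightarrow> y \<in> nb x \<and> (\<exists>t>0. v = t *\<^sub>R d x y)"
    and extreme: "\<And>x y z. \<lbrakk>x \<in> V; y \<in> nb x; z \<in> nb y; z \<noteq> x\<rbrakk>
        \<Longrightarrow> d x y \<notin> gen_cone (d x) (nb x - {y})"

section \<open>Odd closed walks meet\<close>

context cone_contacts
begin

lemma finite_nb: "x \<in> V \<Longrightarrow> finite (nb x)"
  using nb_V finite_V finite_subset by blast

lemma nb_irrefl: "x \<in> V \<Longrightarrow> x \<notin> nb x"
proof
  assume x: "x \<in> V" "x \<in> nb x"
  have "d x x = - d x x" by (rule d_swap)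
  then have "d x x = 0" by (metis eq_neg_iff_add_eq_0 scaleR_2 scaleR_eq_0_iff zero_neq_numeral)
  then show False using d_nonzero x by blast
qed

lemma pointed: "\<lbrakk>x \<in> V; v \<in> gen_cone (d x) (nb x); - v \<in> gen_cone (d x) (nb x)\<rbrakk> \<Longrightarrow> v = 0"
  using contact[of x x v] nb_irrefl[of x] by blast

lemma d_in_cone: "\<lbrakk>x \<in> V; y \<in> nb x\<rbrakk> \<Longrightarrow> d x y \<in> gen_cone (d x) (nb x)"
  by (intro gen_cone_gen finite_nb)

text \<open>Two parallel generators \<open>d x y\<close> and \<open>d x y'\<close> would produce a common ray of \<open>R y\<close> and \<open>R y'\<close>.\<close>

lemma d_parallel:
  assumes x: "x \<in> V" and y: "y \<in> nb x" "y' \<in> nb x" and k: "d x y' = k *\<^sub>R d x y"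
  shows "y' = y"
proof -
  have V: "y \<in> V" "y' \<in> V" using nb_V x y by blast+
  have k0: "k \<noteq> 0" using k d_nonzero x y by auto
  have "\<not> k < 0"
  proof
    assume "k < 0"
    then have "- d x y' \<in> gen_cone (d x) (nb x)"
      using gen_cone_scale[OF d_in_cone[OF x y(1)], of "- k"] k by simp
    then show False using pointed[OF x d_in_cone[OF x y(2)]] d_nonzero x y by blast
  qed
  then have "k *\<^sub>R d y x \<in> gen_cone (d y) (nb y)"
    using gen_cone_scale d_in_cone V nb_sym x y by force
  moreover have "k *\<^sub>R d y x = d y' x" using k d_swap by (metis scaleR_minus_right)
  ultimately show ?thesis
    using disjoint[OF V(2,1), of "d y' x"] d_in_cone[OF V(2)] d_nonzero[OF V(2)] nb_sym[OF x y(2)]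
    by auto
qed

lemma d_cross_nonzero:
  "\<lbrakk>x \<in> V; y \<in> nb x; y' \<in> nb x; y \<noteq> y'\<rbrakk> \<Longrightarrow> cross3 (d x y) (d x y') \<noteq> 0"
  using d_parallel d_nonzero cross3_eq_0_parallel by metis

lemma cone2_gen_cone:
  assumes "x \<in> V" "S \<subseteq> nb x" "y \<in> S" "y' \<in> S"
  shows "cone2 (d x y) (d x y') \<subseteq> gen_cone (d x) S"
proof -
  have "finite S" using assms finite_nb finite_subset by blast
  then show ?thesis
    unfolding cone2_def using assms(3,4) by (auto intro!: gen_cone_add gen_cone_scale gen_cone_gen)
qed

text \<open>The polygon of a walk has the corners \<open>(- 1) ^ i * d (x (i + 1)) (x i)\<close>. Two consecutive ones lie in
\<open>R (x (i + 1))\<close> or both in its antipode, and going around an odd closed walk once changes the sign.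
A common point of two such polygons lies in two cones; unless these belong to the same vertex it is a
contact \<open>d a b\<close>. By extremality it is then an end of the side of the first polygon in \<open>R a\<close>, so that the
first walk visits \<open>b\<close>.\<close>

theorem odd_closed_walks_meet:
  fixes x y :: "nat \<Rightarrow> 'a"
  assumes L: "odd L" "\<And>i. x (i + L) = x i" and M: "odd M" "\<And>i. y (i + M) = y i"
    and xV: "\<And>i. x i \<in> V" and yV: "\<And>i. y i \<in> V"
    and xE: "\<And>i. x (Suc i) \<in> nb (x i)" and yE: "\<And>i. y (Suc i) \<in> nb (y i)"
    and xT: "\<And>i. x (Suc (Suc i)) \<noteq> x i" and yT: "\<And>i. y (Suc (Suc i)) \<noteq> y i"
  shows "\<exists>i j. x i = y j"
proof (rule ccontr)
  assume apart: "\<nexists>i j. x i = y j"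
  define w where "w x i = (- 1) ^ i *\<^sub>R d (x (Suc i)) (x i)" for x :: "nat \<Rightarrow> 'a" and i
  have wS: "w x (Suc i) = (- 1) ^ i *\<^sub>R d (x (Suc i)) (x (Suc (Suc i)))" for x i
    unfolding w_def by (subst d_swap) simp
  have anti: "w x (i + K) = - w x i" if "odd K" "\<And>i. x (i + K) = x i" for x K i
    using that(2)[of i] that(2)[of "Suc i"] that(1) unfolding w_def by (simp add: power_add)
  have cross: "cross3 (w x i) (w x (Suc i)) \<noteq> 0"
    if "\<And>i. x i \<in> V" "\<And>i. x (Suc i) \<in> nb (x i)" "\<And>i. x (Suc (Suc i)) \<noteq> x i" for x i
    unfolding wS unfolding w_def
    using d_cross_nonzero[OF that(1)[of "Suc i"] nb_sym[OF that(1) that(2)] that(2)] that(3)[of i]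
    by (auto simp: cross_mult_left cross_mult_right)
  have arc: "(- 1) ^ i *\<^sub>R v \<in> cone2 (d (x (Suc i)) (x i)) (d (x (Suc i)) (x (Suc (Suc i))))"
    if v: "v \<in> cone2 (w x i) (w x (Suc i))" for v x i
  proof -
    obtain \<alpha> \<beta> where ab: "0 \<le> \<alpha>" "0 \<le> \<beta>" "v = \<alpha> *\<^sub>R w x i + \<beta> *\<^sub>R w x (Suc i)"
      using v unfolding cone2_def by blast
    have sq: "(- 1) ^ i * (\<alpha> * (- 1) ^ i) = \<alpha>" for \<alpha> :: real
      by (cases "even i") auto
    show ?thesis
      by (rule cone2_I[OF _ ab(1,2)]) (simp add: ab(3) wS, simp add: w_def scaleR_right_distrib sq)
  qed
  have antix: "w x (i + L) = - w x i" and antiy: "w y (i + M) = - w y i" for i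
    using anti L M by blast+
  have crossx: "cross3 (w x i) (w x (Suc i)) \<noteq> 0"
    and crossy: "cross3 (w y i) (w y (Suc i)) \<noteq> 0" for i
    using cross xV xE xT yV yE yT by blast+
  obtain i j v where v: "v \<noteq> 0" "v \<in> cone2 (w x i) (w x (Suc i))" "v \<in> cone2 (w y j) (w y (Suc j))"
    using antipodal_polygons_meet[of "w x" L "w y" M, OF antix antiy crossx crossy] by metis
  define a b where "a = x (Suc i)" and "b = y (Suc j)"
  have nba: "x i \<in> nb a" "x (Suc (Suc i)) \<in> nb a" "a \<in> V" and
    nbb: "y j \<in> nb b" "y (Suc (Suc j)) \<in> nb b" "b \<in> V"
    unfolding a_def b_def using xV yV xE yE nb_sym by blast+
  define u where "u = (- 1) ^ i *\<^sub>R v"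
  have u0: "u \<noteq> 0" using v(1) by (simp add: u_def)
  have ua: "u \<in> cone2 (d a (x i)) (d a (x (Suc (Suc i))))"
    using arc[OF v(2)] by (simp add: u_def a_def)
  have ub: "(- 1) ^ j *\<^sub>R v \<in> cone2 (d b (y j)) (d b (y (Suc (Suc j))))"
    using arc[OF v(3)] by (simp add: b_def)
  have uA: "u \<in> gen_cone (d a) (nb a)" using cone2_gen_cone nba ua by blast
  have uB: "(- 1) ^ j *\<^sub>R v \<in> gen_cone (d b) (nb b)" using cone2_gen_cone nbb ub by blast
  have ab: "a \<noteq> b" using apart unfolding a_def b_def by blast
  show False
  proof (cases "even i = even j")
    case True
    then have "(- 1) ^ j *\<^sub>R v = u" by (auto simp: u_def minus_one_power_iff)
    then show False using disjoint[OF nba(3) nbb(3) uA _ u0] uB ab by simp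
  next
    case False
    then have "(- 1) ^ j *\<^sub>R v = - u" by (auto simp: u_def minus_one_power_iff)
    then obtain t where t: "b \<in> nb a" "0 < t" "u = t *\<^sub>R d a b"
      using contact[OF nba(3) nbb(3) uA _ u0] uB by auto
    have "x i \<in> nb a - {b}" "x (Suc (Suc i)) \<in> nb a - {b}"
      using nba apart unfolding b_def by auto
    then have "u \<in> gen_cone (d a) (nb a - {b})" using cone2_gen_cone[OF nba(3)] ua by blast
    then have "(1 / t) *\<^sub>R u \<in> gen_cone (d a) (nb a - {b})" by (rule gen_cone_scale) (use t in simp)
    then have "d a b \<in> gen_cone (d a) (nb a - {b})" using t by simp
    moreover have "y j \<noteq> a" using apart unfolding a_def by metis
    ultimately show False using extreme[OF nba(3) t(1) nbb(1)] by blast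
  qed
qed

end

section \<open>Corners of the cones in cyclic order\<close>

lemma total_order_least:
  assumes "finite S" "S \<noteq> {}"
    and total: "\<And>a b. \<lbrakk>a \<in> S; b \<in> S; a \<noteq> b\<rbrakk> \<Longrightarrow> R a b \<or> R b a"
    and trans: "\<And>a b c. \<lbrakk>a \<in> S; b \<in> S; c \<in> S; R a b; R b c\<rbrakk> \<Longrightarrow> R a c"
  obtains m where "m \<in> S" "\<And>w. \<lbrakk>w \<in> S; w \<noteq> m\<rbrakk> \<Longrightarrow> R m w"
proof -
  have "\<exists>m\<in>T. \<forall>w\<in>T. w \<noteq> m \<longrightarrow> R m w" if "finite T" "T \<noteq> {}" "T \<subseteq> S" for T
    using that
  proof (induction T rule: finite_ne_induct)
    case (insert a T)
    then obtain m where m: "m \<in> T" "\<forall>w\<in>T. w \<noteq> m \<longrightarrow> R m w" by blast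
    have S: "a \<in> S" "m \<in> S" "a \<noteq> m" using insert m by auto
    show ?case
    proof (cases "R a m")
      case True
      have "R a w" if "w \<in> T" for w
        using m True that trans[of a m w] S insert.prems by (cases "w = m") auto
      then show ?thesis by blast
    next
      case False
      then have "R m a" using total S by blast
      then show ?thesis using m by blast
    qed
  qed auto
  from this[OF assms(1,2) order_refl] obtain m where "m \<in> S" "\<forall>w\<in>S. w \<noteq> m \<longrightarrow> R m w" by blast
  then show thesis using that[of m] by simp
qed

text \<open>With degrees at least \<open>3\<close> every cone is solid and every contact is one of its corners.\<close>

locale dense_contacts = cone_contacts +
  assumes degree: "\<And>x. x \<in> V \<Longrightarrow> 3 \<le> card (nb x)"
begin

lemma third_neighbour:
  assumes "x \<in> V"
  obtains w where "w \<in> nb x" "w \<noteq> a" "w \<noteq> b"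
proof -
  have "card {a, b} \<le> 2" by (simp add: card_insert_if)
  then have "\<not> nb x \<subseteq> {a, b}"
    using card_mono[of "{a, b}" "nb x"] degree[OF assms] by fastforce
  then show thesis using that by blast
qed

text \<open>The form in which extremality and pointedness of the cones are used.\<close>

lemma no_relation:
  assumes x: "x \<in> V" and y: "y \<in> nb x" and k: "k *\<^sub>R d x y \<in> gen_cone (d x) (nb x - {y})"
  shows "k = 0"
proof (rule ccontr)
  assume k0: "k \<noteq> 0"
  have yV: "y \<in> V" using nb_V x y by blast
  obtain z where z: "z \<in> nb y" "z \<noteq> x" using third_neighbour[OF yV] by blast
  show False
  proof (cases "0 < k")
    case True
    then have "d x y \<in> gen_cone (d x) (nb x - {y})"
      using gen_cone_scale[OF k, of "1 / k"] by simp
    then show False using extreme[OF x y z] by blast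
  next
    case False
    have "gen_cone (d x) (nb x - {y}) \<subseteq> gen_cone (d x) (nb x)"
    proof
      fix v assume "v \<in> gen_cone (d x) (nb x - {y})"
      then obtain c where c: "\<And>i. i \<in> nb x - {y} \<Longrightarrow> 0 \<le> c i" "v = (\<Sum>i\<in>nb x - {y}. c i *\<^sub>R d x i)"
        by (rule gen_coneE) blast
      have "v = (\<Sum>i\<in>nb x. (if i = y then 0 else c i) *\<^sub>R d x i)"
        unfolding c(2) by (rule sum.mono_neutral_cong_left[OF finite_nb[OF x]]) auto
      then show "v \<in> gen_cone (d x) (nb x)"
        using gen_coneI[of "nb x" "\<lambda>i. if i = y then 0 else c i" "d x"] c(1) by simp
    qed
    then have "k *\<^sub>R d x y \<in> gen_cone (d x) (nb x)" using k by blast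
    moreover have "- (k *\<^sub>R d x y) \<in> gen_cone (d x) (nb x)"
      using gen_cone_scale[OF d_in_cone[OF x y], of "- k"] False by simp
    ultimately show False using pointed[OF x] k0 d_nonzero[OF x y] by force
  qed
qed

lemma in_cone_but:
  assumes "x \<in> V" "a \<in> nb x" "a \<noteq> y"
  shows "0 \<le> k \<Longrightarrow> k *\<^sub>R d x a \<in> gen_cone (d x) (nb x - {y})"
  using assms finite_nb by (intro gen_cone_scale gen_cone_gen) auto

lemma triple_nonzero:
  assumes x: "x \<in> V" and abc: "a \<in> nb x" "b \<in> nb x" "c \<in> nb x" "a \<noteq> b" "a \<noteq> c" "b \<noteq> c"
  shows "triple (d x a) (d x b) (d x c) \<noteq> 0"
proof
  assume 0: "triple (d x a) (d x b) (d x c) = 0"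
  define n where "n = cross3 (d x a) (d x b)"
  have "triple (d x a) (d x b) n = n \<bullet> n"
    using cross_triple[of "d x a" "d x b" n] by (simp add: triple_def n_def inner_commute)
  then have nn: "triple (d x a) (d x b) n \<noteq> 0"
    using d_cross_nonzero[OF x abc(1,2,4)] by (simp add: n_def)
  define \<alpha> \<beta> where "\<alpha> = triple (d x c) (d x b) n / triple (d x a) (d x b) n"
    and "\<beta> = triple (d x a) (d x c) n / triple (d x a) (d x b) n"
  have c: "d x c = \<alpha> *\<^sub>R d x a + \<beta> *\<^sub>R d x b"
    using triple_coords[OF nn, of "d x c"] 0 unfolding \<alpha>_def \<beta>_def by simp
  consider "0 \<le> \<alpha>" "0 \<le> \<beta>" | "\<alpha> < 0" "0 \<le> \<beta>" | "0 \<le> \<alpha>" "\<beta> < 0" | "\<alpha> < 0" "\<beta> < 0"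
    by linarith
  then show False
  proof cases
    case 1
    then have "1 *\<^sub>R d x c \<in> gen_cone (d x) (nb x - {c})"
      unfolding c scaleR_one using abc x by (intro gen_cone_add in_cone_but) auto
    then show False using no_relation[OF x abc(3)] by fastforce
  next
    case 2
    have "\<beta> *\<^sub>R d x b = 1 *\<^sub>R d x c + (- \<alpha>) *\<^sub>R d x a" using c by simp
    moreover have "1 *\<^sub>R d x c + (- \<alpha>) *\<^sub>R d x a \<in> gen_cone (d x) (nb x - {b})"
      using abc x 2 by (intro gen_cone_add in_cone_but) auto
    ultimately have "\<beta> = 0" using no_relation[OF x abc(2)] by metis
    then show False using d_parallel[OF x abc(1,3), of \<alpha>] c abc by simp
  next
    case 3
    have "\<alpha> *\<^sub>R d x a = 1 *\<^sub>R d x c + (- \<beta>) *\<^sub>R d x b" using c by simp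
    moreover have "1 *\<^sub>R d x c + (- \<beta>) *\<^sub>R d x b \<in> gen_cone (d x) (nb x - {a})"
      using abc x 3 by (intro gen_cone_add in_cone_but) auto
    ultimately have "\<alpha> = 0" using no_relation[OF x abc(1)] by metis
    then show False using d_parallel[OF x abc(2,3), of \<beta>] c abc by simp
  next
    case 4
    have "(- 1) *\<^sub>R d x c = (- \<alpha>) *\<^sub>R d x a + (- \<beta>) *\<^sub>R d x b" using c by simp
    moreover have "(- \<alpha>) *\<^sub>R d x a + (- \<beta>) *\<^sub>R d x b \<in> gen_cone (d x) (nb x - {c})"
      using abc x 4 by (intro gen_cone_add in_cone_but) auto
    ultimately show False using no_relation[OF x abc(3), of "- 1"] by simp
  qed
qed

text \<open>A failure of transitivity would make the line of \<open>d x y\<close> meet the cone of the other generators.\<close>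

lemma triple_trans:
  assumes x: "x \<in> V" and nb: "y \<in> nb x" "a \<in> nb x - {y}" "b \<in> nb x - {y}" "c \<in> nb x - {y}"
    and ab: "0 < triple (d x y) (d x a) (d x b)" and bc: "0 < triple (d x y) (d x b) (d x c)"
  shows "0 < triple (d x y) (d x a) (d x c)"
proof (rule ccontr)
  assume not: "\<not> 0 < triple (d x y) (d x a) (d x c)"
  have "a \<noteq> b" "b \<noteq> c" using ab bc by auto
  moreover have "a \<noteq> c" using ab bc triple_swap(2)[of "d x y" "d x a" "d x b"] by auto
  ultimately have ne: "triple (d x a) (d x b) (d x c) \<noteq> 0" using triple_nonzero[OF x] nb by blast
  have "triple (d x a) (d x b) (d x c) *\<^sub>R d x y =
      triple (d x y) (d x b) (d x c) *\<^sub>R d x a + (- triple (d x y) (d x a) (d x c)) *\<^sub>R d x b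
       + triple (d x y) (d x a) (d x b) *\<^sub>R d x c"
    using cramer3[of "d x a" "d x b" "d x c" "d x y"] triple_swap(1)[of "d x a" "d x y" "d x c"]
      triple_rotate[of "d x a" "d x b" "d x y"] by simp
  also have "\<dots> \<in> gen_cone (d x) (nb x - {y})"
    using nb x ab bc not by (intro gen_cone_add in_cone_but) auto
  finally show False using no_relation[OF x nb(1)] ne by blast
qed

text \<open>The arc from \<open>d x y\<close> to \<open>d x y'\<close> is a side of the polygon of \<open>x\<close>, traversed with the polygon on the left.\<close>

definition side :: "'a \<Rightarrow> 'a \<Rightarrow> 'a \<Rightarrow> bool" where
  "side x y y' \<longleftrightarrow> y \<in> nb x \<and> y' \<in> nb x \<and> y \<noteq> y' \<and>
     (\<forall>w\<in>nb x - {y, y'}. 0 < triple (d x y) (d x y') (d x w))"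

lemma side_next_exists:
  assumes x: "x \<in> V" and y: "y \<in> nb x"
  shows "\<exists>y'. side x y y'"
proof -
  obtain m where m: "m \<in> nb x - {y}"
    "\<And>w. \<lbrakk>w \<in> nb x - {y}; w \<noteq> m\<rbrakk> \<Longrightarrow> 0 < triple (d x y) (d x m) (d x w)"
  proof (rule total_order_least)
    show "finite (nb x - {y})" using finite_nb[OF x] by simp
    show "nb x - {y} \<noteq> {}" using third_neighbour[OF x, of y y] by blast
    show "0 < triple (d x y) (d x a) (d x b) \<or> 0 < triple (d x y) (d x b) (d x a)"
      if "a \<in> nb x - {y}" "b \<in> nb x - {y}" "a \<noteq> b" for a b
      using triple_nonzero[OF x y, of a b] that triple_swap(2)[of "d x y" "d x a" "d x b"] by auto
  qed (use triple_trans[OF x y] in blast)+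
  then show ?thesis unfolding side_def using y by blast
qed

lemma side_prev_exists:
  assumes x: "x \<in> V" and y: "y \<in> nb x"
  shows "\<exists>y'. side x y' y"
proof -
  obtain m where m: "m \<in> nb x - {y}"
    "\<And>w. \<lbrakk>w \<in> nb x - {y}; w \<noteq> m\<rbrakk> \<Longrightarrow> 0 < triple (d x y) (d x w) (d x m)"
  proof (rule total_order_least[where R="\<lambda>a b. 0 < triple (d x y) (d x b) (d x a)"])
    show "finite (nb x - {y})" using finite_nb[OF x] by simp
    show "nb x - {y} \<noteq> {}" using third_neighbour[OF x, of y y] by blast
    show "0 < triple (d x y) (d x b) (d x a) \<or> 0 < triple (d x y) (d x a) (d x b)"
      if "a \<in> nb x - {y}" "b \<in> nb x - {y}" "a \<noteq> b" for a b
      using triple_nonzero[OF x y, of a b] that triple_swap(2)[of "d x y" "d x a" "d x b"] by auto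
  qed (use triple_trans[OF x y] in blast)+
  have "0 < triple (d x m) (d x y) (d x w)" if "w \<in> nb x - {m, y}" for w
    using m(2)[of w] that triple_rotate[of "d x y" "d x w" "d x m"] by auto
  then show ?thesis unfolding side_def using y m(1) by blast
qed

text \<open>The other end of the side that starts at \<open>d x y\<close> with the polygon on the left, and of the side that ends
there. In the antipodal polygon \<open>- R x\<close> the orientation is reversed, so there the second one is the
successor.\<close>

definition next_corner :: "bool \<Rightarrow> 'a \<Rightarrow> 'a \<Rightarrow> 'a" where
  "next_corner b x y = (SOME y'. if b then side x y y' else side x y' y)"

lemma next_corner:
  assumes "x \<in> V" "y \<in> nb x"
  shows "side x y (next_corner True x y)" "side x (next_corner False x y) y"
  using someI_ex[OF side_next_exists[OF assms]] someI_ex[OF side_prev_exists[OF assms]]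
  unfolding next_corner_def by simp_all

lemma side_unique:
  assumes "side x y a" "side x y b"
  shows "a = b"
proof (rule ccontr)
  assume "a \<noteq> b"
  then have "0 < triple (d x y) (d x a) (d x b)" "0 < triple (d x y) (d x b) (d x a)"
    using assms unfolding side_def by auto
  then show False using triple_swap(2)[of "d x y" "d x a" "d x b"] by simp
qed

lemma side_asym:
  assumes "x \<in> V" "side x y a"
  shows "\<not> side x a y"
proof
  assume h: "side x a y"
  obtain w where "w \<in> nb x" "w \<noteq> a" "w \<noteq> y" using third_neighbour[OF assms(1)] by blast
  then have "0 < triple (d x y) (d x a) (d x w)" "0 < triple (d x a) (d x y) (d x w)"
    using assms h unfolding side_def by auto
  then show False using triple_swap(1)[of "d x y" "d x a" "d x w"] by simp
qed

text \<open>Any interior point of the polygon of \<open>x\<close> would do.\<close>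

definition centre :: "'a \<Rightarrow> real^3" where "centre x = (\<Sum>y\<in>nb x. d x y)"

lemma centre_in_cone: "x \<in> V \<Longrightarrow> centre x \<in> gen_cone (d x) (nb x)"
  unfolding centre_def by (rule gen_cone_sum) (simp_all add: finite_nb)

lemma side_nonneg:
  assumes "side x y y'" "u \<in> nb x"
  shows "0 \<le> triple (d x y) (d x y') (d x u)"
proof (cases "u = y \<or> u = y'")
  case False
  then show ?thesis using assms unfolding side_def by (intro order_less_imp_le) auto
qed auto

lemma side_centre_pos:
  assumes x: "x \<in> V" and s: "side x y y'"
  shows "0 < triple (d x y) (d x y') (centre x)"
proof -
  obtain w where w: "w \<in> nb x" "w \<noteq> y" "w \<noteq> y'" using third_neighbour[OF x] by blast
  note nonneg = side_nonneg[OF s]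
  have "0 < (\<Sum>u\<in>nb x. triple (d x y) (d x y') (d x u))"
    using finite_nb[OF x] w nonneg s by (intro sum_pos2[of _ w]) (auto simp: side_def)
  then show ?thesis unfolding centre_def triple_sum .
qed

lemma centre_not_parallel:
  assumes x: "x \<in> V" and y: "y \<in> nb x"
  shows "centre x \<noteq> k *\<^sub>R d x y"
proof
  assume k: "centre x = k *\<^sub>R d x y"
  obtain y' where "side x y y'" using side_next_exists[OF x y] by blast
  then have "0 < triple (d x y) (d x y') (centre x)" by (rule side_centre_pos[OF x])
  then show False unfolding k by simp
qed

lemma centre_cross_nonzero:
  "\<lbrakk>x \<in> V; y \<in> nb x\<rbrakk> \<Longrightarrow> cross3 (d x y) (centre x) \<noteq> 0"
  using centre_not_parallel d_nonzero cross3_eq_0_parallel by metis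

text \<open>The spokes are the arcs from the centre of a polygon to its corners. A corner is extreme, so it lies in
no spoke but its own.\<close>

lemma corner_not_in_spoke:
  assumes x: "x \<in> V" and y: "y \<in> nb x" and u: "u \<in> nb x" "u \<noteq> y"
  shows "d x y \<notin> cone2 (centre x) (d x u)"
proof
  assume "d x y \<in> cone2 (centre x) (d x u)"
  then obtain \<mu> \<nu> where m: "0 \<le> \<mu>" "0 \<le> \<nu>" "d x y = \<mu> *\<^sub>R centre x + \<nu> *\<^sub>R d x u"
    unfolding cone2_def by blast
  define rest where "rest = (\<Sum>w\<in>nb x - {y}. d x w)"
  have c: "centre x = d x y + rest"
    unfolding centre_def rest_def by (rule sum.remove[OF finite_nb[OF x] y])
  have "d x y = \<mu> *\<^sub>R d x y + (\<mu> *\<^sub>R rest + \<nu> *\<^sub>R d x u)"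
    using m(3) unfolding c by (simp add: scaleR_right_distrib add.assoc)
  then have "d x y - \<mu> *\<^sub>R d x y = \<mu> *\<^sub>R rest + \<nu> *\<^sub>R d x u"
    by (simp only: diff_eq_eq) (simp add: add.commute)
  then have eq: "(1 - \<mu>) *\<^sub>R d x y = \<mu> *\<^sub>R rest + \<nu> *\<^sub>R d x u"
    by (simp add: scaleR_left_diff_distrib)
  have "\<mu> *\<^sub>R rest + \<nu> *\<^sub>R d x u \<in> gen_cone (d x) (nb x - {y})"
    using m u x finite_nb[OF x]
    by (intro gen_cone_add in_cone_but gen_cone_scale) (auto simp: rest_def intro: gen_cone_sum)
  then have "1 - \<mu> = 0" using no_relation[OF x y] eq by metis
  then have eq2: "rest + \<nu> *\<^sub>R d x u = 0" using eq by simp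
  define rest2 where "rest2 = (\<Sum>w\<in>nb x - {y} - {u}. d x w)"
  have "rest = d x u + rest2"
    unfolding rest_def rest2_def using finite_nb[OF x] u by (intro sum.remove) auto
  then have "(1 + \<nu>) *\<^sub>R d x u = - rest2"
    using eq2 by (simp add: scaleR_left_distrib eq_neg_iff_add_eq_0 add_ac)
  then have "(- (1 + \<nu>)) *\<^sub>R d x u = rest2" by (simp only: scaleR_minus_left minus_minus)
  moreover have "rest2 \<in> gen_cone (d x) (nb x - {u})"
    unfolding rest2_def using finite_nb[OF x] by (intro gen_cone_sum) auto
  ultimately have "- (1 + \<nu>) = 0" using no_relation[OF x u(1)] by metis
  then show False using m(2) by simp
qed

lemma spoke_subset: "\<lbrakk>w \<in> V; u \<in> nb w\<rbrakk> \<Longrightarrow> cone2 (centre w) (d w u) \<subseteq> gen_cone (d w) (nb w)"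
  unfolding cone2_def by (auto intro!: gen_cone_add gen_cone_scale centre_in_cone d_in_cone)

lemma corner_on_spoke:
  assumes x: "x \<in> V" "y \<in> nb x" and w: "w \<in> V" "u \<in> nb w"
  shows "d x y \<in> cone2 (centre w) (d w u) \<Longrightarrow> w = x \<and> u = y"
    and "- d x y \<in> cone2 (centre w) (d w u) \<Longrightarrow> w = y \<and> u = x"
proof -
  have *: "w = x \<and> u = y" if "d x y \<in> cone2 (centre w) (d w u)" "x \<in> V" "y \<in> nb x" for x y
  proof -
    have "w = x" using disjoint[OF w(1) that(2)] spoke_subset[OF w] d_in_cone d_nonzero that by blast
    then show ?thesis using corner_not_in_spoke that w by blast
  qed
  show "d x y \<in> cone2 (centre w) (d w u) \<Longrightarrow> w = x \<and> u = y" using * x by blast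
  assume "- d x y \<in> cone2 (centre w) (d w u)"
  then show "w = y \<and> u = x" using *[of y x] nb_sym[OF x] nb_V x d_swap[of y x] by auto
qed

text \<open>A spoke of the same polygon leaves the plane of the side except at a corner, and a spoke of another
polygon could meet the side only at a contact, which is a corner.\<close>

lemma side_avoids_spoke:
  assumes x: "x \<in> V" and s: "side x y y'" and w: "w \<in> V" "u \<in> nb w"
    and ab: "0 < \<alpha>" "0 < \<beta>" and t: "t = 1 \<or> t = - 1"
  shows "t *\<^sub>R (\<alpha> *\<^sub>R d x y + \<beta> *\<^sub>R d x y') \<notin> cone2 (centre w) (d w u)"
proof
  define v where "v = \<alpha> *\<^sub>R d x y + \<beta> *\<^sub>R d x y'"
  assume "t *\<^sub>R (\<alpha> *\<^sub>R d x y + \<beta> *\<^sub>R d x y') \<in> cone2 (centre w) (d w u)"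
  then have in_w: "t *\<^sub>R v \<in> cone2 (centre w) (d w u)" unfolding v_def .
  have nb: "y \<in> nb x" "y' \<in> nb x" "y \<noteq> y'" using s unfolding side_def by auto
  have vx: "v \<in> gen_cone (d x) (nb x)"
    unfolding v_def using ab x nb by (intro gen_cone_add gen_cone_scale d_in_cone) auto
  have no_y: "v \<noteq> k *\<^sub>R d x y" for k
  proof
    assume "v = k *\<^sub>R d x y"
    then have "\<beta> *\<^sub>R d x y' = (k - \<alpha>) *\<^sub>R d x y"
      unfolding v_def by (simp add: scaleR_left_diff_distrib algebra_simps)
    then have "(1 / \<beta>) *\<^sub>R (\<beta> *\<^sub>R d x y') = (1 / \<beta>) *\<^sub>R ((k - \<alpha>) *\<^sub>R d x y)" by simp
    then show False using d_parallel[OF x nb(1,2), of "(k - \<alpha>) / \<beta>"] nb ab by simp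
  qed
  have no_y': "v \<noteq> k *\<^sub>R d x y'" for k
  proof
    assume "v = k *\<^sub>R d x y'"
    then have "\<alpha> *\<^sub>R d x y = (k - \<beta>) *\<^sub>R d x y'"
      unfolding v_def by (simp add: scaleR_left_diff_distrib algebra_simps)
    then have "(1 / \<alpha>) *\<^sub>R (\<alpha> *\<^sub>R d x y) = (1 / \<alpha>) *\<^sub>R ((k - \<beta>) *\<^sub>R d x y')" by simp
    then show False using d_parallel[OF x nb(2,1), of "(k - \<beta>) / \<alpha>"] nb ab by simp
  qed
  have v0: "v \<noteq> 0" using no_y[of 0] by simp
  have flat: "triple (d x y) (d x y') v = 0" unfolding v_def by simp
  have corner: "u' = y \<or> u' = y'" if "u' \<in> nb x" "triple (d x y) (d x y') (d x u') = 0" for u'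
    using s that unfolding side_def by force
  show False
  proof (cases "t = 1")
    case True
    then have vw: "v \<in> cone2 (centre w) (d w u)" using in_w by simp
    then have wx: "w = x" using disjoint[OF w(1) x] spoke_subset[OF w] vx v0 by blast
    obtain \<mu> \<nu> where m: "0 \<le> \<mu>" "0 \<le> \<nu>" "v = \<mu> *\<^sub>R centre x + \<nu> *\<^sub>R d x u"
      using vw unfolding wx cone2_def by blast
    have ux: "u \<in> nb x" using w wx by simp
    note nonneg = side_nonneg[OF s ux]
    have sum0: "\<mu> * triple (d x y) (d x y') (centre x) + \<nu> * triple (d x y) (d x y') (d x u) = 0"
      using flat unfolding m(3) by simp
    have "0 \<le> \<mu> * triple (d x y) (d x y') (centre x)" "0 \<le> \<nu> * triple (d x y) (d x y') (d x u)"
      using m nonneg side_centre_pos[OF x s] by simp_all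
    then have "\<mu> * triple (d x y) (d x y') (centre x) = 0" "\<nu> * triple (d x y) (d x y') (d x u) = 0"
      using sum0 by linarith+
    then have "\<mu> = 0" "\<nu> = 0 \<or> triple (d x y) (d x y') (d x u) = 0"
      using side_centre_pos[OF x s] by auto
    then show False using m(3) v0 corner[OF ux] no_y no_y' by force
  next
    case False
    then have "- v \<in> gen_cone (d w) (nb w)" using in_w t spoke_subset[OF w] by auto
    then obtain k where k: "w \<in> nb x" "v = k *\<^sub>R d x w" using contact[OF x w(1) vx _ v0] by blast
    then have "triple (d x y) (d x y') (d x w) = 0" using flat v0 by auto
    then show False using corner[OF k(1)] k(2) no_y no_y' by blast
  qed
qed

text \<open>If the centre of \<open>- R y\<close> lay over the wedge of \<open>R x\<close> at the common corner \<open>d x y\<close>, then adding a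
multiple of \<open>d x y\<close> would move it into \<open>R x\<close>, although it is not on the ray of \<open>d x y\<close>.\<close>

lemma centre_outside_wedge:
  assumes x: "x \<in> V" and y: "y \<in> V" and s1: "side x a1 y" and s2: "side x y a2"
  shows "\<not> (0 \<le> triple (d x y) (d x a2) (- centre y) \<and> 0 \<le> triple (d x y) (- centre y) (d x a1))"
proof
  assume h: "0 \<le> triple (d x y) (d x a2) (- centre y) \<and> 0 \<le> triple (d x y) (- centre y) (d x a1)"
  have nb: "a1 \<in> nb x" "a2 \<in> nb x" "y \<in> nb x" "a1 \<noteq> y" "a2 \<noteq> y"
    using s1 s2 unfolding side_def by auto
  have "a1 \<noteq> a2" using side_asym[OF x s2] s1 by blast
  then have D: "0 < triple (d x y) (d x a2) (d x a1)" using s2 nb unfolding side_def by auto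
  have D': "triple (d x a2) (d x a1) (d x y) \<noteq> 0"
    using D triple_rotate[of "d x a2" "d x a1" "d x y"] by simp
  define \<alpha> \<beta> \<mu> where "\<alpha> = triple (- centre y) (d x a1) (d x y) / triple (d x a2) (d x a1) (d x y)"
    and "\<beta> = triple (d x a2) (- centre y) (d x y) / triple (d x a2) (d x a1) (d x y)"
    and "\<mu> = triple (d x a2) (d x a1) (- centre y) / triple (d x a2) (d x a1) (d x y)"
  have c: "- centre y = \<alpha> *\<^sub>R d x a2 + \<beta> *\<^sub>R d x a1 + \<mu> *\<^sub>R d x y"
    unfolding \<alpha>_def \<beta>_def \<mu>_def by (rule triple_coords[OF D'])
  have pos: "0 \<le> \<alpha>" "0 \<le> \<beta>"
    using h D unfolding \<alpha>_def \<beta>_def triple_rotate[of _ _ "d x y"]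
    by (simp_all only: zero_le_divide_iff) auto
  \<comment> \<open>The shift by \<open>m\<close> makes the last coefficient nonnegative.\<close>
  define m where "m = max 0 (- \<mu>)"
  define v where "v = - centre y + m *\<^sub>R d x y"
  have "v = \<alpha> *\<^sub>R d x a2 + \<beta> *\<^sub>R d x a1 + (\<mu> + m) *\<^sub>R d x y"
    unfolding v_def c by (simp add: scaleR_left_distrib)
  also have "\<dots> \<in> gen_cone (d x) (nb x)"
    using pos x nb unfolding m_def by (intro gen_cone_add gen_cone_scale d_in_cone) auto
  finally have vx: "v \<in> gen_cone (d x) (nb x)" .
  have xy: "x \<in> nb y" using nb_sym[OF x] nb by blast
  have mv: "- v = centre y + m *\<^sub>R d y x" unfolding v_def using d_swap[of y x] by simp
  have "- v \<in> gen_cone (d y) (nb y)" unfolding mv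
    using y xy by (intro gen_cone_add gen_cone_scale d_in_cone centre_in_cone) (auto simp: m_def)
  then have "v = 0 \<or> (\<exists>t. v = t *\<^sub>R d x y)" using contact[OF x y vx] by blast
  then obtain t where "v = t *\<^sub>R d x y" by (metis scaleR_zero_left)
  then have "centre y = (t - m) *\<^sub>R d y x"
    unfolding v_def using d_swap[of y x]
    by (simp add: scaleR_left_diff_distrib algebra_simps)
  then show False using centre_not_parallel[OF y xy] by blast
qed

end

section \<open>Drawing the flags on the sphere\<close>

definition sign_of :: "bool \<Rightarrow> real" where "sign_of b = (if b then 1 else - 1)"

lemma sign_of_simps [simp]: "sign_of True = 1" "sign_of False = - 1" "sign_of b \<noteq> 0" "sign_of b * sign_of b = 1"
  by (simp_all add: sign_of_def)

context dense_contacts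
begin

text \<open>A flag \<open>(x, y)\<close> stands for the contact of \<open>R x\<close> and \<open>- R y\<close> at \<open>d x y\<close>, that is, for the edge between
the copies \<open>(x, +)\<close> and \<open>(y, -)\<close> in the bipartite double cover.\<close>

definition flags :: "('a \<times> 'a) set" where "flags = {(x, y). x \<in> V \<and> y \<in> nb x}"

definition spoke_start :: "bool \<times> 'a \<times> 'a \<Rightarrow> real^3" where
  "spoke_start = (\<lambda>(b, w, u). sign_of b *\<^sub>R centre w)"

definition spoke_end :: "bool \<times> 'a \<times> 'a \<Rightarrow> real^3" where
  "spoke_end = (\<lambda>(b, w, u). sign_of b *\<^sub>R d w u)"

text \<open>A flag \<open>(x, y)\<close> is drawn as two spokes: from the centre of \<open>R x\<close> to \<open>d x y\<close>, and from there, as the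
same point is \<open>- d y x\<close>, to the centre of \<open>- R y\<close>.\<close>

definition spokes :: "('a \<times> 'a) set \<Rightarrow> (bool \<times> 'a \<times> 'a) set" where
  "spokes Z = (\<lambda>(x, y). (True, x, y)) ` Z \<union> (\<lambda>(x, y). (False, y, x)) ` Z"

text \<open>The cycle space of the bipartite double cover.\<close>

definition even_flags :: "('a \<times> 'a) set \<Rightarrow> bool" where
  "even_flags Z \<longleftrightarrow> Z \<subseteq> flags \<and> (\<forall>x\<in>V. even (card {y. (x, y) \<in> Z})) \<and>
     (\<forall>y\<in>V. even (card {x. (x, y) \<in> Z}))"

text \<open>The directions at the contact \<open>d x y\<close> of arcs to the other corners of \<open>R x\<close> and of \<open>- R y\<close>.\<close>

definition tangents :: "'a \<Rightarrow> 'a \<Rightarrow> (real^3) set" where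
  "tangents x y = d x ` (nb x - {y}) \<union> (\<lambda>b. d b y) ` (nb y - {x})"

lemma flag_swap: "(x, y) \<in> flags \<Longrightarrow> (y, x) \<in> flags"
  unfolding flags_def using nb_V nb_sym by blast

lemma finite_flags: "finite flags"
proof -
  have "flags \<subseteq> V \<times> V" unfolding flags_def using nb_V by blast
  then show ?thesis using finite_V finite_subset by blast
qed

lemma tangent_cross_nonzero:
  assumes "(x, y) \<in> flags" "e \<in> tangents x y"
  shows "cross3 (d x y) e \<noteq> 0"
proof -
  have xy: "x \<in> V" "y \<in> nb x" "y \<in> V" "x \<in> nb y"
    using assms(1) flag_swap[OF assms(1)] unfolding flags_def by auto
  consider a where "a \<in> nb x" "a \<noteq> y" "e = d x a" | b where "b \<in> nb y" "b \<noteq> x" "e = d b y"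
    using assms(2) unfolding tangents_def by blast
  then show ?thesis
  proof cases
    case 1
    then show ?thesis using d_cross_nonzero[of x y a] xy by simp
  next
    case 2
    then have "cross3 (d x y) e = cross3 (d y x) (d y b)"
      using d_swap[of y x] d_swap[of y b] by simp
    then show ?thesis using d_cross_nonzero[of y x b] xy 2 by simp
  qed
qed

lemma sum_even_fibres:
  assumes "finite (Z :: ('b \<times> 'c) set)" "\<And>x. even (card {y. (x, y) \<in> Z})"
  shows "even (\<Sum>(x, y)\<in>Z. G x :: nat)"
proof -
  have fin: "finite {y. (x, y) \<in> Z}" for x
    by (rule finite_subset[of _ "snd ` Z"]) (use assms in force)+
  have Z: "Z = (SIGMA x:fst ` Z. {y. (x, y) \<in> Z})" by force
  have "(\<Sum>(x, y)\<in>Z. G x) = (\<Sum>x\<in>fst ` Z. \<Sum>y\<in>{y. (x, y) \<in> Z}. G x)"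
    by (subst (1) Z, rule sum.Sigma[symmetric]) (use assms fin in auto)
  also have "\<dots> = (\<Sum>x\<in>fst ` Z. card {y. (x, y) \<in> Z} * G x)" by simp
  also have "even \<dots>" using assms(2) by (intro dvd_sum) simp
  finally show ?thesis .
qed

text \<open>The spokes of an even set form a closed polygon: a centre occurs once for each flag of its vertex in \<open>Z\<close>,
and every contact is the end of two spokes.\<close>

lemma spokes_closed:
  assumes "even_flags Z"
  shows "even (\<Sum>i\<in>spokes Z. g (spoke_start i) + g (spoke_end i) :: nat)"
proof -
  have Z: "Z \<subseteq> flags" and fin: "finite Z"
    using assms finite_flags finite_subset unfolding even_flags_def by blast+
  have row: "even (card {y. (x, y) \<in> Z})" for x
  proof (cases "x \<in> V")
    case False
    then have "{y. (x, y) \<in> Z} = {}" using Z unfolding flags_def by auto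
    then show ?thesis by simp
  qed (use assms in \<open>auto simp: even_flags_def\<close>)
  have col: "even (card {x. (x, y) \<in> Z})" for y
  proof (cases "y \<in> V")
    case False
    then have "{x. (x, y) \<in> Z} = {}" using Z nb_V unfolding flags_def by auto
    then show ?thesis by simp
  qed (use assms in \<open>auto simp: even_flags_def\<close>)
  define h where "h i = g (spoke_start i) + g (spoke_end i)" for i
  have "(\<Sum>i\<in>spokes Z. h i) = (\<Sum>i\<in>(\<lambda>(x, y). (True, x, y)) ` Z. h i)
      + (\<Sum>i\<in>(\<lambda>(x, y). (False, y, x)) ` Z. h i)"
    unfolding spokes_def using fin by (intro sum.union_disjoint) auto
  also have "\<dots> = (\<Sum>(x, y)\<in>Z. h (True, x, y)) + (\<Sum>(x, y)\<in>Z. h (False, y, x))"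
    by (subst (1 2) sum.reindex) (auto simp: inj_on_def case_prod_unfold intro!: sum.cong)
  also have "\<dots> = (\<Sum>(x, y)\<in>Z. g (centre x)) + (\<Sum>(x, y)\<in>Z. g (- centre y))
      + 2 * (\<Sum>(x, y)\<in>Z. g (d x y))"
  proof -
    have "h (False, y, x) = g (- centre y) + g (d x y)" for x y
      unfolding h_def spoke_start_def spoke_end_def using d_swap[of x y] by simp
    moreover have "h (True, x, y) = g (centre x) + g (d x y)" for x y
      unfolding h_def spoke_start_def spoke_end_def by simp
    ultimately show ?thesis by (simp add: sum.distrib case_prod_unfold)
  qed
  finally have eq: "(\<Sum>i\<in>spokes Z. h i) = (\<Sum>(x, y)\<in>Z. g (centre x)) + (\<Sum>(x, y)\<in>Z. g (- centre y))
      + 2 * (\<Sum>(x, y)\<in>Z. g (d x y))" .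
  have "even (\<Sum>(x, y)\<in>Z. g (centre x))" using sum_even_fibres[OF fin row] by simp
  moreover have "even (\<Sum>(x, y)\<in>Z. g (- centre y))"
  proof -
    have "(\<Sum>(x, y)\<in>Z. g (- centre y)) = (\<Sum>(y, x)\<in>prod.swap ` Z. g (- centre y))"
      by (subst sum.reindex) (auto simp: case_prod_unfold)
    moreover have "even (\<Sum>(y, x)\<in>prod.swap ` Z. g (- centre y))"
    proof (rule sum_even_fibres)
      show "even (card {x. (y, x) \<in> prod.swap ` Z})" for y
      proof -
        have "{x. (y, x) \<in> prod.swap ` Z} = {x. (x, y) \<in> Z}" by force
        then show ?thesis using col by simp
      qed
    qed (use fin in simp)
    ultimately show ?thesis by simp
  qed
  ultimately show ?thesis using eq unfolding h_def by simp
qed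

end

text \<open>A pole \<open>N\<close> in general position, and a step \<open>\<epsilon>\<close> so small that moving from a corner by \<open>\<epsilon>\<close> towards a
tangent direction preserves general position and affects no triangle except the two at this corner.
For the latter, only the sector of the direction matters.\<close>

locale drawn_contacts = dense_contacts +
  fixes N :: "real^3" and \<epsilon> :: real
  assumes eps: "0 < \<epsilon>" "\<epsilon> < 1"
    and N_spoke: "\<And>w u. (w, u) \<in> flags \<Longrightarrow> triple N (centre w) (d w u) \<noteq> 0"
    and N_tangent: "\<And>x y e. \<lbrakk>(x, y) \<in> flags; e \<in> tangents x y\<rbrakk> \<Longrightarrow> triple N (d x y) e \<noteq> 0"
    and N_near: "\<And>x y e w u. \<lbrakk>(x, y) \<in> flags; e \<in> tangents x y; (w, u) \<in> flags\<rbrakk> \<Longrightarrow>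
        triple N (d x y + \<epsilon> *\<^sub>R e) (centre w) \<noteq> 0 \<and> triple N (d x y + \<epsilon> *\<^sub>R e) (d w u) \<noteq> 0"
    and far: "\<And>x y e b w u. \<lbrakk>(x, y) \<in> flags; e \<in> tangents x y; (w, u) \<in> flags;
        (b, w, u) \<noteq> (True, x, y); (b, w, u) \<noteq> (False, y, x)\<rbrakk> \<Longrightarrow>
        in_tri N (sign_of b *\<^sub>R centre w) (sign_of b *\<^sub>R d w u) (d x y + \<epsilon> *\<^sub>R e) \<longleftrightarrow>
        in_tri N (sign_of b *\<^sub>R centre w) (sign_of b *\<^sub>R d w u) (d x y)"
    and near: "\<And>x y e. \<lbrakk>(x, y) \<in> flags; e \<in> tangents x y\<rbrakk> \<Longrightarrow>
        in_tri N (centre x) (d x y) (d x y + \<epsilon> *\<^sub>R e) \<longleftrightarrow> in_sector (d x y) N (centre x) e"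
      "\<And>x y e. \<lbrakk>(x, y) \<in> flags; e \<in> tangents x y\<rbrakk> \<Longrightarrow>
        in_tri N (- centre y) (d x y) (d x y + \<epsilon> *\<^sub>R e) \<longleftrightarrow> in_sector (d x y) N (- centre y) e"
begin

definition wind :: "('a \<times> 'a) set \<Rightarrow> real^3 \<Rightarrow> nat" where
  "wind Z = winding N spoke_start spoke_end (spokes Z)"

lemma spokes_flags: "\<lbrakk>Z \<subseteq> flags; (b, w, u) \<in> spokes Z\<rbrakk> \<Longrightarrow> (w, u) \<in> flags"
  unfolding spokes_def using flag_swap by auto

lemma finite_spokes: "Z \<subseteq> flags \<Longrightarrow> finite (spokes Z)"
  unfolding spokes_def using finite_flags finite_subset by blast

text \<open>Both points lie on the relative interior of one side, which no spoke meets.\<close>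

lemma wind_side:
  assumes Z: "even_flags Z" and x: "x \<in> V" and s: "side x y y'"
  shows "even (wind Z (sign_of b *\<^sub>R (d x y + \<epsilon> *\<^sub>R d x y'))) \<longleftrightarrow>
    even (wind Z (sign_of b *\<^sub>R (d x y' + \<epsilon> *\<^sub>R d x y)))"
  unfolding wind_def
proof (rule winding_segment)
  have nb: "y \<in> nb x" "y' \<in> nb x" "y \<noteq> y'" using s unfolding side_def by auto
  have fl: "(x, y) \<in> flags" "(x, y') \<in> flags" using nb x unfolding flags_def by auto
  have tg: "d x y' \<in> tangents x y" "d x y \<in> tangents x y'"
    using nb unfolding tangents_def by auto
  have Zf: "Z \<subseteq> flags" using Z unfolding even_flags_def by blast
  show "finite (spokes Z)" using finite_spokes Zf .
  show "even (\<Sum>i\<in>spokes Z. g (spoke_start i) + g (spoke_end i))" for g :: "real^3 \<Rightarrow> nat"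
    using spokes_closed[OF Z] .
  have "triple N (sign_of b *\<^sub>R (d x y + \<epsilon> *\<^sub>R d x y')) (sign_of b *\<^sub>R (d x y' + \<epsilon> *\<^sub>R d x y))
      = (1 - \<epsilon> * \<epsilon>) * triple N (d x y) (d x y')"
  proof -
    have "triple N (sign_of b *\<^sub>R p) (sign_of b *\<^sub>R q) = sign_of b * sign_of b * triple N p q" for p q
      by (simp only: triple_simps mult.assoc)
    then have scal: "triple N (sign_of b *\<^sub>R p) (sign_of b *\<^sub>R q) = triple N p q" for p q
      by (simp only: sign_of_simps mult_1)
    show ?thesis unfolding scal
      using triple_swap(2)[of N "d x y" "d x y'"] by (simp add: algebra_simps)
  qed
  moreover have "\<epsilon> * \<epsilon> < 1 * 1" using eps by (intro mult_strict_mono) auto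
  ultimately show "triple N (sign_of b *\<^sub>R (d x y + \<epsilon> *\<^sub>R d x y')) (sign_of b *\<^sub>R (d x y' + \<epsilon> *\<^sub>R d x y)) \<noteq> 0"
    using N_tangent[OF fl(1) tg(1)] by simp
  fix i assume i: "i \<in> spokes Z"
  obtain b' w u where iw: "i = (b', w, u)" by (cases i)
  have wu: "(w, u) \<in> flags" using spokes_flags[OF Zf] i iw by blast
  show "triple N (spoke_start i) (spoke_end i) \<noteq> 0"
    using N_spoke[OF wu] unfolding iw spoke_start_def spoke_end_def by simp
  show "triple N (sign_of b *\<^sub>R (d x y + \<epsilon> *\<^sub>R d x y')) (spoke_start i) \<noteq> 0"
    "triple N (sign_of b *\<^sub>R (d x y + \<epsilon> *\<^sub>R d x y')) (spoke_end i) \<noteq> 0"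
    "triple N (sign_of b *\<^sub>R (d x y' + \<epsilon> *\<^sub>R d x y)) (spoke_start i) \<noteq> 0"
    "triple N (sign_of b *\<^sub>R (d x y' + \<epsilon> *\<^sub>R d x y)) (spoke_end i) \<noteq> 0"
    using N_near[OF fl(1) tg(1) wu] N_near[OF fl(2) tg(2) wu]
    unfolding iw spoke_start_def spoke_end_def triple_simps(8,9) split_conv
    by (simp_all del: triple_simps add: triple_simps(8,9))
  show "closed_segment (sign_of b *\<^sub>R (d x y + \<epsilon> *\<^sub>R d x y')) (sign_of b *\<^sub>R (d x y' + \<epsilon> *\<^sub>R d x y))
      \<inter> cone2 (spoke_start i) (spoke_end i) = {}"
  proof (intro equals0I, elim IntE)
    fix v assume v: "v \<in> closed_segment (sign_of b *\<^sub>R (d x y + \<epsilon> *\<^sub>R d x y')) (sign_of b *\<^sub>R (d x y' + \<epsilon> *\<^sub>R d x y))"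
      "v \<in> cone2 (spoke_start i) (spoke_end i)"
    then obtain t where t: "0 \<le> t" "t \<le> 1" "v = (1 - t) *\<^sub>R (sign_of b *\<^sub>R (d x y + \<epsilon> *\<^sub>R d x y'))
        + t *\<^sub>R (sign_of b *\<^sub>R (d x y' + \<epsilon> *\<^sub>R d x y))"
      unfolding closed_segment_def by blast
    define \<alpha> \<beta> where "\<alpha> = (1 - t) + t * \<epsilon>" and "\<beta> = (1 - t) * \<epsilon> + t"
    have ab: "0 < \<alpha>" "0 < \<beta>"
      unfolding \<alpha>_def \<beta>_def using t eps
      by (cases "t = 0"; cases "t = 1"; simp add: add_pos_nonneg add_nonneg_pos)+
    have ve: "v = sign_of b *\<^sub>R (\<alpha> *\<^sub>R d x y + \<beta> *\<^sub>R d x y')"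
      unfolding t(3) \<alpha>_def \<beta>_def by (simp add: algebra_simps)
    obtain \<mu> \<nu> where m: "0 \<le> \<mu>" "0 \<le> \<nu>" "v = \<mu> *\<^sub>R (sign_of b' *\<^sub>R centre w) + \<nu> *\<^sub>R (sign_of b' *\<^sub>R d w u)"
      using v(2) unfolding iw spoke_start_def spoke_end_def cone2_def by auto
    have "sign_of b' *\<^sub>R v = (sign_of b' * sign_of b') *\<^sub>R (\<mu> *\<^sub>R centre w + \<nu> *\<^sub>R d w u)"
      unfolding m(3) by (simp only: scaleR_right_distrib scaleR_scaleR mult_ac)
    then have "sign_of b' *\<^sub>R v \<in> cone2 (centre w) (d w u)"
      using m by (intro cone2_I[of _ \<mu> _ \<nu>]) auto
    then have "(sign_of b' * sign_of b) *\<^sub>R (\<alpha> *\<^sub>R d x y + \<beta> *\<^sub>R d x y') \<in> cone2 (centre w) (d w u)"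
      unfolding ve by simp
    moreover have "sign_of b' * sign_of b = 1 \<or> sign_of b' * sign_of b = - 1" by (cases b; cases b') auto
    ultimately show False using side_avoids_spoke[OF x s _ _ ab] wu unfolding flags_def by blast
  qed
qed

text \<open>Only the two spokes of the flag \<open>(x, y)\<close> can tell the points next to the corner \<open>d x y\<close> apart.\<close>

lemma wind_corner:
  assumes Z: "even_flags Z" and xy: "(x, y) \<in> flags"
    and e: "e \<in> tangents x y" "e' \<in> tangents x y"
  defines "P \<equiv> \<lambda>e. in_sector (d x y) N (centre x) e \<noteq> in_sector (d x y) N (- centre y) e"
  shows "(even (wind Z (d x y + \<epsilon> *\<^sub>R e)) \<longleftrightarrow> even (wind Z (d x y + \<epsilon> *\<^sub>R e'))) \<longleftrightarrow>
     (x, y) \<notin> Z \<or> P e = P e'"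
proof -
  define I where "I = {(True, x, y), (False, y, x)}"
  define hit :: "real^3 \<Rightarrow> bool \<times> 'a \<times> 'a \<Rightarrow> nat" where
    "hit p i = of_bool (in_tri N (spoke_start i) (spoke_end i) p)" for p i
  have Zf: "Z \<subseteq> flags" using Z unfolding even_flags_def by blast
  have split: "wind Z p = (\<Sum>i\<in>spokes Z - I. hit p i) + (\<Sum>i\<in>spokes Z \<inter> I. hit p i)" for p
    unfolding wind_def winding_def hit_def
    using sum.Int_Diff[OF finite_spokes[OF Zf], of _ I] by (simp add: add.commute)
  have away: "(\<Sum>i\<in>spokes Z - I. hit (d x y + \<epsilon> *\<^sub>R e) i) = (\<Sum>i\<in>spokes Z - I. hit (d x y) i)"
    if "e \<in> tangents x y" for e
  proof (rule sum.cong[OF refl])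
    fix i assume i: "i \<in> spokes Z - I"
    obtain b w u where iw: "i = (b, w, u)" by (cases i)
    have "(w, u) \<in> flags" using spokes_flags[OF Zf] i iw by blast
    then show "hit (d x y + \<epsilon> *\<^sub>R e) i = hit (d x y) i"
      unfolding hit_def iw spoke_start_def spoke_end_def
      using far[OF xy that, of w u b] i unfolding iw I_def by auto
  qed
  have at: "even (\<Sum>i\<in>spokes Z \<inter> I. hit (d x y + \<epsilon> *\<^sub>R e) i) \<longleftrightarrow> (x, y) \<notin> Z \<or> \<not> P e"
    if "e \<in> tangents x y" for e
  proof (cases "(x, y) \<in> Z")
    case True
    then have "spokes Z \<inter> I = I" unfolding spokes_def I_def by force
    moreover have "(\<Sum>i\<in>I. hit (d x y + \<epsilon> *\<^sub>R e) i) = of_bool (in_sector (d x y) N (centre x) e)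
        + of_bool (in_sector (d x y) N (- centre y) e)"
      unfolding I_def hit_def spoke_start_def spoke_end_def
      using near[OF xy that] d_swap[of x y] by simp
    ultimately show ?thesis using True unfolding P_def by auto
  next
    case False
    then have "spokes Z \<inter> I = {}" unfolding spokes_def I_def by force
    then show ?thesis using False by simp
  qed
  show ?thesis unfolding split even_add away[OF e(1)] away[OF e(2)] at[OF e(1)] at[OF e(2)] by blast
qed

text \<open>In the notation of \<open>gap_crossing\<close>, with \<open>z = d x y\<close>: the sides are \<open>e1 = d x a1\<close>, \<open>e2 = d x a2\<close>,
\<open>e3 = d b1 y\<close> and \<open>e4 = d b2 y\<close>.\<close>

lemma wind_around_corner:
  assumes Z: "even_flags Z" and xy: "x \<in> V" "y \<in> V"
    and s: "side x a1 y" "side x y a2" "side y b1 x" "side y x b2"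
  shows "even (wind Z (d x y + \<epsilon> *\<^sub>R d x a1)) \<longleftrightarrow> even (wind Z (d x y + \<epsilon> *\<^sub>R d b1 y))"
    and "even (wind Z (d x y + \<epsilon> *\<^sub>R d b2 y)) \<longleftrightarrow> even (wind Z (d x y + \<epsilon> *\<^sub>R d x a2))"
    and "(even (wind Z (d x y + \<epsilon> *\<^sub>R d x a1)) \<longleftrightarrow> even (wind Z (d x y + \<epsilon> *\<^sub>R d x a2))) \<longleftrightarrow> (x, y) \<notin> Z"
proof -
  have nb: "a1 \<in> nb x" "a2 \<in> nb x" "y \<in> nb x" "a1 \<noteq> y" "a2 \<noteq> y"
    "b1 \<in> nb y" "b2 \<in> nb y" "x \<in> nb y" "b1 \<noteq> x" "b2 \<noteq> x"
    using s unfolding side_def by auto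
  have fl: "(x, y) \<in> flags" "(y, x) \<in> flags" using nb xy unfolding flags_def by auto
  have tg: "d x a1 \<in> tangents x y" "d x a2 \<in> tangents x y" "d b1 y \<in> tangents x y" "d b2 y \<in> tangents x y"
    using nb unfolding tangents_def by auto
  have rotN: "triple (d x y) N e = - triple N (d x y) e" for e by (rule triple_swap(1))
  define P where "P e \<longleftrightarrow> in_sector (d x y) N (centre x) e \<noteq> in_sector (d x y) N (- centre y) e" for e
  have a12: "a1 \<noteq> a2" using side_asym[OF xy(1) s(2)] s(1) by blast
  have b12: "b1 \<noteq> b2" using side_asym[OF xy(2) s(4)] s(3) by blast
  have sw: "d y x = - d x y" "d y b1 = - d b1 y" "d y b2 = - d b2 y" using d_swap by blast+
  have "P (d x a1) = P (d b1 y) \<and> P (d b2 y) = P (d x a2) \<and> P (d x a1) \<noteq> P (d x a2)"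
    unfolding P_def
  proof (rule gap_crossing)
    show "triple (d x y) N (d x a1) \<noteq> 0" "triple (d x y) N (d x a2) \<noteq> 0"
      "triple (d x y) N (d b1 y) \<noteq> 0" "triple (d x y) N (d b2 y) \<noteq> 0"
      unfolding rotN using N_tangent[OF fl(1)] tg by simp_all
    show "triple (d x y) N (centre x) \<noteq> 0"
      unfolding rotN using N_spoke[OF fl(1)] triple_swap(2)[of N "d x y" "centre x"] by simp
    show "triple (d x y) N (- centre y) \<noteq> 0"
      unfolding rotN using N_spoke[OF fl(2)] triple_swap(2)[of N "d x y" "centre y"] sw by simp
    show "0 < triple (d x y) (d x a2) (centre x)" using side_centre_pos[OF xy(1) s(2)] .
    show "0 < triple (d x y) (centre x) (d x a1)"
      using side_centre_pos[OF xy(1) s(1)] triple_rotate[of "d x y" "centre x" "d x a1"] by simp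
    show "0 < triple (d x y) (d x a2) (d x a1)" using s(2) nb a12 unfolding side_def by auto
    show "0 < triple (d x y) (d b1 y) (- centre y)"
      using side_centre_pos[OF xy(2) s(3)] triple_swap(1)[of "d b1 y" "d x y" "centre y"]
      unfolding sw by simp
    show "0 < triple (d x y) (- centre y) (d b2 y)"
      using side_centre_pos[OF xy(2) s(4)] triple_swap(2)[of "d x y" "centre y" "d b2 y"]
      unfolding sw by simp
    have "0 < triple (d y x) (d y b2) (d y b1)" using s(4) nb b12 unfolding side_def by auto
    then show "0 < triple (d x y) (d b1 y) (d b2 y)"
      using triple_swap(2)[of "d x y" "d b1 y" "d b2 y"] unfolding sw by simp
    show "\<not> (0 \<le> triple (d x y) (d x a2) (- centre y) \<and> 0 \<le> triple (d x y) (- centre y) (d x a1))"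
      using centre_outside_wedge[OF xy s(1,2)] .
    show "\<not> (0 \<le> triple (d x y) (d b1 y) (centre x) \<and> 0 \<le> triple (d x y) (centre x) (d b2 y))"
      using centre_outside_wedge[OF xy(2,1) s(3,4)] triple_swap(2)[of "d x y" "centre x" "d b2 y"]
        triple_swap(2)[of "d x y" "centre x" "d b1 y"]
      unfolding sw by auto
  qed
  then show "even (wind Z (d x y + \<epsilon> *\<^sub>R d x a1)) \<longleftrightarrow> even (wind Z (d x y + \<epsilon> *\<^sub>R d b1 y))"
    "even (wind Z (d x y + \<epsilon> *\<^sub>R d b2 y)) \<longleftrightarrow> even (wind Z (d x y + \<epsilon> *\<^sub>R d x a2))"
    "(even (wind Z (d x y + \<epsilon> *\<^sub>R d x a1)) \<longleftrightarrow> even (wind Z (d x y + \<epsilon> *\<^sub>R d x a2))) \<longleftrightarrow> (x, y) \<notin> Z"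
    using wind_corner[OF Z fl(1)] tg unfolding P_def by blast+
qed

end

text \<open>The pole is generic for all centres and corners. Every condition on \<open>\<epsilon>\<close> then holds for all sufficiently
small positive \<open>\<epsilon>\<close>, and there are finitely many of them.\<close>

theorem (in dense_contacts) drawing_exists: "\<exists>N \<epsilon>. drawn_contacts V nb d N \<epsilon>"
proof -
  define W where "W = centre ` V \<union> (\<lambda>(x, y). d x y) ` flags"
  have "finite W" unfolding W_def using finite_V finite_flags by simp
  then obtain N where N: "\<And>u v. \<lbrakk>u \<in> W; v \<in> W; cross3 u v \<noteq> 0\<rbrakk> \<Longrightarrow> triple N u v \<noteq> 0"
    using generic_pole[of W] by metis
  have cW: "centre w \<in> W" if "w \<in> V" for w using that unfolding W_def by blast
  have dW: "d x y \<in> W" if "(x, y) \<in> flags" for x y using that unfolding W_def by force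
  have finite_tangents: "finite (tangents x y)" if "(x, y) \<in> flags" for x y
  proof -
    have "x \<in> V" "y \<in> V" using that flag_swap[OF that] unfolding flags_def by auto
    then show ?thesis unfolding tangents_def using finite_nb by simp
  qed
  have spoke: "triple N (centre w) (d w u) \<noteq> 0" if "(w, u) \<in> flags" for w u
  proof -
    have "cross3 (d w u) (centre w) \<noteq> 0" using centre_cross_nonzero that unfolding flags_def by simp
    then have "triple N (d w u) (centre w) \<noteq> 0" using N dW cW that unfolding flags_def by blast
    then show ?thesis using triple_swap(2)[of N "d w u" "centre w"] by simp
  qed
  have tangent: "triple N (d x y) e \<noteq> 0" if xy: "(x, y) \<in> flags" and e: "e \<in> tangents x y" for x y e
  proof -
    have "e \<in> W \<or> - e \<in> W"
    proof -
      have "x \<in> V" "y \<in> V" using xy flag_swap[OF xy] unfolding flags_def by auto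
      then consider a where "e = d x a" "(x, a) \<in> flags" | b where "e = - d y b" "(y, b) \<in> flags"
        using e d_swap[of _ y] unfolding tangents_def flags_def by blast
      then show ?thesis by cases (use dW in auto)
    qed
    moreover have "cross3 (d x y) e \<noteq> 0" using tangent_cross_nonzero[OF xy e] .
    moreover have "cross3 (d x y) (- e) = - cross3 (d x y) e" by simp
    ultimately show ?thesis using N[OF dW[OF xy], of e] N[OF dW[OF xy], of "- e"] by auto
  qed
  have off: "\<forall>\<^sub>F \<epsilon> in at_right 0. triple N (d x y + \<epsilon> *\<^sub>R e) v \<noteq> 0"
    if xy: "(x, y) \<in> flags" and e: "e \<in> tangents x y" and v: "v \<in> W" "v \<noteq> 0" for x y e v
  proof (cases "cross3 (d x y) v = 0")
    case True
    have "d x y \<noteq> 0" using d_nonzero xy unfolding flags_def by blast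
    then obtain k where k: "v = k *\<^sub>R d x y" using cross3_eq_0_parallel[OF True] by blast
    then have k0: "k \<noteq> 0" using v(2) by auto
    have "triple N (d x y + \<epsilon> *\<^sub>R e) v = - (\<epsilon> * k * triple N (d x y) e)" for \<epsilon>
      unfolding k using triple_swap(2)[of N "d x y" e] by simp
    then have "triple N (d x y + \<epsilon> *\<^sub>R e) v \<noteq> 0" if "0 < \<epsilon>" for \<epsilon>
      using that k0 tangent[OF xy e] by simp
    then show ?thesis using eventually_at_right_less[of "0::real"] by (rule eventually_mono[rotated])
  next
    case False
    then have "triple N (d x y) v \<noteq> 0" using N dW[OF xy] v by blast
    from eventually_affine_nonzero[OF this, of "triple N e v"] show ?thesis by simp
  qed
  have d0: "d w u \<noteq> 0" if "(w, u) \<in> flags" for w u using d_nonzero that unfolding flags_def by blast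
  have c0: "centre w \<noteq> 0" if "(w, u) \<in> flags" for w u
    using centre_not_parallel[of w u 0] that unfolding flags_def by simp
  have E_near: "\<forall>\<^sub>F \<epsilon> in at_right 0. triple N (d x y + \<epsilon> *\<^sub>R e) (centre w) \<noteq> 0 \<and>
      triple N (d x y + \<epsilon> *\<^sub>R e) (d w u) \<noteq> 0"
    if "(x, y) \<in> flags" "e \<in> tangents x y" "(w, u) \<in> flags" for x y e w u
    using off[OF that(1,2) cW c0] off[OF that(1,2) dW d0] that(3)
    by (auto simp: flags_def intro: eventually_conj)
  have E_far: "\<forall>\<^sub>F \<epsilon> in at_right 0. (b, w, u) \<noteq> (True, x, y) \<longrightarrow> (b, w, u) \<noteq> (False, y, x) \<longrightarrow>
      (in_tri N (sign_of b *\<^sub>R centre w) (sign_of b *\<^sub>R d w u) (d x y + \<epsilon> *\<^sub>R e) \<longleftrightarrow>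
        in_tri N (sign_of b *\<^sub>R centre w) (sign_of b *\<^sub>R d w u) (d x y))"
    if xy: "(x, y) \<in> flags" and e: "e \<in> tangents x y" and wu: "(w, u) \<in> flags" for x y e b w u
  proof (cases "(b, w, u) \<noteq> (True, x, y) \<and> (b, w, u) \<noteq> (False, y, x)")
    case True
    have V: "x \<in> V" "y \<in> nb x" "w \<in> V" "u \<in> nb w" using xy wu unfolding flags_def by auto
    have D: "triple N (sign_of b *\<^sub>R centre w) (sign_of b *\<^sub>R d w u) \<noteq> 0" using spoke[OF wu] by simp
    have avoid: "d x y \<notin> cone2 (sign_of b *\<^sub>R centre w) (sign_of b *\<^sub>R d w u)"
    proof
      assume "d x y \<in> cone2 (sign_of b *\<^sub>R centre w) (sign_of b *\<^sub>R d w u)"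
      then obtain \<mu> \<nu> where m: "0 \<le> \<mu>" "0 \<le> \<nu>"
        "d x y = \<mu> *\<^sub>R (sign_of b *\<^sub>R centre w) + \<nu> *\<^sub>R (sign_of b *\<^sub>R d w u)" unfolding cone2_def by auto
      have "sign_of b *\<^sub>R d x y = (sign_of b * sign_of b) *\<^sub>R (\<mu> *\<^sub>R centre w + \<nu> *\<^sub>R d w u)"
        unfolding m(3) by (simp only: scaleR_right_distrib scaleR_scaleR mult_ac)
      then have "sign_of b *\<^sub>R d x y \<in> cone2 (centre w) (d w u)"
        using m by (intro cone2_I[of _ \<mu> _ \<nu>]) auto
      then show False using corner_on_spoke[OF V] True by (cases b) auto
    qed
    have ray: "d x y \<notin> cone2 N a" if a: "triple N (d x y) a \<noteq> 0 \<or> (\<exists>k. a = k *\<^sub>R d x y)"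
      and on: "\<And>k. 0 \<le> k \<Longrightarrow> d x y \<noteq> k *\<^sub>R a" for a
    proof
      assume "d x y \<in> cone2 N a"
      then obtain \<mu> \<nu> where m: "0 \<le> \<mu>" "0 \<le> \<nu>" "d x y = \<mu> *\<^sub>R N + \<nu> *\<^sub>R a" unfolding cone2_def by auto
      have "triple N (d x y) a = 0" unfolding m(3) by simp
      then obtain k where "a = k *\<^sub>R d x y" using a by blast
      then have "d x y = \<mu> *\<^sub>R N + (\<nu> * k) *\<^sub>R d x y" using m(3) by (metis scaleR_scaleR)
      then have "d x y - (\<nu> * k) *\<^sub>R d x y = \<mu> *\<^sub>R N" by (simp only: diff_eq_eq)
      then have "(1 - \<nu> * k) *\<^sub>R d x y = \<mu> *\<^sub>R N" by (simp add: scaleR_left_diff_distrib)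
      then have "(1 - \<nu> * k) * triple N (d x y) e = \<mu> * triple N N e"
        by (metis triple_simps(7,8))
      then have "1 - \<nu> * k = 0" using tangent[OF xy e] by simp
      then have "\<mu> *\<^sub>R N = 0" using \<open>(1 - \<nu> * k) *\<^sub>R d x y = \<mu> *\<^sub>R N\<close> by simp
      then have "d x y = \<nu> *\<^sub>R a" using m(3) by simp
      then show False using on[OF m(2)] by blast
    qed
    have par: "triple N (d x y) (sign_of b *\<^sub>R v) \<noteq> 0 \<or> (\<exists>k. sign_of b *\<^sub>R v = k *\<^sub>R d x y)" if "v \<in> W" for v
    proof (cases "cross3 (d x y) v = 0")
      case True
      then obtain k where "v = k *\<^sub>R d x y" using cross3_eq_0_parallel d0[OF xy] by metis
      then show ?thesis by (metis scaleR_scaleR)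
    next
      case False
      then show ?thesis using N[OF dW[OF xy] that] by simp
    qed
    have right: "k *\<^sub>R c \<in> cone2 a c" if "0 \<le> k" for k a and c :: "real^3"
      by (rule cone2_I[of _ 0 _ k]) (use that in simp_all)
    have "d x y \<notin> cone2 N (sign_of b *\<^sub>R centre w)"
      using ray[OF par[OF cW[OF V(3)]]] avoid cone2_left(1) by metis
    moreover have "d x y \<notin> cone2 N (sign_of b *\<^sub>R d w u)"
      using ray[OF par[OF dW[OF wu]]] avoid right by metis
    ultimately have "\<forall>\<^sub>F \<epsilon> in at_right 0. in_tri N (sign_of b *\<^sub>R centre w) (sign_of b *\<^sub>R d w u) (d x y + \<epsilon> *\<^sub>R e) \<longleftrightarrow>
        in_tri N (sign_of b *\<^sub>R centre w) (sign_of b *\<^sub>R d w u) (d x y)"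
      using in_tri_near[OF D avoid] by blast
    then show ?thesis by (auto elim!: eventually_mono)
  qed auto
  have E_at1: "\<forall>\<^sub>F \<epsilon> in at_right 0. in_tri N (centre x) (d x y) (d x y + \<epsilon> *\<^sub>R e) \<longleftrightarrow>
      in_sector (d x y) N (centre x) e" if "(x, y) \<in> flags" for x y e
    using in_tri_near_vertex[OF spoke[OF that]] .
  have E_at2: "\<forall>\<^sub>F \<epsilon> in at_right 0. in_tri N (- centre y) (d x y) (d x y + \<epsilon> *\<^sub>R e) \<longleftrightarrow>
      in_sector (d x y) N (- centre y) e" if "(x, y) \<in> flags" for x y e
    using spoke[OF flag_swap[OF that]] d_swap[of y x] by (intro in_tri_near_vertex) simp
  define G where "G \<epsilon> x y e w u b \<longleftrightarrow>
     (triple N (d x y + \<epsilon> *\<^sub>R e) (centre w) \<noteq> 0 \<and> triple N (d x y + \<epsilon> *\<^sub>R e) (d w u) \<noteq> 0) \<and>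
     ((b, w, u) \<noteq> (True, x, y) \<longrightarrow> (b, w, u) \<noteq> (False, y, x) \<longrightarrow>
      (in_tri N (sign_of b *\<^sub>R centre w) (sign_of b *\<^sub>R d w u) (d x y + \<epsilon> *\<^sub>R e) \<longleftrightarrow>
        in_tri N (sign_of b *\<^sub>R centre w) (sign_of b *\<^sub>R d w u) (d x y))) \<and>
     (in_tri N (centre x) (d x y) (d x y + \<epsilon> *\<^sub>R e) \<longleftrightarrow> in_sector (d x y) N (centre x) e) \<and>
     (in_tri N (- centre y) (d x y) (d x y + \<epsilon> *\<^sub>R e) \<longleftrightarrow> in_sector (d x y) N (- centre y) e)"
    for \<epsilon> x y e w u b
  have each: "\<forall>\<^sub>F \<epsilon> in at_right 0. G \<epsilon> x y e w u b"
    if "(x, y) \<in> flags" "e \<in> tangents x y" "(w, u) \<in> flags" for x y e w u b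
    unfolding G_def
    by (rule eventually_conj[OF E_near[OF that] eventually_conj[OF E_far[OF that]
          eventually_conj[OF E_at1[OF that(1)] E_at2[OF that(1)]]]])
  have all: "\<forall>\<^sub>F \<epsilon> in at_right 0. \<forall>p\<in>flags. \<forall>e\<in>tangents (fst p) (snd p). \<forall>q\<in>flags. \<forall>b\<in>UNIV.
     G \<epsilon> (fst p) (snd p) e (fst q) (snd q) b"
    by (intro eventually_ball_finite finite_flags ballI finite_tangents each) auto
  have "\<forall>\<^sub>F \<epsilon> in at_right (0::real). 0 < \<epsilon> \<and> \<epsilon> < 1"
    using eventually_at_right_real[of 0 1] by (auto elim!: eventually_mono)
  from eventually_happens'[OF _ eventually_conj[OF this all]] obtain \<epsilon> where eps: "0 < \<epsilon>" "\<epsilon> < 1"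
    and good: "\<forall>p\<in>flags. \<forall>e\<in>tangents (fst p) (snd p). \<forall>q\<in>flags. \<forall>b\<in>UNIV.
     G \<epsilon> (fst p) (snd p) e (fst q) (snd q) b"
    by auto
  have "drawn_contacts V nb d N \<epsilon>"
  proof
    fix x y e w u b
    assume xy: "(x, y) \<in> flags" and e: "e \<in> tangents x y"
    have G: "G \<epsilon> x y e w u b" if "(w, u) \<in> flags" for w u b using good xy e that by force
    show "triple N (d x y) e \<noteq> 0" by (rule tangent[OF xy e])
    show "in_tri N (centre x) (d x y) (d x y + \<epsilon> *\<^sub>R e) = in_sector (d x y) N (centre x) e"
      "in_tri N (- centre y) (d x y) (d x y + \<epsilon> *\<^sub>R e) = in_sector (d x y) N (- centre y) e"
      using G[OF xy] unfolding G_def by blast+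
    assume wu: "(w, u) \<in> flags"
    note G' = G[OF wu, unfolded G_def]
    show "triple N (d x y + \<epsilon> *\<^sub>R e) (centre w) \<noteq> 0 \<and> triple N (d x y + \<epsilon> *\<^sub>R e) (d w u) \<noteq> 0"
      using G' by blast
    assume "(b, w, u) \<noteq> (True, x, y)" "(b, w, u) \<noteq> (False, y, x)"
    then show "in_tri N (sign_of b *\<^sub>R centre w) (sign_of b *\<^sub>R d w u) (d x y + \<epsilon> *\<^sub>R e) =
        in_tri N (sign_of b *\<^sub>R centre w) (sign_of b *\<^sub>R d w u) (d x y)"
      using G'[of b] by blast
  qed (use eps spoke in auto)
  then show ?thesis by blast
qed

section \<open>Counting faces\<close>

text \<open>The orbits of \<open>f\<close> are contained in the classes of points that no closed set separates, so these classes
have at least four elements each. A closed set is a union of classes.\<close>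

lemma card_closed_sets:
  fixes f :: "'t \<Rightarrow> 't"
  assumes D: "finite D" and f: "\<And>x. x \<in> D \<Longrightarrow> f x \<in> D"
    and four: "\<And>x. x \<in> D \<Longrightarrow> card {x, f x, f (f x), f (f (f x))} = 4"
  obtains m where "4 * m \<le> card D" "card {S. S \<subseteq> D \<and> (\<forall>x\<in>D. f x \<in> S \<longleftrightarrow> x \<in> S)} \<le> 2 ^ m"
proof -
  define \<S> where "\<S> = {S. S \<subseteq> D \<and> (\<forall>x\<in>D. f x \<in> S \<longleftrightarrow> x \<in> S)}"
  define r where "r = {(x, y). x \<in> D \<and> y \<in> D \<and> (\<forall>S\<in>\<S>. x \<in> S \<longleftrightarrow> y \<in> S)}"
  have r: "equiv D r"
    unfolding equiv_def r_def refl_on_def sym_def trans_def by auto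
  have finr: "finite (D // r)" using D r by (metis equiv_type finite_quotient)
  have class4: "4 \<le> card C" if "C \<in> D // r" for C
  proof -
    from that obtain x where x: "x \<in> D" "C = r `` {x}" unfolding quotient_def by blast
    have "{x, f x, f (f x), f (f (f x))} \<subseteq> C"
      unfolding x(2) r_def \<S>_def using f x(1) by auto
    moreover have "finite C" using that D r by (metis equiv_type finite_equiv_class)
    ultimately show ?thesis using four[OF x(1)] card_mono by metis
  qed
  have "4 * card (D // r) \<le> (\<Sum>C\<in>D // r. card C)"
    using sum_mono[of "D // r" "\<lambda>_. 4" card] class4 by simp
  also have "\<dots> = card (\<Union> (D // r))"
    using quotient_disj[OF r] finite_equiv_class[OF D equivE]
    by (intro card_Union_disjoint[symmetric]) (auto simp: pairwise_def disjnt_def intro: finite_subset[OF _ D] dest: in_quotient_imp_subset[OF r])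
  finally have m: "4 * card (D // r) \<le> card D" using Union_quotient[OF r] by simp
  have "inj_on (\<lambda>S. {C \<in> D // r. C \<subseteq> S}) \<S>"
  proof (rule inj_onI)
    fix S T assume ST: "S \<in> \<S>" "T \<in> \<S>" and eq: "{C \<in> D // r. C \<subseteq> S} = {C \<in> D // r. C \<subseteq> T}"
    have "A \<subseteq> B" if A: "A \<in> \<S>" and eq: "{C \<in> D // r. C \<subseteq> A} = {C \<in> D // r. C \<subseteq> B}" for A B
    proof
      fix x assume x: "x \<in> A"
      then have xD: "x \<in> D" using A unfolding \<S>_def by blast
      have "r `` {x} \<subseteq> A" using A x unfolding r_def by blast
      then have "r `` {x} \<subseteq> B" using eq quotientI[OF xD] by blast
      then show "x \<in> B" using equiv_class_self[OF r xD] by blast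
    qed
    from this[OF ST(1) eq] this[OF ST(2) eq[symmetric]] show "S = T" by (rule equalityI)
  qed
  then have "card \<S> \<le> card (Pow (D // r))" by (rule card_inj_on_le) (use finr in auto)
  then have "card \<S> \<le> 2 ^ card (D // r)" using finr by (simp add: card_Pow)
  then show thesis using that[OF m] unfolding \<S>_def by blast
qed

lemma even_card_sym_diff:
  assumes "finite A" "finite B"
  shows "even (card (A - B \<union> (B - A))) \<longleftrightarrow> even (card A) = even (card B)"
proof -
  have "card (A - B \<union> (B - A)) = card (A - B) + card (B - A)"
    using assms by (intro card_Un_disjoint) auto
  moreover have "card A = card (A - B) + card (A \<inter> B)"
    using assms by (metis card_Diff_subset_Int Int_lower1 add.commute card_mono finite_Int le_add_diff_inverse)
  moreover have "card B = card (B - A) + card (A \<inter> B)"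
    using assms by (metis card_Diff_subset_Int Int_commute Int_lower1 add.commute card_mono finite_Int le_add_diff_inverse)
  ultimately show ?thesis by presburger
qed

text \<open>Membership of one fixed element in \<open>C\<close> is determined by the parities.\<close>

lemma card_balanced_pairs:
  assumes "finite V" "V \<noteq> {}"
  shows "card {(R, C). R \<subseteq> V \<and> C \<subseteq> V \<and> (even (card R) \<longleftrightarrow> even (card C))} \<le> 2 ^ (2 * card V - 1)"
proof -
  obtain v where v: "v \<in> V" using assms by blast
  define T where "T = {(R, C). R \<subseteq> V \<and> C \<subseteq> V \<and> (even (card R) \<longleftrightarrow> even (card C))}"
  have "inj_on (\<lambda>(R, C). (R, C - {v})) T"
  proof (rule inj_onI)
    fix s t assume st: "s \<in> T" "t \<in> T" "(\<lambda>(R, C). (R, C - {v})) s = (\<lambda>(R, C). (R, C - {v})) t"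
    obtain R C where s: "s = (R, C)" by (cases s)
    obtain C' where t: "t = (R, C')" using st(3) s by (cases t) auto
    have h: "(R, C) \<in> T" "(R, C') \<in> T" "C - {v} = C' - {v}" using st unfolding s t by auto
    have fin: "finite C" "finite C'" using h assms finite_subset unfolding T_def by auto
    have par: "even (card C) \<longleftrightarrow> even (card C')" using h unfolding T_def by auto
    have "v \<in> C \<longleftrightarrow> v \<in> C'"
    proof (rule ccontr)
      assume ne: "\<not> (v \<in> C \<longleftrightarrow> v \<in> C')"
      then consider "v \<in> C" "v \<notin> C'" | "v \<notin> C" "v \<in> C'" by blast
      then show False
      proof cases
        case 1
        then have "C = insert v C'" "v \<notin> C'" using h(3) by auto
        then show False using fin par by simp
      next
        case 2
        then have "C' = insert v C" "v \<notin> C" using h(3) by auto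
        then show False using fin par by simp
      qed
    qed
    then show "s = t" unfolding s t using h(3) by blast
  qed
  then have "card T \<le> card (Pow V \<times> Pow (V - {v}))"
    by (rule card_inj_on_le) (use assms in \<open>auto simp: T_def\<close>)
  also have "\<dots> = 2 ^ card V * 2 ^ (card V - 1)"
    using assms v by (simp add: card_cartesian_product card_Pow)
  also have "\<dots> = 2 ^ (2 * card V - 1)"
  proof -
    have "0 < card V" using assms by (simp add: card_gt_0_iff)
    then show ?thesis by (simp flip: power_add) 
  qed
  finally show ?thesis unfolding T_def .
qed

context dense_contacts
begin

text \<open>The even sets are the kernel of the map that sends a set of flags to its sets of vertices of odd degree
on the two sides of the bipartition. All fibres of this map are at most as large as the kernel. Since both
degree sums count the flags, the image satisfies one parity relation, which accounts for the \<open>- 1\<close>.\<close>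

lemma card_even_flags:
  assumes V: "V \<noteq> {}"
  shows "2 ^ card flags \<le> card {Z. even_flags Z} * 2 ^ (2 * card V - 1)"
proof -
  define row col where "row Z x = card {y. (x, y) \<in> Z}" and "col Z y = card {x. (x, y) \<in> Z}"
    for Z :: "('a \<times> 'a) set" and x y
  define p where "p Z = ({x \<in> V. odd (row Z x)}, {y \<in> V. odd (col Z y)})" for Z
  define T where "T = {(R, C). R \<subseteq> V \<and> C \<subseteq> V \<and> (even (card R) \<longleftrightarrow> even (card C))}"
  have finT: "finite T" by (rule finite_subset[of _ "Pow V \<times> Pow V"]) (use finite_V in \<open>auto simp: T_def\<close>)
  have finE: "finite {Z. even_flags Z}"
    by (rule finite_subset[of _ "Pow flags"]) (use finite_flags in \<open>auto simp: even_flags_def\<close>)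
  have finrow: "finite {y. (x, y) \<in> Z}" "finite {x. (x, y) \<in> Z}" if "Z \<subseteq> flags" for Z x y
  proof -
    have "finite Z" using that finite_flags finite_subset by blast
    then have "finite (snd ` Z)" "finite (fst ` Z)" by auto
    moreover have "{y. (x, y) \<in> Z} \<subseteq> snd ` Z" "{x. (x, y) \<in> Z} \<subseteq> fst ` Z" by force+
    ultimately show "finite {y. (x, y) \<in> Z}" "finite {x. (x, y) \<in> Z}" using finite_subset by blast+
  qed
  have pT: "p Z \<in> T" if Z: "Z \<subseteq> flags" for Z
  proof -
    have ZV: "Z \<subseteq> V \<times> V" using Z nb_V unfolding flags_def by blast
    have "Z = (SIGMA x:V. {y. (x, y) \<in> Z})" using ZV by auto
    then have "card Z = (\<Sum>x\<in>V. row Z x)"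
      using card_SigmaI[OF finite_V, of "\<lambda>x. {y. (x, y) \<in> Z}"] finrow(1)[OF Z]
      unfolding row_def by simp
    moreover have "card Z = (\<Sum>y\<in>V. col Z y)"
    proof -
      have "card Z = card (prod.swap ` Z)" by (simp add: card_image)
      also have "prod.swap ` Z = (SIGMA y:V. {x. (x, y) \<in> Z})" using ZV by auto
      finally show ?thesis
        using card_SigmaI[OF finite_V, of "\<lambda>y. {x. (x, y) \<in> Z}"] finrow(2)[OF Z]
        unfolding col_def by simp
    qed
    ultimately have "even (\<Sum>x\<in>V. row Z x) \<longleftrightarrow> even (\<Sum>y\<in>V. col Z y)" by simp
    then show ?thesis unfolding p_def T_def even_sum_iff[OF finite_V, of "row Z"] even_sum_iff[OF finite_V, of "col Z"]
      by simp
  qed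
  have fibre: "card {Z \<in> Pow flags. p Z = t} \<le> card {Z. even_flags Z}" for t
  proof (cases "{Z \<in> Pow flags. p Z = t} = {}")
    case True
    show ?thesis unfolding True by simp
  next
    case False
    then obtain Y where Y: "Y \<subseteq> flags" "p Y = t" by blast
    \<comment> \<open>Symmetric difference with one element of the fibre maps the fibre into the kernel.\<close>
    let ?sd = "\<lambda>Z. Z - Y \<union> (Y - Z)"
    have "inj_on ?sd {Z \<in> Pow flags. p Z = t}" by (rule inj_onI) blast
    moreover have "?sd ` {Z \<in> Pow flags. p Z = t} \<subseteq> {Z. even_flags Z}"
    proof clarify
      fix Z assume Z: "Z \<subseteq> flags" "t = p Z"
      have "even (row Z x) = even (row Y x)" if "x \<in> V" for x
        using Y(2) Z(2) that unfolding p_def by blast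
      moreover have "even (col Z x) = even (col Y x)" if "x \<in> V" for x
        using Y(2) Z(2) that unfolding p_def by blast
      moreover have "{y. (x, y) \<in> ?sd Z} = {y. (x, y) \<in> Z} - {y. (x, y) \<in> Y} \<union> ({y. (x, y) \<in> Y} - {y. (x, y) \<in> Z})"
        "{y. (y, x) \<in> ?sd Z} = {y. (y, x) \<in> Z} - {y. (y, x) \<in> Y} \<union> ({y. (y, x) \<in> Y} - {y. (y, x) \<in> Z})" for x
        by blast+
      ultimately show "even_flags (?sd Z)"
        unfolding even_flags_def row_def col_def
        using even_card_sym_diff[OF finrow(1)[OF Z(1)] finrow(1)[OF Y(1)]]
          even_card_sym_diff[OF finrow(2)[OF Z(1)] finrow(2)[OF Y(1)]] Z(1) Y(1) by auto
    qed
    ultimately show ?thesis using finE card_inj_on_le by blast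
  qed
  have "2 ^ card flags = card (Pow flags)" using finite_flags by (simp add: card_Pow)
  also have "Pow flags = (\<Union>t\<in>T. {Z \<in> Pow flags. p Z = t})" using pT by auto
  also have "card \<dots> \<le> (\<Sum>t\<in>T. card {Z \<in> Pow flags. p Z = t})" by (rule card_UN_le[OF finT])
  also have "\<dots> \<le> (\<Sum>t\<in>T. card {Z. even_flags Z})" by (intro sum_mono fibre)
  also have "\<dots> = card {Z. even_flags Z} * card T" by simp
  also have "\<dots> \<le> card {Z. even_flags Z} * 2 ^ (2 * card V - 1)"
    using card_balanced_pairs[OF finite_V V] unfolding T_def by (intro mult_left_mono) auto
  finally show ?thesis .
qed

end

context drawn_contacts
begin

definition darts :: "(bool \<times> 'a \<times> 'a) set" where "darts = UNIV \<times> flags"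

text \<open>A dart \<open>(b, x, y)\<close> is the side of the polygon \<open>R x\<close> (if \<open>b\<close>) or \<open>- R x\<close> that starts at its corner
belonging to \<open>y\<close>, with the polygon on the left. The side ends at a contact with a polygon of the other
sign, whose own side starting there bounds the same face.\<close>

definition face_step :: "bool \<times> 'a \<times> 'a \<Rightarrow> bool \<times> 'a \<times> 'a" where
  "face_step = (\<lambda>(b, x, y). (\<not> b, next_corner b x y, x))"

definition dart_point :: "bool \<times> 'a \<times> 'a \<Rightarrow> real^3" where
  "dart_point = (\<lambda>(b, x, y). sign_of b *\<^sub>R (d x y + \<epsilon> *\<^sub>R d x (next_corner b x y)))"

definition odd_darts :: "('a \<times> 'a) set \<Rightarrow> (bool \<times> 'a \<times> 'a) set" where
  "odd_darts Z = {t \<in> darts. odd (wind Z (dart_point t))}"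

lemma next_corner_flag:
  assumes "(x, y) \<in> flags"
  shows "(next_corner b x y, x) \<in> flags" "next_corner b x y \<noteq> y"
proof -
  have x: "x \<in> V" "y \<in> nb x" using assms unfolding flags_def by auto
  have n: "next_corner b x y \<in> nb x \<and> next_corner b x y \<noteq> y"
    using next_corner[OF x] unfolding side_def by (cases b) auto
  then have "(x, next_corner b x y) \<in> flags" using x unfolding flags_def by auto
  then show "(next_corner b x y, x) \<in> flags" by (rule flag_swap)
  show "next_corner b x y \<noteq> y" using n by blast
qed

lemma face_step_dart: "t \<in> darts \<Longrightarrow> face_step t \<in> darts"
  unfolding darts_def face_step_def using next_corner_flag(1) by auto

text \<open>The sign alternates, and no side returns to itself after two steps because a side has distinct ends; so a
face has at least four sides.\<close>

lemma face_length:
  assumes "t \<in> darts"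
  shows "card {t, face_step t, face_step (face_step t), face_step (face_step (face_step t))} = 4"
proof -
  have two: "face_step (face_step t) \<noteq> t" if t: "t \<in> darts" for t
  proof -
    obtain b x y where "t = (b, x, y)" "(x, y) \<in> flags" using t unfolding darts_def by auto
    then show ?thesis unfolding face_step_def using next_corner_flag(2) by auto
  qed
  have flip: "fst (face_step t) = (\<not> fst t)" for t unfolding face_step_def by (simp add: case_prod_unfold)
  have "t \<noteq> face_step t" "face_step t \<noteq> face_step (face_step t)"
    "face_step (face_step t) \<noteq> face_step (face_step (face_step t))"
    "t \<noteq> face_step (face_step (face_step t))"
    by (metis flip)+
  moreover have "face_step (face_step (face_step t)) \<noteq> face_step t"
    using two[OF face_step_dart[OF assms]] .
  ultimately show ?thesis using two[OF assms] by (simp add: card_insert_if)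
qed

text \<open>The winding number is constant along a side, and at its end it is the same as on the next side of the
face.\<close>

lemma odd_darts_closed:
  assumes Z: "even_flags Z" and t: "t \<in> darts"
  shows "face_step t \<in> odd_darts Z \<longleftrightarrow> t \<in> odd_darts Z"
proof -
  obtain b x y where txy: "t = (b, x, y)" and xy: "(x, y) \<in> flags" using t unfolding darts_def by auto
  define z where "z = next_corner b x y"
  have zx: "(z, x) \<in> flags" "(x, z) \<in> flags" using next_corner_flag(1)[OF xy] flag_swap z_def by auto
  have V: "x \<in> V" "y \<in> nb x" "z \<in> V" "x \<in> nb z" "z \<in> nb x" using xy zx unfolding flags_def by auto
  have "even (wind Z (dart_point (face_step t))) \<longleftrightarrow> even (wind Z (dart_point t))"
  proof (cases b)
    case True
    have s: "side x y z" using next_corner(1)[OF V(1,2)] True z_def by simp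
    have zb: "next_corner True x y = z" using True z_def by simp
    define u where "u = next_corner False z x"
    have su: "side z u x" using next_corner(2)[OF V(3,4)] u_def by simp
    have "dart_point (face_step t) = d x z + \<epsilon> *\<^sub>R d u z"
      unfolding dart_point_def face_step_def txy using True d_swap[of x z] d_swap[of u z] zb
      by (simp add: u_def[symmetric])
    moreover have "dart_point t = sign_of True *\<^sub>R (d x y + \<epsilon> *\<^sub>R d x z)"
      unfolding dart_point_def txy using True z_def by simp
    moreover have "even (wind Z (d x z + \<epsilon> *\<^sub>R d x y)) \<longleftrightarrow> even (wind Z (d x z + \<epsilon> *\<^sub>R d u z))"
      using wind_around_corner(1)[OF Z V(1,3) s next_corner(1)[OF V(1,5)] su next_corner(1)[OF V(3,4)]] .
    ultimately show ?thesis using wind_side[OF Z V(1) s, of True] by simp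
  next
    case False
    have s: "side x z y" using next_corner(2)[OF V(1,2)] False z_def by simp
    have zb: "next_corner False x y = z" using False z_def by simp
    define u where "u = next_corner True z x"
    have su: "side z x u" using next_corner(1)[OF V(3,4)] u_def by simp
    have "dart_point (face_step t) = d z x + \<epsilon> *\<^sub>R d z u"
      unfolding dart_point_def face_step_def txy using False zb
      by (simp add: u_def[symmetric])
    moreover have "dart_point t = sign_of False *\<^sub>R (d x y + \<epsilon> *\<^sub>R d x z)"
      unfolding dart_point_def txy using False z_def by simp
    moreover have "sign_of False *\<^sub>R (d x z + \<epsilon> *\<^sub>R d x y) = d z x + \<epsilon> *\<^sub>R d y x"
      using d_swap[of x z] d_swap[of x y] by simp
    moreover have "even (wind Z (d z x + \<epsilon> *\<^sub>R d y x)) \<longleftrightarrow> even (wind Z (d z x + \<epsilon> *\<^sub>R d z u))"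
      using wind_around_corner(2)[OF Z V(3,1) next_corner(2)[OF V(3,4)] su next_corner(2)[OF V(1,5)] s] .
    ultimately show ?thesis using wind_side[OF Z V(1) s, of False] by simp
  qed
  then show ?thesis unfolding odd_darts_def using t face_step_dart[OF t] by simp
qed

text \<open>The two sides of \<open>R x\<close> at the corner \<open>d x y\<close> border the two gaps there.\<close>

lemma odd_darts_determine:
  assumes Z: "even_flags Z" and xy: "(x, y) \<in> flags"
  shows "(x, y) \<in> Z \<longleftrightarrow> ((True, x, next_corner False x y) \<in> odd_darts Z) \<noteq> ((True, x, y) \<in> odd_darts Z)"
proof -
  have V: "x \<in> V" "y \<in> nb x" "y \<in> V" "x \<in> nb y"
    using xy flag_swap[OF xy] unfolding flags_def by auto
  define a where "a = next_corner False x y"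
  have s: "side x a y" using next_corner(2)[OF V(1,2)] a_def by simp
  have a: "a \<in> nb x" using s unfolding side_def by blast
  have na: "next_corner True x a = y" using side_unique[OF next_corner(1)[OF V(1) a] s] .
  have "dart_point (True, x, a) = sign_of True *\<^sub>R (d x a + \<epsilon> *\<^sub>R d x y)"
    unfolding dart_point_def using na by simp
  moreover have "dart_point (True, x, y) = d x y + \<epsilon> *\<^sub>R d x (next_corner True x y)"
    unfolding dart_point_def by simp
  moreover have "(even (wind Z (d x y + \<epsilon> *\<^sub>R d x a)) \<longleftrightarrow>
      even (wind Z (d x y + \<epsilon> *\<^sub>R d x (next_corner True x y)))) \<longleftrightarrow> (x, y) \<notin> Z"
    using wind_around_corner(3)[OF Z V(1,3) s next_corner(1)[OF V(1,2)] next_corner(2)[OF V(3,4)]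
        next_corner(1)[OF V(3,4)]] .
  moreover have "(True, x, a) \<in> darts" "(True, x, y) \<in> darts"
    using V a unfolding darts_def flags_def by auto
  ultimately show ?thesis
    using wind_side[OF Z V(1) s, of True] unfolding odd_darts_def a_def[symmetric] by auto
qed

text \<open>The sets \<open>odd_darts Z\<close> and their complements are distinct sets of darts that are closed under
\<open>face_step\<close>.\<close>

lemma card_flags_le_drawn:
  assumes V: "V \<noteq> {}"
  shows "card flags + 4 \<le> 4 * card V"
proof -
  have finD: "finite darts" unfolding darts_def using finite_flags by simp
  have cardD: "card darts = 2 * card flags" unfolding darts_def by (simp add: card_cartesian_product)
  obtain x where x: "x \<in> V" using V by blast
  obtain y where y: "y \<in> nb x" using third_neighbour[OF x] by blast
  have dne: "(True, x, y) \<in> darts" using x y unfolding darts_def flags_def by auto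
  define \<S> where "\<S> = {S. S \<subseteq> darts \<and> (\<forall>t\<in>darts. face_step t \<in> S \<longleftrightarrow> t \<in> S)}"
  obtain m where m: "4 * m \<le> card darts" "card \<S> \<le> 2 ^ m"
    using card_closed_sets[OF finD face_step_dart face_length] unfolding \<S>_def by blast
  \<comment> \<open>The complements account for adding the constant \<open>1\<close> to a winding number.\<close>
  define \<phi> where "\<phi> = (\<lambda>(Z, c). if c then odd_darts Z else darts - odd_darts Z)"
  have sub: "odd_darts Z \<subseteq> darts" for Z unfolding odd_darts_def by blast
  have "inj_on \<phi> ({Z. even_flags Z} \<times> (UNIV :: bool set))"
  proof (rule inj_onI, clarify)
    fix Z c Z' c' assume h: "even_flags Z" "even_flags Z'" and eq: "\<phi> (Z, c) = \<phi> (Z', c')"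
    have "(x, y) \<in> Z \<longleftrightarrow> (x, y) \<in> Z'" if xy: "(x, y) \<in> flags" for x y
    proof -
      have xV: "x \<in> V" "y \<in> nb x" using xy unfolding flags_def by auto
      have "next_corner False x y \<in> nb x"
        using next_corner(2)[OF xV] unfolding side_def by blast
      then have "(True, x, next_corner False x y) \<in> darts" "(True, x, y) \<in> darts"
        using xV unfolding darts_def flags_def by auto
      moreover have "t \<in> darts \<Longrightarrow> (t \<in> odd_darts Z \<longleftrightarrow> t \<in> odd_darts Z') = (c = c')" for t
        using eq unfolding \<phi>_def by (cases c; cases c'; simp; blast)
      ultimately show ?thesis
        using odd_darts_determine[OF h(1) xy] odd_darts_determine[OF h(2) xy] by blast
    qed
    then have "Z = Z'" using h unfolding even_flags_def by auto
    moreover have "c = c'" using eq dne sub[of Z] unfolding \<phi>_def \<open>Z = Z'\<close> by (auto split: if_splits)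
    ultimately show "Z = Z' \<and> c = c'" by blast
  qed
  moreover have "\<phi> ` ({Z. even_flags Z} \<times> UNIV) \<subseteq> \<S>"
  proof clarify
    fix Z c assume Z: "even_flags Z"
    show "\<phi> (Z, c) \<in> \<S>"
      unfolding \<S>_def \<phi>_def using odd_darts_closed[OF Z] sub[of Z] face_step_dart by auto
  qed
  moreover have "finite \<S>" unfolding \<S>_def using finD by simp
  ultimately have "card ({Z. even_flags Z} \<times> (UNIV :: bool set)) \<le> card \<S>" using card_inj_on_le by blast
  then have K: "2 * card {Z. even_flags Z} \<le> 2 ^ m" using m(2) by (simp add: card_cartesian_product)
  have "(2::nat) ^ (card flags + 1) \<le> 2 * card {Z. even_flags Z} * 2 ^ (2 * card V - 1)"
    using card_even_flags[OF V] by simp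
  also have "\<dots> \<le> 2 ^ m * 2 ^ (2 * card V - 1)" using K by (rule mult_right_mono) simp
  finally have "(2::nat) ^ (card flags + 1) \<le> 2 ^ (m + (2 * card V - 1))" by (simp add: power_add)
  then have "card flags + 1 \<le> m + (2 * card V - 1)" by (rule power_le_imp_le_exp[rotated]) simp
  moreover have "0 < card V" using V finite_V by (simp add: card_gt_0_iff)
  ultimately show ?thesis using m(1) cardD by linarith
qed

end

theorem (in dense_contacts) card_flags_le:
  assumes "V \<noteq> {}"
  shows "card flags + 4 \<le> 4 * card V"
proof -
  obtain N \<epsilon> where "drawn_contacts V nb d N \<epsilon>" using drawing_exists by blast
  then interpret drawn_contacts V nb d N \<epsilon> .
  show ?thesis using card_flags_le_drawn[OF assms] .
qed

section \<open>Quaternionic parallelism on the three-sphere\<close>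

text \<open>The imaginary part of \<open>x\<^sup>* y\<close>, where a vector of \<open>\<real>\<^sup>4\<close> is read as a quaternion with real part first and
\<open>x\<^sup>*\<close> is the conjugate.\<close>

definition quat_im :: "real^4 \<Rightarrow> real^4 \<Rightarrow> real^3" where
  "quat_im x y = vector [
     - x$2 * y$1 + x$1 * y$2 + x$4 * y$3 - x$3 * y$4,
     - x$3 * y$1 - x$4 * y$2 + x$1 * y$3 + x$2 * y$4,
     - x$4 * y$1 + x$3 * y$2 - x$2 * y$3 + x$1 * y$4]"

text \<open>The product \<open>x v\<close> with an imaginary quaternion \<open>v\<close>: for unit vectors \<open>x\<close> the tangent vector at \<open>x\<close>
that corresponds to \<open>v\<close> under left translation.\<close>

definition quat_dir :: "real^4 \<Rightarrow> real^3 \<Rightarrow> real^4" where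
  "quat_dir x v = vector [
     - v$1 * x$2 - v$2 * x$3 - v$3 * x$4,
     v$1 * x$1 - v$2 * x$4 + v$3 * x$3,
     v$1 * x$4 + v$2 * x$1 - v$3 * x$2,
     - v$1 * x$3 + v$2 * x$2 + v$3 * x$1]"

lemma vector_4 [simp]:
  "(vector [a, b, c, e] :: real^4) $ 1 = a" "(vector [a, b, c, e] :: real^4) $ 2 = b"
  "(vector [a, b, c, e] :: real^4) $ 3 = c" "(vector [a, b, c, e] :: real^4) $ 4 = e"
  by (simp_all add: vector_def)

lemma inner_3: "(u::real^3) \<bullet> v = u$1 * v$1 + u$2 * v$2 + u$3 * v$3"
  by (simp add: inner_vec_def sum_3)

lemma inner_4: "(u::real^4) \<bullet> v = u$1 * v$1 + u$2 * v$2 + u$3 * v$3 + u$4 * v$4"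
  by (simp add: inner_vec_def sum_4)

lemma quat_im_swap: "quat_im y x = - quat_im x y"
  by (simp add: vec_eq_iff forall_3 quat_im_def)

lemma quat_dir_inner: "quat_dir x v \<bullet> y = v \<bullet> quat_im x y"
  by (simp add: inner_4 inner_3 quat_im_def quat_dir_def algebra_simps)

lemma quat_dir_inner_self: "x \<bullet> quat_dir x v = 0"
  by (simp add: inner_4 quat_dir_def algebra_simps)

lemma quat_dir_inner_dir: "quat_dir x v \<bullet> quat_dir y v = (v \<bullet> v) * (x \<bullet> y)"
  by (simp add: inner_4 inner_3 quat_dir_def algebra_simps)

text \<open>The expansion of \<open>y\<close> in the orthogonal frame \<open>x\<close>, \<open>x i\<close>, \<open>x j\<close>, \<open>x k\<close>.\<close>

lemma quat_decomp: "(x \<bullet> x) *\<^sub>R y = (x \<bullet> y) *\<^sub>R x + quat_dir x (quat_im x y)"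
  by (simp add: vec_eq_iff forall_4 inner_4 quat_dir_def quat_im_def algebra_simps)

lemma quat_inner: "(x \<bullet> x) * (y \<bullet> z) = (x \<bullet> y) * (x \<bullet> z) + quat_im x y \<bullet> quat_im x z"
  using arg_cong[OF quat_decomp[of x y], of "\<lambda>u. u \<bullet> z"]
  by (simp add: inner_left_distrib quat_dir_inner)

lemma quat_dir_minus: "quat_dir x (- v) = - quat_dir x v"
  by (simp add: vec_eq_iff forall_4 quat_dir_def)

lemma norm_eq_1_inner: "norm (x::'b::real_inner) = 1 \<Longrightarrow> x \<bullet> x = 1"
  by (simp add: norm_eq_1)

lemma inner_less_1:
  fixes x y :: "'b::real_inner"
  assumes "norm x = 1" "norm y = 1" "x \<noteq> y"
  shows "x \<bullet> y < 1"
proof -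
  have "0 < (x - y) \<bullet> (x - y)" using assms(3) by simp
  also have "(x - y) \<bullet> (x - y) = 2 - 2 * (x \<bullet> y)"
    using assms(1,2) by (simp add: norm_eq_1 inner_diff_left inner_diff_right inner_commute)
  finally show ?thesis by simp
qed

text \<open>A vector that is a nonnegative combination of vectors of its own length has total weight at least \<open>1\<close>, by the
Cauchy-Schwarz inequality.\<close>

lemma cone_weight:
  fixes f :: "'i \<Rightarrow> 'b::real_inner"
  assumes S: "finite S" and v: "v = (\<Sum>i\<in>S. c i *\<^sub>R f i)" and c: "\<And>i. i \<in> S \<Longrightarrow> 0 \<le> c i"
    and len: "\<And>i. i \<in> S \<Longrightarrow> f i \<bullet> f i = v \<bullet> v" and v0: "v \<noteq> 0"
  shows "1 \<le> sum c S" "v \<notin> f ` S \<Longrightarrow> 1 < sum c S"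
proof -
  have vf: "v \<bullet> f i = v \<bullet> v - (v - f i) \<bullet> (v - f i) / 2" if "i \<in> S" for i
    using len[OF that] by (simp add: inner_diff_left inner_diff_right inner_commute field_simps)
  have pos: "0 < v \<bullet> v" using v0 by simp
  have eq: "v \<bullet> v = (\<Sum>i\<in>S. c i * (v \<bullet> f i))"
    using arg_cong[OF v, of "inner v"] by (simp only: inner_sum_right inner_scaleR_right)
  also have "\<dots> \<le> (\<Sum>i\<in>S. c i * (v \<bullet> v))"
    by (intro sum_mono mult_left_mono) (auto simp: vf c)
  also have "\<dots> = sum c S * (v \<bullet> v)" by (simp add: sum_distrib_right)
  finally show "1 \<le> sum c S" using pos by simp
  assume nin: "v \<notin> f ` S"
  have "\<exists>j\<in>S. c j \<noteq> 0" using sum.neutral[of S "\<lambda>i. c i *\<^sub>R f i"] v v0 by auto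
  then obtain j where j: "j \<in> S" "c j \<noteq> 0" by blast
  have "(\<Sum>i\<in>S. c i * (v \<bullet> f i)) < (\<Sum>i\<in>S. c i * (v \<bullet> v))"
  proof (rule sum_strict_mono_ex1[OF S])
    show "\<forall>i\<in>S. c i * (v \<bullet> f i) \<le> c i * (v \<bullet> v)"
      by (intro ballI mult_left_mono) (auto simp: vf c)
    have "v - f j \<noteq> 0" using nin j(1) by auto
    then have "0 < (v - f j) \<bullet> (v - f j)" by simp
    then have "v \<bullet> f j < v \<bullet> v" using vf[OF j(1)] by linarith
    then have "c j * (v \<bullet> f j) < c j * (v \<bullet> v)" using j c[OF j(1)] by simp
    then show "\<exists>i\<in>S. c i * (v \<bullet> f i) < c i * (v \<bullet> v)" using j(1) by blast
  qed
  then have "v \<bullet> v < sum c S * (v \<bullet> v)" using eq by (simp add: sum_distrib_right)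
  then show "1 < sum c S" using pos by simp
qed

text \<open>Ball convexity on the sphere: a spherical cap of the critical radius that contains all neighbours \<open>e p\<close>
of \<open>x\<close> also contains \<open>g x + x v\<close>, the point at the critical distance from \<open>x\<close> in a direction \<open>v\<close> from the
cone of \<open>x\<close>. The centre of the cap is \<open>z\<close>. This uses that \<open>g\<close> is positive and that the weights of \<open>v\<close> sum up
to at least \<open>1\<close>.\<close>

lemma cone_point_inner:
  assumes g: "0 < g" "g < 1" and x: "norm x = 1" and z: "norm z = 1"
    and S: "finite S" and p: "\<And>p. p \<in> S \<Longrightarrow> norm (e p) = 1 \<and> x \<bullet> e p = g \<and> g \<le> z \<bullet> e p"
    and v: "v \<in> gen_cone (\<lambda>p. quat_im x (e p)) S" and vv: "v \<bullet> v = 1 - g\<^sup>2"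
  shows "g \<le> z \<bullet> (g *\<^sub>R x + quat_dir x v)"
    and "\<lbrakk>z \<noteq> x; v \<notin> (\<lambda>p. quat_im x (e p)) ` S\<rbrakk> \<Longrightarrow> g < z \<bullet> (g *\<^sub>R x + quat_dir x v)"
proof -
  obtain c where c: "\<And>i. i \<in> S \<Longrightarrow> 0 \<le> c i" and vc: "v = (\<Sum>i\<in>S. c i *\<^sub>R quat_im x (e i))"
    using v by (rule gen_coneE) blast
  have xx: "x \<bullet> x = 1" using x by (rule norm_eq_1_inner)
  have len: "quat_im x (e i) \<bullet> quat_im x (e i) = v \<bullet> v" if "i \<in> S" for i
    using quat_inner[of x "e i" "e i"] p[OF that] xx
    by (simp add: vv norm_eq_1 power2_eq_square)
  have "g\<^sup>2 < 1" using g by (simp add: power_less_one_iff abs_square_less_1)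
  then have v0: "v \<noteq> 0" using vv by auto
  note W = cone_weight[OF S vc c len v0]
  have each: "g * (1 - x \<bullet> z) \<le> quat_im x (e i) \<bullet> quat_im x z" if "i \<in> S" for i
    using quat_inner[of x "e i" z] p[OF that] xx by (simp add: algebra_simps inner_commute)
  have "sum c S * (g * (1 - x \<bullet> z)) = (\<Sum>i\<in>S. c i * (g * (1 - x \<bullet> z)))"
    by (simp add: sum_distrib_right)
  also have "\<dots> \<le> (\<Sum>i\<in>S. c i * (quat_im x (e i) \<bullet> quat_im x z))"
    by (intro sum_mono mult_left_mono each c)
  also have "\<dots> = v \<bullet> quat_im x z" unfolding vc by (simp add: inner_sum_left)
  finally have A: "sum c S * (g * (1 - x \<bullet> z)) \<le> v \<bullet> quat_im x z" .
  have B: "z \<bullet> (g *\<^sub>R x + quat_dir x v) = g * (x \<bullet> z) + v \<bullet> quat_im x z"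
    by (simp add: inner_right_distrib quat_dir_inner[symmetric] inner_commute)
  have le1: "x \<bullet> z \<le> 1" using Cauchy_Schwarz_ineq2[of x z] x z by simp
  have "1 * (g * (1 - x \<bullet> z)) \<le> sum c S * (g * (1 - x \<bullet> z))"
    using W(1) g le1 by (intro mult_right_mono) auto
  then show "g \<le> z \<bullet> (g *\<^sub>R x + quat_dir x v)" using A B by (simp add: algebra_simps)
  assume h: "z \<noteq> x" "v \<notin> (\<lambda>p. quat_im x (e p)) ` S"
  have "x \<bullet> z < 1" using inner_less_1 x z h(1) by metis
  then have "1 * (g * (1 - x \<bullet> z)) < sum c S * (g * (1 - x \<bullet> z))"
    using W(2)[OF _ _ h(2)] g by (intro mult_strict_right_mono) auto
  then show "g < z \<bullet> (g *\<^sub>R x + quat_dir x v)" using A B by (simp add: algebra_simps)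
qed

lemma gen_cone_normalise:
  assumes "v \<in> gen_cone f S" "(v::'b::real_inner) \<noteq> 0" "0 < s"
  obtains t where "0 < t" "t *\<^sub>R v \<in> gen_cone f S" "(t *\<^sub>R v) \<bullet> (t *\<^sub>R v) = s"
proof -
  define t where "t = sqrt (s / (v \<bullet> v))"
  have vv: "0 < v \<bullet> v" using assms(2) by simp
  have t: "0 < t" unfolding t_def using vv assms(3) by simp
  have "t * t = s / (v \<bullet> v)" unfolding t_def using vv assms(3) by simp
  then have "(t *\<^sub>R v) \<bullet> (t *\<^sub>R v) = s" using vv by (simp flip: mult.assoc)
  then show thesis using that t gen_cone_scale[OF assms(1), of t] by simp
qed

text \<open>Let \<open>P = g e x + e x v\<close> with \<open>v\<close> in the cone of \<open>x\<close>, of the length of the generators. By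
\<open>cone_point_inner\<close>, \<open>P\<close> has inner product at least \<open>g\<close> with all points.
If \<open>v\<close> also lies in the cone of \<open>y\<close>, adding the inequalities for \<open>y\<close> and \<open>P\<close> and for \<open>x\<close> and
\<open>g e y + e y v\<close> gives \<open>e x \<bullet> e y \<ge> 1\<close>, because \<open>x \<bullet> (y v) = - y \<bullet> (x v)\<close>.
If \<open>- v\<close> lies in the cone of \<open>y\<close>, then \<open>P\<close> and \<open>Q = g e y - e y v\<close> have inner product at least \<open>g\<close> as well.
As \<open>e x \<bullet> e y \<ge> g\<close> too, this says that the unit vectors \<open>(g, v)\<close> and \<open>(e x \<bullet> e y, d x y)\<close> have inner
product at least \<open>1\<close>, so they coincide, and \<open>e y = P\<close>.
Extremality follows from the strict form of \<open>cone_point_inner\<close>: otherwise the other neighbours \<open>z\<close> of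
\<open>y\<close> would have inner product greater than \<open>g\<close> with \<open>e y\<close>.\<close>

theorem spherical_cone_contacts:
  fixes e :: "'a \<Rightarrow> real^4"
  assumes fin: "finite X" and inj: "inj_on e X" and unit: "\<And>x. x \<in> X \<Longrightarrow> norm (e x) = 1"
    and g: "0 < g" "g < 1" and inner: "\<And>x y. \<lbrakk>x \<in> X; y \<in> X\<rbrakk> \<Longrightarrow> g \<le> e x \<bullet> e y"
  shows "cone_contacts X (\<lambda>x. {y \<in> X. e x \<bullet> e y = g}) (\<lambda>x y. quat_im (e x) (e y))"
proof -
  define nb where "nb x = {y \<in> X. e x \<bullet> e y = g}" for x
  define d where "d x y = quat_im (e x) (e y)" for x y
  have g2: "g\<^sup>2 < 1" using g by (simp add: power_less_one_iff abs_square_less_1)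
  have finnb: "finite (nb x)" for x unfolding nb_def using fin by simp
  have lenxy: "d x y \<bullet> d x y = 1 - (e x \<bullet> e y)\<^sup>2" if "x \<in> X" "y \<in> X" for x y
    using quat_inner[of "e x" "e y" "e y"] norm_eq_1_inner[OF unit] that
    by (simp add: d_def power2_eq_square)
  have K: "g \<le> z \<bullet> (g *\<^sub>R e x + quat_dir (e x) v)"
    if "x \<in> X" "norm z = 1" "\<And>p. p \<in> nb x \<Longrightarrow> g \<le> z \<bullet> e p" "v \<in> gen_cone (d x) (nb x)"
      "v \<bullet> v = 1 - g\<^sup>2" for x z v
    using that finnb g unit
    by (intro cone_point_inner(1)[where S="nb x" and e=e]) (auto simp: nb_def d_def[abs_def])
  have disj: "x = y" if "x \<in> X" "y \<in> X" "v \<in> gen_cone (d x) (nb x)" "v \<in> gen_cone (d y) (nb y)"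
      "v \<bullet> v = 1 - g\<^sup>2" for x y v
  proof (rule ccontr)
    assume "x \<noteq> y"
    then have less: "e x \<bullet> e y < 1" using inner_less_1 unit that(1,2) inj by (metis inj_onD)
    have "g \<le> e y \<bullet> (g *\<^sub>R e x + quat_dir (e x) v)"
      using K[OF that(1) _ _ that(3,5), of "e y"] that inner unit by (auto simp: nb_def)
    moreover have "g \<le> e x \<bullet> (g *\<^sub>R e y + quat_dir (e y) v)"
      using K[OF that(2) _ _ that(4,5), of "e x"] that inner unit by (auto simp: nb_def)
    moreover have "e y \<bullet> quat_dir (e x) v = - (e x \<bullet> quat_dir (e y) v)"
      using quat_dir_inner[of "e x" v "e y"] quat_dir_inner[of "e y" v "e x"]
        quat_im_swap[of "e x" "e y"] by (simp add: inner_commute)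
    ultimately have "2 * g \<le> 2 * (g * (e x \<bullet> e y))"
      by (simp add: inner_right_distrib inner_commute)
    then show False using g less by simp
  qed
  have cont: "y \<in> nb x \<and> v = d x y" if "x \<in> X" "y \<in> X" "v \<in> gen_cone (d x) (nb x)"
      "- v \<in> gen_cone (d y) (nb y)" "v \<bullet> v = 1 - g\<^sup>2" for x y v
  proof -
    note hyps = that
    define P where "P = g *\<^sub>R e x + quat_dir (e x) v"
    have xx: "e x \<bullet> e x = 1" using norm_eq_1_inner unit that(1) by blast
    have "P \<bullet> P = 1" unfolding P_def
      using quat_dir_inner_self[of "e x" v] quat_dir_inner_dir[of "e x" v "e x"] that(5) xx
      by (simp add: inner_left_distrib inner_right_distrib inner_commute power2_eq_square)
    then have P1: "norm P = 1" by (simp add: norm_eq_1)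
    have "g \<le> P \<bullet> e q" if q: "q \<in> nb y" for q
      using K[OF hyps(1) _ _ hyps(3,5), of "e q"] hyps(1) q inner unit
      unfolding P_def by (auto simp: nb_def inner_commute)
    then have "g \<le> P \<bullet> (g *\<^sub>R e y + quat_dir (e y) (- v))"
      using K[OF that(2) P1 _ that(4)] that(5) by simp
    also have "\<dots> = g\<^sup>2 * (e x \<bullet> e y) + 2 * g * (v \<bullet> d x y) - (1 - g\<^sup>2) * (e x \<bullet> e y)"
      unfolding P_def d_def quat_dir_minus
      using quat_dir_inner_dir[of "e x" v "e y"] quat_dir_inner[of "e x" v "e y"]
        quat_dir_inner[of "e y" v "e x"] that(5) quat_im_swap[of "e x" "e y"]
      by (simp add: inner_left_distrib inner_right_distrib inner_commute power2_eq_square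
          algebra_simps)
    finally have ineq: "g + e x \<bullet> e y \<le> 2 * g * (g * (e x \<bullet> e y) + v \<bullet> d x y)"
      by (simp add: algebra_simps power2_eq_square)
    then have "g * 1 \<le> g * (g * (e x \<bullet> e y) + v \<bullet> d x y)" using inner[OF that(1,2)] by linarith
    then have ge1: "1 \<le> g * (e x \<bullet> e y) + v \<bullet> d x y" using g(1) by (simp only: mult_le_cancel_left_pos)
    have eq: "(e x \<bullet> e y - g)\<^sup>2 + (d x y - v) \<bullet> (d x y - v) = 2 - 2 * (g * (e x \<bullet> e y) + v \<bullet> d x y)"
      using lenxy[OF that(1,2)] that(5)
      by (simp add: inner_diff_left inner_diff_right inner_commute power2_diff)
    have "(e x \<bullet> e y - g)\<^sup>2 + (d x y - v) \<bullet> (d x y - v) \<le> 0"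
      unfolding eq using mult_left_mono[OF ge1, of 2] by (simp only: diff_le_0_iff_le) simp
    then have "(e x \<bullet> e y - g)\<^sup>2 = 0" "(d x y - v) \<bullet> (d x y - v) = 0"
      using zero_le_power2[of "e x \<bullet> e y - g"] inner_ge_zero[of "d x y - v"] by linarith+
    then show ?thesis using that(2) by (simp add: nb_def)
  qed
  have "cone_contacts X nb d"
  proof
    show "finite X" by (rule fin)
    show "nb x \<subseteq> X" for x by (auto simp: nb_def)
    show "x \<in> nb y" if "x \<in> X" "y \<in> nb x" for x y using that by (auto simp: nb_def inner_commute)
    show "d y x = - d x y" for x y unfolding d_def by (rule quat_im_swap)
    show "d x y \<noteq> 0" if "x \<in> X" "y \<in> nb x" for x y
    proof -
      have "d x y \<bullet> d x y = 1 - g\<^sup>2" using lenxy[OF that(1)] that(2) by (auto simp: nb_def)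
      then show ?thesis using g2 by auto
    qed
    show "x = y" if h: "x \<in> X" "y \<in> X" "v \<in> gen_cone (d x) (nb x)" "v \<in> gen_cone (d y) (nb y)"
        "v \<noteq> 0" for x y v
    proof -
      obtain t where t: "0 < t" "t *\<^sub>R v \<in> gen_cone (d x) (nb x)" "(t *\<^sub>R v) \<bullet> (t *\<^sub>R v) = 1 - g\<^sup>2"
        using gen_cone_normalise[OF h(3,5), of "1 - g\<^sup>2"] g2 by auto
      show ?thesis using disj[OF h(1,2) t(2) gen_cone_scale[OF h(4)] t(3)] t(1) by simp
    qed
    show "y \<in> nb x \<and> (\<exists>t>0. v = t *\<^sub>R d x y)"
      if h: "x \<in> X" "y \<in> X" "v \<in> gen_cone (d x) (nb x)" "- v \<in> gen_cone (d y) (nb y)"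
        "v \<noteq> 0" for x y v
    proof -
      obtain t where t: "0 < t" "t *\<^sub>R v \<in> gen_cone (d x) (nb x)" "(t *\<^sub>R v) \<bullet> (t *\<^sub>R v) = 1 - g\<^sup>2"
        using gen_cone_normalise[OF h(3,5), of "1 - g\<^sup>2"] g2 by auto
      have "y \<in> nb x \<and> t *\<^sub>R v = d x y"
        using cont[OF h(1,2) t(2) _ t(3)] gen_cone_scale[OF h(4), of t] t(1) by simp
      moreover from this have "v = (1 / t) *\<^sub>R d x y" using t(1)
        by (metis divide_self_if less_irrefl scaleR_one scaleR_scaleR times_divide_eq_left mult_1)
      ultimately show ?thesis using t(1) by (intro conjI exI[of _ "1 / t"]) auto
    qed
    show "d x y \<notin> gen_cone (d x) (nb x - {y})"
      if h: "x \<in> X" "y \<in> nb x" "z \<in> nb y" "z \<noteq> x" for x y z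
    proof
      assume v: "d x y \<in> gen_cone (d x) (nb x - {y})"
      have X: "y \<in> X" "z \<in> X" "e x \<bullet> e y = g" "e y \<bullet> e z = g" using h by (auto simp: nb_def)
      have dec: "e p = g *\<^sub>R e x + quat_dir (e x) (d x p)" if "p \<in> nb x" for p
        using quat_decomp[of "e x" "e p"] that norm_eq_1_inner[OF unit[OF h(1)]]
        by (simp add: nb_def d_def)
      have "d x y \<notin> d x ` (nb x - {y})"
      proof
        assume "d x y \<in> d x ` (nb x - {y})"
        then obtain p where p: "p \<in> nb x" "p \<noteq> y" "d x y = d x p" by blast
        then have "e p = e y" using dec[OF p(1)] dec[OF h(2)] by simp
        then show False using p inj X by (auto simp: nb_def dest: inj_onD)
      qed
      moreover have "e z \<noteq> e x" using h(4) inj X h(1) by (auto dest: inj_onD)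
      ultimately have "g < e z \<bullet> (g *\<^sub>R e x + quat_dir (e x) (d x y))"
        using v lenxy[OF h(1) X(1)] X inner unit g h(1) finnb
        by (intro cone_point_inner(2)[where S="nb x - {y}" and e=e])
           (auto simp: nb_def d_def[abs_def])
      then have "g < e z \<bullet> e y" using dec[OF h(2)] by simp
      then show False using X by (simp add: inner_commute)
    qed
  qed
  then show ?thesis unfolding nb_def[abs_def] d_def[abs_def] .
qed

section \<open>Diameter graphs\<close>

locale spherical_diameter =
  fixes r :: real and c :: "real^4" and X :: "(real^4) set"
  assumes radius: "r > 1 / sqrt 2" and finite_X: "finite X" and on_sphere: "X \<subseteq> sphere c r"
    and dist_le: "\<And>x y. \<lbrakk>x \<in> X; y \<in> X\<rbrakk> \<Longrightarrow> dist x y \<le> 1"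
begin

definition adj :: "(real^4) set \<Rightarrow> real^4 \<Rightarrow> (real^4) set" where
  "adj Y x = {y \<in> Y. dist x y = 1}"

definition unit_vec :: "real^4 \<Rightarrow> real^4" where "unit_vec x = (1 / r) *\<^sub>R (x - c)"

lemma r_pos: "0 < r"
  using radius by (smt (verit) divide_pos_pos real_sqrt_gt_0_iff)

lemma r_sq: "1 < 2 * r\<^sup>2"
proof -
  have "(1 / sqrt 2)\<^sup>2 < r\<^sup>2" using radius by (intro power_strict_mono) auto
  then show ?thesis by (simp add: power_divide)
qed

lemma unit_vec_inner:
  assumes "x \<in> X" "y \<in> X"
  shows "unit_vec x \<bullet> unit_vec y = 1 - (dist x y)\<^sup>2 / (2 * r\<^sup>2)"
proof -
  have xy: "(x - c) \<bullet> (x - c) = r\<^sup>2" "(y - c) \<bullet> (y - c) = r\<^sup>2"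
    using assms on_sphere by (auto simp: subset_iff dist_norm norm_minus_commute dot_square_norm)
  have "(dist x y)\<^sup>2 = ((x - c) - (y - c)) \<bullet> ((x - c) - (y - c))"
    by (simp add: dist_norm dot_square_norm)
  also have "\<dots> = (x - c) \<bullet> (x - c) + (y - c) \<bullet> (y - c) - 2 * ((x - c) \<bullet> (y - c))"
    unfolding inner_diff_left[of "x - c"] inner_diff_right[of _ "x - c"]
      inner_commute[of "y - c" "x - c"] by simp
  also have "\<dots> = 2 * r\<^sup>2 - 2 * ((x - c) \<bullet> (y - c))" unfolding xy by simp
  finally have "(x - c) \<bullet> (y - c) = r\<^sup>2 - (dist x y)\<^sup>2 / 2" by linarith
  then have "unit_vec x \<bullet> unit_vec y = (r\<^sup>2 - (dist x y)\<^sup>2 / 2) / r\<^sup>2"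
    by (simp add: unit_vec_def power2_eq_square)
  then show ?thesis using r_pos by (simp add: diff_divide_distrib)
qed

lemma adj_unit_vec:
  assumes "Y \<subseteq> X" "x \<in> Y"
  shows "adj Y x = {y \<in> Y. unit_vec x \<bullet> unit_vec y = 1 - 1 / (2 * r\<^sup>2)}"
proof -
  have "unit_vec x \<bullet> unit_vec y = 1 - 1 / (2 * r\<^sup>2) \<longleftrightarrow> dist x y = 1" if "y \<in> Y" for y
  proof -
    have "unit_vec x \<bullet> unit_vec y = 1 - 1 / (2 * r\<^sup>2) \<longleftrightarrow> (dist x y)\<^sup>2 = 1"
      using unit_vec_inner[of x y] subsetD[OF assms(1)] assms(2) that r_pos by simp
    also have "\<dots> \<longleftrightarrow> dist x y = 1" unfolding power2_eq_1_iff using zero_le_dist[of x y] by linarith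
    finally show ?thesis .
  qed
  then show ?thesis unfolding adj_def by auto
qed

lemma cone_contacts_adj:
  assumes Y: "Y \<subseteq> X"
  shows "\<exists>d. cone_contacts Y (adj Y) d"
proof -
  define g where "g = 1 - 1 / (2 * r\<^sup>2)"
  have g: "0 < g" "g < 1" unfolding g_def using r_sq r_pos by (simp_all add: divide_simps)
  define nb where "nb x = {y \<in> Y. unit_vec x \<bullet> unit_vec y = g}" for x
  have "cone_contacts Y nb (\<lambda>x y. quat_im (unit_vec x) (unit_vec y))"
    unfolding nb_def
  proof (rule spherical_cone_contacts)
    show "finite Y" using Y finite_X finite_subset by blast
    show "inj_on unit_vec Y" by (rule inj_onI) (use r_pos in \<open>simp add: unit_vec_def\<close>)
    show "norm (unit_vec x) = 1" if "x \<in> Y" for x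
      using unit_vec_inner[of x x] that Y by (simp add: norm_eq_1 subset_iff)
    show "g \<le> unit_vec x \<bullet> unit_vec y" if "x \<in> Y" "y \<in> Y" for x y
    proof -
      have "(dist x y)\<^sup>2 \<le> 1" using dist_le[of x y] that Y by (simp add: power_le_one subset_iff)
      then have "(dist x y)\<^sup>2 / (2 * r\<^sup>2) \<le> 1 / (2 * r\<^sup>2)" by (intro divide_right_mono) auto
      then show ?thesis using unit_vec_inner[of x y] subsetD[OF Y] that unfolding g_def by simp
    qed
  qed (use g in auto)
  then interpret cone_contacts Y nb "\<lambda>x y. quat_im (unit_vec x) (unit_vec y)" .
  have eq: "nb x = adj Y x" if "x \<in> Y" for x
    unfolding nb_def g_def using adj_unit_vec[OF Y that] by simp
  have YY: "y \<in> Y" if "x \<in> Y" "y \<in> adj Y x" for x y using that unfolding adj_def by blast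
  have "cone_contacts Y (adj Y) (\<lambda>x y. quat_im (unit_vec x) (unit_vec y))"
  proof
    show "finite Y" by (rule finite_V)
    show "adj Y x \<subseteq> Y" for x unfolding adj_def by blast
    show "x \<in> adj Y y" if "x \<in> Y" "y \<in> adj Y x" for x y
      using that unfolding adj_def by (simp add: dist_commute)
    show "quat_im (unit_vec y) (unit_vec x) = - quat_im (unit_vec x) (unit_vec y)" for x y
      by (rule d_swap)
    show "quat_im (unit_vec x) (unit_vec y) \<noteq> 0" if "x \<in> Y" "y \<in> adj Y x" for x y
      using d_nonzero that eq by blast
    show "x = y" if "x \<in> Y" "y \<in> Y" "v \<in> gen_cone (\<lambda>y. quat_im (unit_vec x) (unit_vec y)) (adj Y x)"
      "v \<in> gen_cone (\<lambda>z. quat_im (unit_vec y) (unit_vec z)) (adj Y y)" "v \<noteq> 0" for x y v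
      using disjoint[of x y v] that eq by simp
    show "y \<in> adj Y x \<and> (\<exists>t>0. v = t *\<^sub>R quat_im (unit_vec x) (unit_vec y))"
      if "x \<in> Y" "y \<in> Y" "v \<in> gen_cone (\<lambda>y. quat_im (unit_vec x) (unit_vec y)) (adj Y x)"
      "- v \<in> gen_cone (\<lambda>z. quat_im (unit_vec y) (unit_vec z)) (adj Y y)" "v \<noteq> 0" for x y v
      using contact[of x y v] that eq by simp
    show "quat_im (unit_vec x) (unit_vec y) \<notin>
        gen_cone (\<lambda>y. quat_im (unit_vec x) (unit_vec y)) (adj Y x - {y})"
      if "x \<in> Y" "y \<in> adj Y x" "z \<in> adj Y y" "z \<noteq> x" for x y z
      using extreme[of x y z] that eq YY[OF that(1,2)] by simp
  qed
  then show ?thesis by blast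
qed

definition ordered_edges :: "(real^4) set \<Rightarrow> ((real^4) \<times> (real^4)) set" where
  "ordered_edges Y = {(x, y). x \<in> Y \<and> y \<in> Y \<and> dist x y = 1}"

lemma ordered_edges_Sigma: "ordered_edges Y = (SIGMA x:Y. adj Y x)"
  unfolding ordered_edges_def adj_def by auto

lemma card_ordered_edges_sum:
  assumes "Y \<subseteq> X"
  shows "card (ordered_edges Y) = (\<Sum>x\<in>Y. card (adj Y x))"
proof -
  have "finite Y" using assms finite_X finite_subset by blast
  then show ?thesis unfolding ordered_edges_Sigma by (intro card_SigmaI) (auto simp: adj_def)
qed

text \<open>A point of degree at most \<open>2\<close> accounts for at most four ordered pairs and can be removed.\<close>

lemma card_ordered_edges_le:
  assumes "Y \<subseteq> X" "Y \<noteq> {}"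
  shows "card (ordered_edges Y) + 4 \<le> 4 * card Y"
  using assms
proof (induction "card Y" arbitrary: Y rule: less_induct)
  case less
  have fin: "finite Y" using less.prems finite_X finite_subset by blast
  show ?case
  proof (cases "\<forall>x\<in>Y. 3 \<le> card (adj Y x)")
    case True
    obtain d where "cone_contacts Y (adj Y) d" using cone_contacts_adj less.prems by blast
    then interpret cone_contacts Y "adj Y" d .
    interpret dense_contacts Y "adj Y" d by unfold_locales (use True in blast)
    have "flags = ordered_edges Y" unfolding flags_def ordered_edges_def adj_def by auto
    then show ?thesis using card_flags_le less.prems by simp
  next
    case False
    \<comment> \<open>Here \<open>x\<close> is removed; for \<open>Y = {x}\<close> the bound is an equality.\<close>
    then obtain x where x: "x \<in> Y" "card (adj Y x) \<le> 2" by force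
    show ?thesis
    proof (cases "Y = {x}")
      case True
      then have "ordered_edges Y = {}" unfolding ordered_edges_def by auto
      then show ?thesis using True by simp
    next
      case False
      define Z where "Z = Y - {x}"
      have Z: "Z \<subseteq> X" "Z \<noteq> {}" "card Z < card Y" "card Y = Suc (card Z)"
        using less.prems fin x False unfolding Z_def by (auto simp: card_gt_0_iff)
      have "ordered_edges Y \<subseteq> ordered_edges Z \<union> (Pair x ` adj Y x \<union> (\<lambda>y. (y, x)) ` adj Y x)"
        unfolding ordered_edges_def adj_def Z_def by (auto simp: dist_commute)
      moreover have finadj: "finite (adj Y x)" using fin by (simp add: adj_def)
      moreover have "finite (ordered_edges Z)"
        using fin unfolding ordered_edges_Sigma Z_def by (intro finite_SigmaI) (auto simp: adj_def)
      ultimately have "card (ordered_edges Y) \<le> card (ordered_edges Z \<union> (Pair x ` adj Y x \<union> (\<lambda>y. (y, x)) ` adj Y x))"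
        by (intro card_mono) auto
      also have "\<dots> \<le> card (ordered_edges Z) + (card (adj Y x) + card (adj Y x))"
        using card_image_le[OF finadj] by (meson add_mono card_Un_le le_trans order_refl)
      finally show ?thesis using less.hyps[OF Z(3,1,2)] Z(4) x(2) by linarith
    qed
  qed
qed

lemma card_ordered_edges: "card (ordered_edges X) = 2 * card (diameter_graph_edges X)"
proof -
  let ?e = "\<lambda>(x, y). {x, y}"
  have fin: "finite (ordered_edges X)"
    using finite_X unfolding ordered_edges_Sigma by (intro finite_SigmaI) (auto simp: adj_def)
  have img: "?e ` ordered_edges X = diameter_graph_edges X"
    unfolding ordered_edges_def diameter_graph_edges_def by auto
  have two: "card {a \<in> ordered_edges X. ?e a = E} = 2" if "E \<in> diameter_graph_edges X" for E
  proof -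
    from that obtain x y where xy: "E = {x, y}" "x \<in> X" "y \<in> X" "dist x y = 1"
      unfolding diameter_graph_edges_def by blast
    then have xy': "x \<noteq> y" "dist y x = 1" using dist_commute[of x y] dist_self[of x] by (auto simp del: dist_self)
    have "a \<in> ordered_edges X \<and> ?e a = E \<longleftrightarrow> a = (x, y) \<or> a = (y, x)" for a
    proof (cases a)
      case (Pair u v)
      have ordered_edges: "(x, y) \<in> ordered_edges X" "(y, x) \<in> ordered_edges X" using xy(2-4) xy'(2) by (simp_all add: ordered_edges_def)
      show ?thesis
      proof
        assume "a \<in> ordered_edges X \<and> ?e a = E"
        then have "{u, v} = {x, y}" unfolding Pair xy(1) by simp
        then show "a = (x, y) \<or> a = (y, x)" unfolding Pair doubleton_eq_iff by blast
      next
        assume "a = (x, y) \<or> a = (y, x)"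
        then show "a \<in> ordered_edges X \<and> ?e a = E" using ordered_edges xy(1) by (elim disjE) (simp_all add: insert_commute)
      qed
    qed
    then have "{a \<in> ordered_edges X. ?e a = E} = {a. a = (x, y) \<or> a = (y, x)}" by (simp only:)
    also have "\<dots> = {(x, y), (y, x)}" by (rule set_eqI) simp
    finally have "{a \<in> ordered_edges X. ?e a = E} = {(x, y), (y, x)}" .
    then show ?thesis using xy'(1) by simp
  qed
  have "card (ordered_edges X) = (\<Sum>E\<in>?e ` ordered_edges X. card {a \<in> ordered_edges X. ?e a = E})"
    using sum.image_gen[OF fin, of "\<lambda>_. 1::nat" ?e] by (simp only: card_eq_sum)
  also have "\<dots> = (\<Sum>E\<in>diameter_graph_edges X. 2)" unfolding img using two by (intro sum.cong) auto
  finally show ?thesis by simp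
qed

lemma edge_bound: "X \<noteq> {} \<Longrightarrow> card (diameter_graph_edges X) \<le> 2 * card X - 2"
  using card_ordered_edges_le[of X] card_ordered_edges by simp

text \<open>Every nonempty subset contains a point with at most three neighbours in it, as the average degree is
less than four.\<close>

lemma ex_four_colouring:
  assumes "Y \<subseteq> X"
  shows "\<exists>f. f ` Y \<subseteq> {..<4::nat} \<and> (\<forall>x\<in>Y. \<forall>y\<in>Y. dist x y = 1 \<longrightarrow> f x \<noteq> f y)"
  using assms
proof (induction "card Y" arbitrary: Y rule: less_induct)
  case less
  have fin: "finite Y" using less.prems finite_X finite_subset by blast
  show ?case
  proof (cases "Y = {}")
    case False
    have "\<exists>x\<in>Y. card (adj Y x) \<le> 3"
    proof (rule ccontr)
      assume "\<not> (\<exists>x\<in>Y. card (adj Y x) \<le> 3)"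
      then have "(\<Sum>x\<in>Y. 4) \<le> (\<Sum>x\<in>Y. card (adj Y x))" by (intro sum_mono) force
      then show False using card_ordered_edges_le[OF less.prems False] card_ordered_edges_sum[OF less.prems] by simp
    qed
    then obtain x where x: "x \<in> Y" "card (adj Y x) \<le> 3" by blast
    have "card (Y - {x}) < card Y" using fin x by (meson card_Diff1_less)
    then obtain f where f: "f ` (Y - {x}) \<subseteq> {..<4::nat}"
      "\<forall>y\<in>Y - {x}. \<forall>z\<in>Y - {x}. dist y z = 1 \<longrightarrow> f y \<noteq> f z"
      using less.hyps[of "Y - {x}"] less.prems by blast
    have finadj: "finite (adj Y x)" using fin by (simp add: adj_def)
    have "card (f ` adj Y x) < card {..<4::nat}"
      using card_image_le[OF finadj, of f] x(2) by simp
    then have "\<not> {..<4::nat} \<subseteq> f ` adj Y x"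
      using card_mono[of "f ` adj Y x" "{..<4::nat}"] finadj by auto
    then obtain k where k: "k < 4" "k \<notin> f ` adj Y x" by blast
    have "(f(x := k)) ` Y \<subseteq> {..<4}" using f(1) k(1) by auto
    moreover have "(f(x := k)) y \<noteq> (f(x := k)) z" if "y \<in> Y" "z \<in> Y" "dist y z = 1" for y z
    proof -
      have "y \<noteq> z" using that by auto
      have new: "k \<noteq> f w" if "w \<in> Y" "dist x w = 1" for w
        using k(2) that unfolding adj_def by (auto simp: image_iff)
      consider "y = x" | "z = x" | "y \<noteq> x" "z \<noteq> x" by blast
      then show ?thesis
      proof cases
        case 1
        then show ?thesis using new[of z] that \<open>y \<noteq> z\<close> by simp
      next
        case 2
        then show ?thesis using new[of y] that dist_commute[of y x] \<open>y \<noteq> z\<close> by simp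
      next
        case 3
        then show ?thesis using f(2) that by simp
      qed
    qed
    ultimately show ?thesis by blast
  qed auto
qed

lemma chromatic_number_le: "chromatic_number X (diameter_graph_edges X) \<le> 4"
proof -
  obtain f where f: "f ` X \<subseteq> {..<4::nat}" "\<forall>x\<in>X. \<forall>y\<in>X. dist x y = 1 \<longrightarrow> f x \<noteq> f y"
    using ex_four_colouring by blast
  have "f x \<noteq> f y" if "{x, y} \<in> diameter_graph_edges X" for x y
  proof -
    obtain a b where "{x, y} = {a, b}" "a \<in> X" "b \<in> X" "dist a b = 1"
      using \<open>{x, y} \<in> diameter_graph_edges X\<close> unfolding diameter_graph_edges_def by blast
    then show ?thesis using f(2) by (metis doubleton_eq_iff)
  qed
  then have "proper_colouring X (diameter_graph_edges X) 4 f"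
    using f(1) unfolding proper_colouring_def by blast
  then show ?thesis unfolding chromatic_number_def by (intro Least_le) blast
qed

lemma edge_adj: "{x, y} \<in> diameter_graph_edges X \<Longrightarrow> x \<in> X \<and> y \<in> adj X x"
  unfolding diameter_graph_edges_def adj_def by (auto simp: doubleton_eq_iff dist_commute)

lemma odd_cycles_meet:
  assumes p: "odd_graph_cycle X (diameter_graph_edges X) p"
    and q: "odd_graph_cycle X (diameter_graph_edges X) q"
  shows "set p \<inter> set q \<noteq> {}"
proof -
  obtain d where "cone_contacts X (adj X) d" using cone_contacts_adj by blast
  then interpret cone_contacts X "adj X" d .
  define w where "w p i = p ! (i mod length p)" for p :: "(real^4) list" and i
  have walk: "odd (length p)" "w p (i + length p) = w p i" "w p i \<in> X" "w p i \<in> set p"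
      "w p (Suc i) \<in> adj X (w p i)" "w p (Suc (Suc i)) \<noteq> w p i"
    if "odd_graph_cycle X (diameter_graph_edges X) p" for p i
  proof -
    have c: "3 \<le> length p" "distinct p" "set p \<subseteq> X"
      "\<And>i. i < length p \<Longrightarrow> {p ! i, p ! ((i + 1) mod length p)} \<in> diameter_graph_edges X"
      using that unfolding odd_graph_cycle_def graph_cycle_def by auto
    show "odd (length p)" using that unfolding odd_graph_cycle_def by blast
    show "w p (i + length p) = w p i" unfolding w_def by simp
    have lt: "i mod length p < length p" for i using c(1) by (intro mod_less_divisor) linarith
    show "w p i \<in> set p" unfolding w_def using lt by simp
    then show "w p i \<in> X" using c(3) by blast
    have "w p (Suc i) = p ! ((i mod length p + 1) mod length p)"
      unfolding w_def by (simp add: mod_Suc_eq)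
    then show "w p (Suc i) \<in> adj X (w p i)" using edge_adj[OF c(4)[OF lt[of i]]] unfolding w_def by simp
    \<comment> \<open>The length is at least \<open>3\<close>, so two steps along the cycle do not lead back.\<close>
    have "Suc (Suc i) mod length p \<noteq> i mod length p"
    proof
      assume "Suc (Suc i) mod length p = i mod length p"
      then have "length p dvd Suc (Suc i) - i" using mod_eq_dvd_iff_nat[of i "Suc (Suc i)" "length p"] by simp
      then have "length p \<le> 2" by (intro dvd_imp_le) auto
      then show False using c(1) by simp
    qed
    then show "w p (Suc (Suc i)) \<noteq> w p i"
      unfolding w_def using nth_eq_iff_index_eq[OF c(2) lt lt] by blast
  qed
  obtain i j where "w p i = w q j"
    using odd_closed_walks_meet[of "length p" "w p" "length q" "w q"] walk[OF p] walk[OF q] by blast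
  then show ?thesis using walk(4)[OF p, of i] walk(4)[OF q, of j] by auto
qed

end

theorem theorem2:
  fixes r :: real and c :: "real ^ 4" and X :: "(real ^ 4) set" and n :: nat
  assumes "r > 1 / sqrt 2"
    and "finite X"
    and "X \<subseteq> sphere c r"
    and "diameter X = 1"
    and "card X = n"
  shows "card (diameter_graph_edges X) \<le> 2 * n - 2 \<and>
    chromatic_number X (diameter_graph_edges X) \<le> 4 \<and>
    (\<forall>p q. odd_graph_cycle X (diameter_graph_edges X) p \<and>
           odd_graph_cycle X (diameter_graph_edges X) q \<longrightarrow>
           set p \<inter> set q \<noteq> {})"
proof -
  interpret spherical_diameter r c X
  proof
    show "dist x y \<le> 1" if "x \<in> X" "y \<in> X" for x y
      using diameter_bounded_bound[OF finite_imp_bounded[OF assms(2)] that] assms(4) by simp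
  qed (use assms in auto)
  have "X \<noteq> {}" using assms(4) by auto
  then show ?thesis using edge_bound chromatic_number_le odd_cycles_meet assms(5) by blast
qed

end
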